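(* Let $T_1=\binom{T_{11}}{T_{21}}=\binom{T_{11}}{VD_{T_{11}}}$ be a symmetric contraction from $\mathfrak H_1$ to $\mathfrak H=\mathfrak H_1\oplus\mathfrak H_2$, let $T=(T_{ij})_{i,j=1}^2\in[\mathfrak H]$ be an extension of $T_1$ (i.e. its first column is $T_1$), $\mathcal H_2:=\overline{\mathrm{ran}}\,D_{V^*}$, $\mathcal H_2':=\overline{\mathrm{ran}}\,D_V$, and $\varphi\in[0,\pi/2]$. Then: (i) $T\in\mathrm{Ext}_{T_1}(\pi/2)$, i.e. $T$ is a contractive extension of $T_1$, if and only if $$T_{12}=D_{T_{11}}U,\qquad T_{22}=-VT_{11}^*U+D_{V^*}KD_U$$ for some contractions $U\in[\mathfrak H_2,\mathfrak H_1]$ and $K\in[\overline{\mathrm{ran}}\,D_U,\mathcal H_2]$. (ii) $T\in\mathrm{Ext}_{T_1}(\varphi)$ if and only if $T_{12}=D_{T_{11}}U$ for some $U$ in the operator ball $$U=\sin\varphi\,(\sin^2\varphi\, D_V^2+\cos^2\varphi)^{-1/2}D_V\,M\,D_{V^*}(\sin^2\varphi\, D_{V^*}^2+\cos^2\varphi)^{-1/2}+\cos^2\varphi\,(\sin^2\varphi\, D_V^2+\cos^2\varphi)^{-1}V^*,$$ with $M\in[\mathcal H_2,\mathcal H_2']$ a contraction, and (for this $U$) $T_{22}$ lies in the operator hole $$T_{22}=-VT_{11}^*U+D_{V^*}KD_U,\qquad K\in[\mathcal H_1,\mathcal H_2],\quad \|K\sin\varphi+iQ\cos\varphi\|\le1,\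 \ \|K\sin\varphi-iQ\cos\varphi\|\le1.$$ Here $\mathcal H_1=\mathcal H_1(U):=\overline{\mathrm{ran}}\,D_U$ and $Q\in[\mathcal H_1,\mathcal H_2]$ is the closure of $Q_0=D_{V^*}^{-1}(I-VU)D_U^{-1}$. For the endpoint values the description in (ii) is understood as follows: for $\varphi=\pi/2$, the ball for $U$ consists of all contractions $U\in[\mathfrak H_2,\mathfrak H_1]$ and the condition on $K$ is $\|K\|\le1$; for $\varphi=0$, $U=V^*$ and the condition on $K$ is $K=K^*$, $\|K\|\le1$.
   Context: Hilbert spaces are complex and separable; $[\mathfrak H,\mathfrak K]$ denotes bounded operators from $\mathfrak H$ to $\mathfrak K$, $[\mathfrak H]=[\mathfrak H,\mathfrak H]$. For a contraction $X$, $D_X:=(I-X^*X)^{1/2}$. A symmetric contraction $T_1\in[\mathfrak H_1,\mathfrak H]$ ($\mathfrak H_1$ a subspace of $\mathfrak H$, $\mathfrak H_2=\mathfrak H\ominus\mathfrak H_1$) is a contraction with $(T_1f,g)=(f,T_1g)$, $f,g\in\mathfrak H_1$; it has the block form $\binom{T_{11}}{T_{21}}$ with $T_{11}=T_{11}^*$ and $T_{21}=VD_{T_{11}}$, where $V\in[\mathfrak H_1,\mathfrak H_2]$ is the unique contraction with this property and $\ker V\supset\ker D_{T_{11}}$. $C_{\mathfrak H}(\varphi)$, $\varphi\in(0,\pi/2]$, is the set of $T\in[\mathfrak H]$ with $\|T\sin\varphi\pm i\cos\varphi\, I\|\le1$ for both signs ($C_{\mathfrak H}(\pi/2)$ is the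 set of all contractions); $C_{\mathfrak H}(0)$ is the set of selfadjoint contractions. $\mathrm{Ext}_{T_1}(\varphi)$ is the set of all (proper and improper) extensions $T\in C_{\mathfrak H}(\varphi)$ of $T_1$, i.e. $T|_{\mathfrak H_1}=T_1$ with no requirement on $T^*$. For $U$ as in (ii) with $0\le\varphi<\pi/2$, $Q$ is the (unique) bounded operator in $[\mathcal H_1,\mathcal H_2]$ with $I-VU=D_{V^*}QD_U$ on $\mathfrak H_2$; its existence is part of the assertion. *)

theory Defs
  imports "HOL-Analysis.Analysis"
begin

section \<open>Separable complex Hilbert spaces\<close>

text \<open>The real inner product, hence norm and topology, are those of the underlying real Hilbert
  space, so that the library of \<^class>\<open>real_inner\<close> and \<^class>\<open>banach\<close> applies.  The complex inner
  product is linear in its first argument.\<close>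

class complex_hilbert = real_inner + banach +
  fixes scaleC :: "complex \<Rightarrow> 'a \<Rightarrow> 'a"  (infixr \<open>*\<^sub>C\<close> 75)
    and cinner :: "'a \<Rightarrow> 'a \<Rightarrow> complex"
  assumes scaleC_add_right: "c *\<^sub>C (x + y) = c *\<^sub>C x + c *\<^sub>C y"
    and scaleC_add_left: "(c + d) *\<^sub>C x = c *\<^sub>C x + d *\<^sub>C x"
    and scaleC_scaleC: "c *\<^sub>C d *\<^sub>C x = (c * d) *\<^sub>C x"
    and scaleR_scaleC: "r *\<^sub>R x = complex_of_real r *\<^sub>C x"
    and cinner_commute: "cinner x y = cnj (cinner y x)"
    and cinner_add_left: "cinner (x + y) z = cinner x z + cinner y z"
    and cinner_scaleC_left: "cinner (c *\<^sub>C x) y = c * cinner x y"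
    and inner_eq_Re_cinner: "inner x y = Re (cinner x y)"
    and separable: "\<exists>D. countable D \<and> (\<forall>S. open S \<longrightarrow> S \<noteq> {} \<longrightarrow> (\<exists>d\<in>D. d \<in> S))"

text \<open>The product type carries the Hilbert space direct sum.\<close>

instantiation prod :: (complex_hilbert, complex_hilbert) complex_hilbert
begin

definition scaleC_prod_def: "c *\<^sub>C p = (c *\<^sub>C fst p, c *\<^sub>C snd p)"

definition cinner_prod_def: "cinner p q = cinner (fst p) (fst q) + cinner (snd p) (snd q)"

instance
proof
  obtain A :: "'a set" where A: "countable A" "\<And>S. open S \<Longrightarrow> S \<noteq> {} \<Longrightarrow> \<exists>d\<in>A. d \<in> S"
    using separable by metis
  obtain B :: "'b set" where B: "countable B" "\<And>S. open S \<Longrightarrow> S \<noteq> {} \<Longrightarrow> \<exists>d\<in>B. d \<in> S"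
    using separable by metis
  have "\<exists>d\<in>A \<times> B. d \<in> S" if S: "open S" "S \<noteq> {}" for S :: "('a \<times> 'b) set"
  proof -
    from S obtain p where "p \<in> S" by blast
    with S obtain S1 S2 where "open S1" "open S2" "p \<in> S1 \<times> S2" "S1 \<times> S2 \<subseteq> S"
      by (metis open_prod_elim)
    moreover from this obtain a b where "a \<in> A" "a \<in> S1" "b \<in> B" "b \<in> S2"
      using A(2)[of S1] B(2)[of S2] by blast
    ultimately show ?thesis by blast
  qed
  then show "\<exists>D. countable D \<and> (\<forall>S. open S \<longrightarrow> S \<noteq> {} \<longrightarrow> (\<exists>d\<in>D. d \<in> (S :: ('a \<times> 'b) set)))"
    using A(1) B(1) by (intro exI[of _ "A \<times> B"]) auto
next
  fix x y :: "'a \<times> 'b"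
  have "cinner (fst x) (fst y) = cnj (cinner (fst y) (fst x))"
    "cinner (snd x) (snd y) = cnj (cinner (snd y) (snd x))"
    by (rule cinner_commute)+
  then show "cinner x y = cnj (cinner y x)"
    by (simp add: cinner_prod_def)
qed (simp_all add: scaleC_prod_def cinner_prod_def scaleC_add_right scaleC_add_left scaleC_scaleC
    scaleR_scaleC scaleR_prod_def cinner_add_left cinner_scaleC_left inner_prod_def
    inner_eq_Re_cinner algebra_simps)

end

section \<open>Bounded operators between closed subspaces\<close>

text \<open>\<open>bounded_ops S S'\<close> is the set of bounded operators from the subspace \<open>S\<close> to the subspace \<open>S'\<close>.
  Outside of \<open>S\<close> an operator is set to 0, so that equality of operators is equality of functions.\<close>

definition bounded_ops ::
    "'a::complex_hilbert set \<Rightarrow> 'b::complex_hilbert set \<Rightarrow> ('a \<Rightarrow> 'b) set" where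
  "bounded_ops S S' = {A.
     (\<forall>x\<in>S. A x \<in> S') \<and> (\<forall>x. x \<notin> S \<longrightarrow> A x = 0) \<and>
     (\<forall>x\<in>S. \<forall>y\<in>S. A (x + y) = A x + A y) \<and> (\<forall>c. \<forall>x\<in>S. A (c *\<^sub>C x) = c *\<^sub>C A x) \<and>
     (\<exists>B. \<forall>x\<in>S. norm (A x) \<le> B * norm x)}"

text \<open>As in \<^const>\<open>onorm\<close>, the quotient at 0 is 0.  Meaningful only for operators bounded on \<open>S\<close>.\<close>

definition op_norm :: "'a::complex_hilbert set \<Rightarrow> ('a \<Rightarrow> 'b::complex_hilbert) \<Rightarrow> real" where
  "op_norm S A = (SUP x\<in>S. norm (A x) / norm x)"

definition contractions ::
    "'a::complex_hilbert set \<Rightarrow> 'b::complex_hilbert set \<Rightarrow> ('a \<Rightarrow> 'b) set" where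
  "contractions S S' = {A \<in> bounded_ops S S'. op_norm S A \<le> 1}"

definition adj_on ::
    "'a::complex_hilbert set \<Rightarrow> 'b::complex_hilbert set \<Rightarrow> ('a \<Rightarrow> 'b) \<Rightarrow> 'b \<Rightarrow> 'a" where
  "adj_on S S' A =
     (THE B. B \<in> bounded_ops S' S \<and> (\<forall>x\<in>S. \<forall>y\<in>S'. cinner (A x) y = cinner x (B y)))"

abbreviation adj :: "('a::complex_hilbert \<Rightarrow> 'b::complex_hilbert) \<Rightarrow> 'b \<Rightarrow> 'a" where
  "adj \<equiv> adj_on UNIV UNIV"

definition nonneg_op :: "('a::complex_hilbert \<Rightarrow> 'a) \<Rightarrow> bool" where
  "nonneg_op A \<longleftrightarrow> A \<in> bounded_ops UNIV UNIV \<and> (\<forall>x. cinner (A x) x \<in> \<real>\<^sub>\<ge>\<^sub>0)"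

definition op_sqrt :: "('a::complex_hilbert \<Rightarrow> 'a) \<Rightarrow> 'a \<Rightarrow> 'a" where
  "op_sqrt A = (THE B. nonneg_op B \<and> B \<circ> B = A)"

definition defect :: "('a::complex_hilbert \<Rightarrow> 'b::complex_hilbert) \<Rightarrow> 'a \<Rightarrow> 'a" where
  "defect X = op_sqrt (\<lambda>x. x - adj X (X x))"

definition defect_space :: "('a::complex_hilbert \<Rightarrow> 'b::complex_hilbert) \<Rightarrow> 'a set" where
  "defect_space X = closure (range (defect X))"

section \<open>The classes of extensions\<close>

text \<open>The first summand of the product is regarded as a subspace via \<open>f \<mapsto> (f, 0)\<close>.\<close>

definition symmetric_contraction ::
    "('a::complex_hilbert \<Rightarrow> 'a \<times> 'b::complex_hilbert) \<Rightarrow> bool" where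
  "symmetric_contraction T\<^sub>1 \<longleftrightarrow>
     T\<^sub>1 \<in> contractions UNIV UNIV \<and> (\<forall>f g. cinner (T\<^sub>1 f) (g, 0) = cinner (f, 0) (T\<^sub>1 g))"

definition C_class :: "real \<Rightarrow> ('h::complex_hilbert \<Rightarrow> 'h) set" where
  "C_class \<phi> =
     (if \<phi> = 0 then {T \<in> contractions UNIV UNIV. adj T = T}
      else {T \<in> bounded_ops UNIV UNIV.
        op_norm UNIV (\<lambda>x. sin \<phi> *\<^sub>R T x + (\<i> * complex_of_real (cos \<phi>)) *\<^sub>C x) \<le> 1 \<and>
        op_norm UNIV (\<lambda>x. sin \<phi> *\<^sub>R T x - (\<i> * complex_of_real (cos \<phi>)) *\<^sub>C x) \<le> 1})"

definition extends ::
    "('a::complex_hilbert \<times> 'b::complex_hilbert \<Rightarrow> 'a \<times> 'b) \<Rightarrow> ('a \<Rightarrow> 'a \<times> 'b) \<Rightarrow> bool" where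
  "extends T T\<^sub>1 \<longleftrightarrow> (\<forall>f. T (f, 0) = T\<^sub>1 f)"

definition Ext ::
    "('a::complex_hilbert \<Rightarrow> 'a \<times> 'b::complex_hilbert) \<Rightarrow> real \<Rightarrow> ('a \<times> 'b \<Rightarrow> 'a \<times> 'b) set" where
  "Ext T\<^sub>1 \<phi> = {T \<in> C_class \<phi>. extends T T\<^sub>1}"

definition block12 ::
    "('a::complex_hilbert \<times> 'b::complex_hilbert \<Rightarrow> 'a \<times> 'b) \<Rightarrow> 'b \<Rightarrow> 'a" where
  "block12 T = (\<lambda>h. fst (T (0, h)))"

definition block22 ::
    "('a::complex_hilbert \<times> 'b::complex_hilbert \<Rightarrow> 'a \<times> 'b) \<Rightarrow> 'b \<Rightarrow> 'b" where
  "block22 T = (\<lambda>h. snd (T (0, h)))"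

section \<open>The operator ball and the operator hole\<close>

definition ball_weight ::
    "real \<Rightarrow> ('a::complex_hilbert \<Rightarrow> 'b::complex_hilbert) \<Rightarrow> 'a \<Rightarrow> 'a" where
  "ball_weight \<phi> X = (\<lambda>x. (sin \<phi>)\<^sup>2 *\<^sub>R defect X (defect X x) + (cos \<phi>)\<^sup>2 *\<^sub>R x)"

definition operator_ball ::
    "real \<Rightarrow> ('a::complex_hilbert \<Rightarrow> 'b::complex_hilbert) \<Rightarrow> ('b \<Rightarrow> 'a) set" where
  "operator_ball \<phi> V =
     (if \<phi> = pi / 2 then contractions UNIV UNIV
      else if \<phi> = 0 then {adj V}
      else {U. \<exists>M \<in> contractions (defect_space (adj V)) (defect_space V).
        U = (\<lambda>h. sin \<phi> *\<^sub>R inv (op_sqrt (ball_weight \<phi> V)) (defect V (M (defect (adj V)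
                     (inv (op_sqrt (ball_weight \<phi> (adj V))) h))))
               + (cos \<phi>)\<^sup>2 *\<^sub>R inv (ball_weight \<phi> V) (adj V h))})"

text \<open>The graph of the partially defined operator \<open>D\<^bsub>V*\<^esub>\<^sup>-\<^sup>1 (I - V U) D\<^bsub>U\<^esub>\<^sup>-\<^sup>1\<close>, the inverses being those
  of the restrictions of the selfadjoint operators to the closures of their ranges, where they are
  injective.\<close>

definition Q0_graph ::
    "('a::complex_hilbert \<Rightarrow> 'b::complex_hilbert) \<Rightarrow> ('b \<Rightarrow> 'a) \<Rightarrow> ('b \<times> 'b) set" where
  "Q0_graph V U = {(defect U h, k) | h k.
     h \<in> defect_space U \<and> k \<in> defect_space (adj V) \<and> h - V (U h) = defect (adj V) k}"

definition is_Q ::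
    "('a::complex_hilbert \<Rightarrow> 'b::complex_hilbert) \<Rightarrow> ('b \<Rightarrow> 'a) \<Rightarrow> ('b \<Rightarrow> 'b) \<Rightarrow> bool" where
  "is_Q V U Q \<longleftrightarrow> Q \<in> bounded_ops (defect_space U) (defect_space (adj V)) \<and>
     (\<forall>h. h - V (U h) = defect (adj V) (Q (defect U h)))"

definition Q_op ::
    "('a::complex_hilbert \<Rightarrow> 'b::complex_hilbert) \<Rightarrow> ('b \<Rightarrow> 'a) \<Rightarrow> 'b \<Rightarrow> 'b" where
  "Q_op V U = (THE Q. is_Q V U Q)"

definition operator_hole ::
    "real \<Rightarrow> ('a::complex_hilbert \<Rightarrow> 'b::complex_hilbert) \<Rightarrow> ('b \<Rightarrow> 'a) \<Rightarrow> ('b \<Rightarrow> 'b) set" where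
  "operator_hole \<phi> V U = {K \<in> bounded_ops (defect_space U) (defect_space (adj V)).
     (if \<phi> = pi / 2 then op_norm (defect_space U) K \<le> 1
      else if \<phi> = 0 then
        adj_on (defect_space U) (defect_space (adj V)) K = K \<and> op_norm (defect_space U) K \<le> 1
      else
        op_norm (defect_space U)
          (\<lambda>x. sin \<phi> *\<^sub>R K x + (\<i> * complex_of_real (cos \<phi>)) *\<^sub>C Q_op V U x) \<le> 1 \<and>
        op_norm (defect_space U)
          (\<lambda>x. sin \<phi> *\<^sub>R K x - (\<i> * complex_of_real (cos \<phi>)) *\<^sub>C Q_op V U x) \<le> 1)}"

end

theory Submission
  imports Defs
begin

text \<open>Let \<open>D\<close> be the defect operator of \<open>A = T\<^sub>1\<^sub>1\<close>. Two applications of Douglas' lemma give the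
  parametrization (i).  With \<open>y = D f - A U h\<close>, \<open>k = K D\<^sub>U h\<close> and \<open>z = D\<^sub>V y - V*k\<close> one has
  \<open>\<parallel>x\<parallel>\<^sup>2 - \<parallel>T x\<parallel>\<^sup>2 = \<parallel>D\<^sub>U h\<parallel>\<^sup>2 - \<parallel>k\<parallel>\<^sup>2 + \<parallel>z\<parallel>\<^sup>2\<close> and
  \<open>Im (T x, x) = Im (y, V*h - U h) + Im (D\<^bsub>V*\<^esub>k, h)\<close> for \<open>x = (f, h)\<close>, while \<open>T\<close> is of class
  \<open>C(\<phi>)\<close> iff it is a contraction with
  \<open>2 cos \<phi> \<bar>Im (T x, x)\<bar> \<le> sin \<phi> (\<parallel>x\<parallel>\<^sup>2 - \<parallel>T x\<parallel>\<^sup>2)\<close>.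
  For \<open>\<phi> < \<pi>/2\<close> this forces \<open>V* - U = D\<^sub>V X\<close> with \<open>cos \<phi> \<parallel>X h\<parallel> \<le> sin \<phi> \<parallel>D\<^sub>U h\<parallel>\<close>, and completing the
  square identifies the operators \<open>U\<close> with such a factorization as the operator ball.  For them
  \<open>Q D\<^sub>U = V X + D\<^bsub>V*\<^esub>\<close>, since
  \<open>D\<^bsub>V*\<^esub>(V X + D\<^bsub>V*\<^esub>) = V D\<^sub>V X + I - V V* = I - V U\<close>, and \<open>\<parallel>Q D\<^sub>U h\<parallel>\<^sup>2 = \<parallel>X h\<parallel>\<^sup>2 + \<parallel>D\<^sub>U h\<parallel>\<^sup>2\<close>.
  Finally \<open>Im (T x, x) = Im (z, X h) + Im (k, Q D\<^sub>U h)\<close>, and minimizing over \<open>z\<close> turns the inequality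
  above into the condition on \<open>K\<close>.\<close>

section \<open>Complex inner products\<close>

text \<open>In the form identities \<open>y\<close> runs only over the range of \<open>D\<close>
  shifted by \<open>A U h\<close>, whereas the minimization needs arbitrary vectors. Choosing
  \<open>U\<close> with values in the closure of that range keeps the shift inside it, and the
  hypothesis that \<open>V\<close> vanishes on the kernel of \<open>D\<close> makes the inequalities
  stable under adding kernel vectors. The factorization through \<open>D_V\<close> comes from
  comparing degrees: one side of the estimate is affine in \<open>y\<close>, the other is quadratic
  in \<open>D_V y\<close>. Testing on \<open>norm (D_V y) \<le> 1\<close> therefore bounds the
  adjoint of \<open>V* - U\<close> at \<open>y\<close> by a multiple of \<open>norm (D_V y)\<close>,
  which is the input of Douglas' lemma. The optimal \<open>z\<close> carries the factor
  \<open>cos \<phi> / sin \<phi>\<close>. At \<open>\<phi> = 0\<close> this breaks down, and the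
  quadratic inequality loses the condition \<open>Im (k, Q D_U h) = 0\<close>, because it occurs
  there with the factor \<open>sin \<phi>\<close>. That linear condition is therefore carried along
  separately in both directions.\<close>

lemma scaleC_one [simp]: "1 *\<^sub>C (x::'a::complex_hilbert) = x"
  using scaleR_scaleC[of 1 x] by simp

lemma scaleC_zero_left [simp]: "0 *\<^sub>C (x::'a::complex_hilbert) = 0"
  using scaleR_scaleC[of 0 x] by simp

lemma scaleC_zero_right [simp]: "c *\<^sub>C (0::'a::complex_hilbert) = 0"
  using scaleC_add_right[of c "0::'a" 0] by simp

lemma scaleC_minus_one: "(-1) *\<^sub>C (x::'a::complex_hilbert) = - x"
  using scaleR_scaleC[of "-1" x] by simp

lemma scaleC_minus_right: "c *\<^sub>C (- x) = - (c *\<^sub>C (x::'a::complex_hilbert))"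
  using scaleC_add_right[of c x "-x"] by (simp add: eq_neg_iff_add_eq_0 add.commute)

lemma scaleC_diff_right: "c *\<^sub>C (x - y) = c *\<^sub>C x - c *\<^sub>C (y::'a::complex_hilbert)"
  using scaleC_add_right[of c x "-y"] by (simp add: scaleC_minus_right)

lemma cinner_zero_left [simp]: "cinner 0 (x::'a::complex_hilbert) = 0"
  using cinner_add_left[of 0 0 x] by simp

lemma cinner_zero_right [simp]: "cinner (x::'a::complex_hilbert) 0 = 0"
  using cinner_commute[of x 0] by simp

lemma cinner_add_right: "cinner (x::'a::complex_hilbert) (y + z) = cinner x y + cinner x z"
  by (metis cinner_add_left cinner_commute complex_cnj_add)

lemma cinner_scaleC_right: "cinner (x::'a::complex_hilbert) (c *\<^sub>C y) = cnj c * cinner x y"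
  by (metis cinner_scaleC_left cinner_commute complex_cnj_mult)

lemma cinner_minus_left: "cinner (- x) (y::'a::complex_hilbert) = - cinner x y"
  using cinner_scaleC_left[of "-1" x y] by (simp add: scaleC_minus_one)

lemma cinner_minus_right: "cinner (x::'a::complex_hilbert) (- y) = - cinner x y"
  using cinner_scaleC_right[of x "-1" y] by (simp add: scaleC_minus_one)

lemma cinner_diff_left: "cinner (x - y) (z::'a::complex_hilbert) = cinner x z - cinner y z"
  using cinner_add_left[of x "-y" z] by (simp add: cinner_minus_left)

lemma cinner_diff_right: "cinner (x::'a::complex_hilbert) (y - z) = cinner x y - cinner x z"
  using cinner_add_right[of x y "-z"] by (simp add: cinner_minus_right)

lemma cinner_scaleR_left: "cinner (r *\<^sub>R x) (y::'a::complex_hilbert) = of_real r * cinner x y"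
  by (simp add: scaleR_scaleC cinner_scaleC_left)

lemma cinner_scaleR_right: "cinner (x::'a::complex_hilbert) (r *\<^sub>R y) = of_real r * cinner x y"
  by (simp add: scaleR_scaleC cinner_scaleC_right)

lemmas cinner_simps = cinner_add_left cinner_add_right cinner_diff_left cinner_diff_right
  cinner_minus_left cinner_minus_right cinner_scaleC_left cinner_scaleC_right
  cinner_scaleR_left cinner_scaleR_right

lemma cinner_self: "cinner x x = of_real ((norm (x::'a::complex_hilbert))\<^sup>2)"
proof -
  have "Im (cinner x x) = 0"
    using arg_cong[OF cinner_commute[of x x], of Im] by simp
  then show ?thesis
    by (simp add: complex_eq_iff power2_norm_eq_inner inner_eq_Re_cinner)
qed

lemma norm_scaleC: "norm (c *\<^sub>C x) = cmod c * norm (x::'a::complex_hilbert)"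
proof -
  have "of_real ((norm (c *\<^sub>C x))\<^sup>2) = (of_real ((cmod c * norm x)\<^sup>2) :: complex)"
    unfolding cinner_self[symmetric] cinner_scaleC_left cinner_scaleC_right
    by (simp add: cinner_self power_mult_distrib complex_norm_square[unfolded of_real_power] mult.commute)
  then have "(norm (c *\<^sub>C x))\<^sup>2 = (cmod c * norm x)\<^sup>2"
    using of_real_eq_iff by blast
  then show ?thesis by (simp add: power2_eq_iff_nonneg)
qed

text \<open>The real inner product gives only the real part; rotating one argument by
  \<open>\<i>\<close> recovers the imaginary part. This transfers continuity from
  \<open>inner\<close> to \<open>cinner\<close>.\<close>

lemma cinner_complex_inner: "cinner x y = Complex (inner x y) (- inner (\<i> *\<^sub>C x) (y::'a::complex_hilbert))"
  by (simp add: complex_eq_iff inner_eq_Re_cinner cinner_scaleC_left)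

lemma cmod_cinner_le: "cmod (cinner x y) \<le> norm x * norm (y::'a::complex_hilbert)"
proof (cases "cinner x y = 0")
  case False
  \<comment> \<open>The phase that turns \<open>cinner x y\<close> into its modulus, so that the
    real Cauchy-Schwarz inequality suffices.\<close>
  define u where "u = cnj (cinner x y) / of_real (cmod (cinner x y))"
  have "inner (u *\<^sub>C x) y = cmod (cinner x y)"
    using False unfolding inner_eq_Re_cinner cinner_scaleC_left u_def
    by (simp add: complex_norm_square[symmetric] mult.commute power2_eq_square)
  moreover have "inner (u *\<^sub>C x) y \<le> norm (u *\<^sub>C x) * norm y" by (rule norm_cauchy_schwarz)
  moreover have "cmod u = 1" using False by (simp add: u_def norm_divide)
  ultimately show ?thesis by (simp add: norm_scaleC)
qed simp

lemma cinner_ext_right: "(\<And>z. cinner z x = cinner z y) \<Longrightarrow> x = (y::'a::complex_hilbert)"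
proof -
  assume "\<And>z. cinner z x = cinner z y"
  then have "cinner (x - y) (x - y) = 0" by (simp add: cinner_diff_right)
  then show ?thesis by (simp add: cinner_self)
qed

lemma cinner_eq_zero_iff_commute: "cinner x (y::'a::complex_hilbert) = 0 \<longleftrightarrow> cinner y x = 0"
  by (metis cinner_commute complex_cnj_zero)

lemma norm_add_sq: "(norm (x + y))\<^sup>2 = (norm x)\<^sup>2 + (norm y)\<^sup>2 + 2 * Re (cinner x (y::'a::complex_hilbert))"
  by (simp add: power2_norm_eq_inner inner_add_left inner_add_right inner_commute
      inner_eq_Re_cinner[of x y, symmetric])

lemma norm_diff_sq: "(norm (x - y))\<^sup>2 = (norm x)\<^sup>2 + (norm y)\<^sup>2 - 2 * Re (cinner x (y::'a::complex_hilbert))"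
  using norm_add_sq[of x "-y"] by (simp add: cinner_minus_right)

lemma continuous_on_scaleC [continuous_intros]:
  assumes "continuous_on S f"
  shows "continuous_on S (\<lambda>x. c *\<^sub>C (f x :: 'a::complex_hilbert))"
proof -
  have "bounded_linear ((*\<^sub>C) c :: 'a \<Rightarrow> 'a)"
    by (rule bounded_linear_intro[of _ "cmod c"])
       (simp_all add: scaleC_add_right scaleR_scaleC scaleC_scaleC norm_scaleC mult.commute)
  then show ?thesis using assms by (rule bounded_linear.continuous_on)
qed

lemma continuous_on_Complex:
  "continuous_on S f \<Longrightarrow> continuous_on S g \<Longrightarrow> continuous_on S (\<lambda>x. Complex (f x) (g x))"
  unfolding complex_eq by (auto intro!: continuous_intros)

lemma continuous_on_cinner [continuous_intros]:
  assumes "continuous_on S f" "continuous_on S g"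
  shows "continuous_on S (\<lambda>x. cinner (f x) (g x :: 'a::complex_hilbert))"
  unfolding cinner_complex_inner by (intro continuous_intros continuous_on_Complex assms)

section \<open>Closed subspaces\<close>

definition csubspace :: "'a::complex_hilbert set \<Rightarrow> bool" where
  "csubspace S \<longleftrightarrow> 0 \<in> S \<and> (\<forall>x\<in>S. \<forall>y\<in>S. x + y \<in> S) \<and> (\<forall>c. \<forall>x\<in>S. c *\<^sub>C x \<in> S)"

lemma csubspace_0: "csubspace S \<Longrightarrow> 0 \<in> S"
  and csubspace_add: "csubspace S \<Longrightarrow> x \<in> S \<Longrightarrow> y \<in> S \<Longrightarrow> x + y \<in> S"
  and csubspace_scaleC: "csubspace S \<Longrightarrow> x \<in> S \<Longrightarrow> c *\<^sub>C x \<in> S"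
  by (auto simp: csubspace_def)

lemma csubspace_scaleR: "csubspace S \<Longrightarrow> x \<in> S \<Longrightarrow> r *\<^sub>R x \<in> S"
  by (simp add: scaleR_scaleC csubspace_scaleC)

lemma csubspace_minus: "csubspace S \<Longrightarrow> x \<in> S \<Longrightarrow> - x \<in> S"
  using csubspace_scaleC[of S x "-1"] by (simp add: scaleC_minus_one)

lemma csubspace_diff: "csubspace S \<Longrightarrow> x \<in> S \<Longrightarrow> y \<in> S \<Longrightarrow> x - y \<in> S"
  using csubspace_add[of S x "-y"] csubspace_minus[of S y] by simp

lemma csubspace_UNIV [simp]: "csubspace UNIV"
  by (simp add: csubspace_def)

lemma csubspace_closure:
  fixes S :: "'a::complex_hilbert set"
  assumes "csubspace S"
  shows "csubspace (closure S)"
  unfolding csubspace_def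
proof (intro conjI ballI allI)
  show "0 \<in> closure S" using csubspace_0[OF assms] closure_subset by blast
next
  fix x y assume "x \<in> closure S" "y \<in> closure S"
  then obtain a b where "\<forall>n. a n \<in> S" "a \<longlonglongrightarrow> x" "\<forall>n. b n \<in> S" "b \<longlonglongrightarrow> y"
    unfolding closure_sequential by blast
  then show "x + y \<in> closure S"
    unfolding closure_sequential
    by (intro exI[of _ "\<lambda>n. a n + b n"]) (auto intro!: tendsto_add csubspace_add[OF assms])
next
  fix c and x assume "x \<in> closure S"
  moreover have "(*\<^sub>C) c ` closure S \<subseteq> closure S"
    by (rule image_closure_subset)
       (auto intro!: continuous_intros csubspace_scaleC[OF assms] subsetD[OF closure_subset])
  ultimately show "c *\<^sub>C x \<in> closure S" by auto
qed

text \<open>A minimizing sequence is Cauchy by the parallelogram law.\<close>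

lemma nearest_point_exists:
  fixes S :: "'a::complex_hilbert set"
  assumes "csubspace S" "closed S"
  obtains p where "p \<in> S" "\<And>z. z \<in> S \<Longrightarrow> norm (x - p) \<le> norm (x - z)"
proof -
  define d where "d = (INF z\<in>S. norm (x - z))"
  have bdd: "bdd_below ((\<lambda>z. norm (x - z)) ` S)"
    by (rule bdd_belowI[of _ 0]) auto
  have ne: "S \<noteq> {}" using csubspace_0[OF assms(1)] by auto
  have dle: "d \<le> norm (x - z)" if "z \<in> S" for z
    unfolding d_def using that bdd by (rule cINF_lower[rotated])
  have d0: "0 \<le> d"
    unfolding d_def by (rule cINF_greatest[OF ne]) simp
  have "\<exists>z\<in>S. norm (x - z) < d + 1 / Suc n" for n
    using cINF_less_iff[OF ne bdd, of "d + 1 / Suc n"] by (simp add: d_def[symmetric])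
  then obtain z where z: "z n \<in> S" "norm (x - z n) < d + 1 / Suc n" for n by metis
  have par: "(norm (a - b))\<^sup>2 \<le> 2 * (norm (x - a))\<^sup>2 + 2 * (norm (x - b))\<^sup>2 - 4 * d\<^sup>2"
    if "a \<in> S" "b \<in> S" for a b
  proof -
    have "(1/2) *\<^sub>R (a + b) \<in> S"
      using that assms(1) by (simp add: csubspace_add csubspace_scaleR)
    then have "d \<le> norm (x - (1/2) *\<^sub>R (a + b))" by (rule dle)
    then have "d\<^sup>2 \<le> (norm (x - (1/2) *\<^sub>R (a + b)))\<^sup>2" using d0 by (simp add: power_mono)
    moreover have "4 * (norm (x - (1/2) *\<^sub>R (a + b)))\<^sup>2 + (norm (a - b))\<^sup>2
        = 2 * (norm (x - a))\<^sup>2 + 2 * (norm (x - b))\<^sup>2"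
      by (simp add: power2_norm_eq_inner inner_simps inner_commute algebra_simps)
    ultimately show ?thesis by linarith
  qed
  have lim: "(\<lambda>n. norm (x - z n)) \<longlonglongrightarrow> d"
  proof (rule tendsto_sandwich[of "\<lambda>_. d" _ _ "\<lambda>n. d + 1 / Suc n"])
    show "(\<lambda>n. d + 1 / real (Suc n)) \<longlonglongrightarrow> d"
      using tendsto_add[OF tendsto_const LIMSEQ_inverse_real_of_nat, of d]
      by (simp add: inverse_eq_divide)
  qed (use z dle in \<open>auto intro!: always_eventually less_imp_le\<close>)
  have "Cauchy z"
  proof (rule metric_CauchyI)
    fix e :: real assume "e > 0"
    have "(\<lambda>n. 2 * (norm (x - z n))\<^sup>2) \<longlonglongrightarrow> 2 * d\<^sup>2"
      by (intro tendsto_intros lim)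
    then have "eventually (\<lambda>n. 2 * (norm (x - z n))\<^sup>2 < 2 * d\<^sup>2 + e\<^sup>2 / 2) sequentially"
      by (rule order_tendstoD) (use \<open>e > 0\<close> in simp)
    then obtain N where N: "\<And>n. n \<ge> N \<Longrightarrow> 2 * (norm (x - z n))\<^sup>2 < 2 * d\<^sup>2 + e\<^sup>2 / 2"
      unfolding eventually_sequentially by blast
    have "dist (z m) (z n) < e" if "m \<ge> N" "n \<ge> N" for m n
    proof -
      have "(norm (z m - z n))\<^sup>2 < e\<^sup>2"
        using par[OF z(1) z(1), of m n] N[OF that(1)] N[OF that(2)] by linarith
      then show ?thesis using \<open>e > 0\<close> by (simp add: dist_norm power2_less_imp_less)
    qed
    then show "\<exists>M. \<forall>m\<ge>M. \<forall>n\<ge>M. dist (z m) (z n) < e" by blast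
  qed
  then obtain p where p: "z \<longlonglongrightarrow> p" using Cauchy_convergent convergent_def by blast
  have "p \<in> S" using closed_sequentially[OF assms(2)] z(1) p by blast
  moreover have "norm (x - p) = d"
    by (rule LIMSEQ_unique[OF _ lim]) (intro tendsto_intros p)
  ultimately show thesis using that dle by blast
qed

lemma inner_eq_0_of_nearest:
  fixes u v :: "'a::real_inner"
  assumes "\<And>t. norm u \<le> norm (u - t *\<^sub>R v)"
  shows "inner u v = 0"
proof (cases "v = 0")
  case False
  \<comment> \<open>The minimizer of the quadratic polynomial \<open>norm (u - t v)^2\<close> in
    \<open>t\<close>.\<close>
  define t where "t = inner u v / (norm v)\<^sup>2"
  have "(norm u)\<^sup>2 \<le> (norm (u - t *\<^sub>R v))\<^sup>2" using assms[of t] by (simp add: power_mono)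
  also have "\<dots> = (norm u)\<^sup>2 - 2 * t * inner u v + t\<^sup>2 * (norm v)\<^sup>2"
    unfolding power2_norm_eq_inner
    by (simp add: inner_simps inner_commute power2_eq_square)
  also have "\<dots> = (norm u)\<^sup>2 - (inner u v)\<^sup>2 / (norm v)\<^sup>2"
    using False by (simp add: t_def field_simps power2_eq_square)
  finally show ?thesis using False by (simp add: field_simps)
qed simp

lemma orthogonal_decomposition:
  fixes S :: "'a::complex_hilbert set"
  assumes "csubspace S" "closed S"
  shows "\<exists>p\<in>S. \<forall>z\<in>S. cinner (x - p) z = 0"
proof -
  obtain p where p: "p \<in> S" "\<And>z. z \<in> S \<Longrightarrow> norm (x - p) \<le> norm (x - z)"
    using nearest_point_exists[OF assms] by blast
  have in0: "inner (x - p) z = 0" if "z \<in> S" for z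
  proof (rule inner_eq_0_of_nearest)
    fix t show "norm (x - p) \<le> norm (x - p - t *\<^sub>R z)"
      using p(2)[of "p + t *\<^sub>R z"] p(1) that assms(1)
      by (simp add: csubspace_add csubspace_scaleR diff_diff_eq)
  qed
  have "cinner (x - p) z = 0" if "z \<in> S" for z
  proof -
    \<comment> \<open>Minimality yields only real orthogonality; as \<open>S\<close> is a complex
      subspace, testing with a rotated vector removes the imaginary part too.\<close>
    have "inner (x - p) (\<i> *\<^sub>C z) = 0" using that assms(1) by (intro in0 csubspace_scaleC)
    then show ?thesis using in0[OF that]
      by (simp add: inner_eq_Re_cinner cinner_scaleC_right complex_eq_iff)
  qed
  with p(1) show ?thesis by blast
qed

definition proj :: "'a::complex_hilbert set \<Rightarrow> 'a \<Rightarrow> 'a" where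
  "proj S x = (SOME p. p \<in> S \<and> (\<forall>z\<in>S. cinner (x - p) z = 0))"

lemma
  assumes "csubspace S" "closed S"
  shows proj_in: "proj S x \<in> S"
    and proj_orth: "z \<in> S \<Longrightarrow> cinner (x - proj S x) z = 0"
proof -
  have "proj S x \<in> S \<and> (\<forall>z\<in>S. cinner (x - proj S x) z = 0)"
    unfolding proj_def by (rule someI_ex) (use orthogonal_decomposition[OF assms] in blast)
  then show "proj S x \<in> S" "z \<in> S \<Longrightarrow> cinner (x - proj S x) z = 0" by auto
qed

lemma proj_eqI:
  assumes S: "csubspace S" "closed S" and "p \<in> S" "\<And>z. z \<in> S \<Longrightarrow> cinner (x - p) z = 0"
  shows "proj S x = p"
proof -
  have m: "proj S x - p \<in> S" using assms proj_in[OF S] by (simp add: csubspace_diff)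
  have "cinner (proj S x - p) (proj S x - p)
      = cinner (x - p) (proj S x - p) - cinner (x - proj S x) (proj S x - p)"
    by (simp add: cinner_diff_left)
  also have "\<dots> = 0" using assms(4)[OF m] proj_orth[OF S m] by simp
  finally show ?thesis by (simp add: cinner_self)
qed

lemma proj_same: "csubspace S \<Longrightarrow> closed S \<Longrightarrow> x \<in> S \<Longrightarrow> proj S x = x"
  by (rule proj_eqI) auto

lemma proj_add:
  assumes "csubspace S" "closed S"
  shows "proj S (x + y) = proj S x + proj S y"
  by (rule proj_eqI[OF assms])
     (use assms in \<open>auto simp: proj_in csubspace_add add_diff_add cinner_add_left proj_orth\<close>)

lemma proj_scaleC:
  assumes "csubspace S" "closed S"
  shows "proj S (c *\<^sub>C x) = c *\<^sub>C proj S x"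
  by (rule proj_eqI[OF assms])
     (use assms in \<open>auto simp: proj_in csubspace_scaleC scaleC_diff_right[symmetric]
       cinner_scaleC_left proj_orth\<close>)

lemma norm_proj_le:
  assumes "csubspace S" "closed S"
  shows "norm (proj S x) \<le> norm x"
proof -
  have "(norm x)\<^sup>2 = (norm (proj S x))\<^sup>2 + (norm (x - proj S x))\<^sup>2"
    using norm_add_sq[of "x - proj S x" "proj S x"] proj_orth[OF assms proj_in[OF assms], of x x]
    by simp
  then show ?thesis by (metis le_add_same_cancel1 zero_le_power2 power2_le_imp_le norm_ge_zero)
qed

section \<open>Bounded operators\<close>

abbreviation ops :: "('a::complex_hilbert \<Rightarrow> 'b::complex_hilbert) set" where
  "ops \<equiv> bounded_ops UNIV UNIV"

lemma opsI:
  assumes "\<And>x y. A (x + y) = A x + A y" "\<And>c x. A (c *\<^sub>C x) = c *\<^sub>C A x"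
    and "\<And>x. norm (A x) \<le> B * norm x"
  shows "A \<in> ops"
  using assms unfolding bounded_ops_def by blast

lemma
  assumes "A \<in> ops"
  shows op_add: "A (x + y) = A x + A y"
    and op_scaleC: "A (c *\<^sub>C x) = c *\<^sub>C A x"
  using assms by (auto simp: bounded_ops_def)

lemma op_zero: "A \<in> ops \<Longrightarrow> A 0 = 0"
  using op_scaleC[of A 0 0] by simp

lemma op_minus: "A \<in> ops \<Longrightarrow> A (- x) = - A x"
  using op_scaleC[of A "-1" x] by (simp add: scaleC_minus_one)

lemma op_diff: "A \<in> ops \<Longrightarrow> A (x - y) = A x - A y"
  using op_add[of A x "-y"] by (simp add: op_minus)

lemma op_scaleR: "A \<in> ops \<Longrightarrow> A (r *\<^sub>R x) = r *\<^sub>R A x"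
  by (simp add: scaleR_scaleC op_scaleC)

lemmas op_simps = op_add op_diff op_minus op_zero op_scaleC op_scaleR

lemma op_bound:
  assumes "A \<in> ops"
  obtains B where "B \<ge> 0" "\<And>x. norm (A x) \<le> B * norm x"
proof -
  obtain B where B: "norm (A x) \<le> B * norm x" for x
    using assms by (auto simp: bounded_ops_def)
  have "norm (A x) \<le> max B 0 * norm x" for x
    using B[of x] mult_right_mono[of B "max B 0" "norm x"] by simp
  then show thesis by (intro that[of "max B 0"]) auto
qed

lemma op_bounded_linear:
  assumes "A \<in> ops"
  shows "bounded_linear A"
proof -
  obtain B where "\<And>x. norm (A x) \<le> B * norm x" using op_bound[OF assms] by blast
  then show ?thesis
    by (intro bounded_linear_intro[of _ B]) (auto simp: op_simps[OF assms] mult.commute)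
qed

lemma op_continuous_on:
  "A \<in> ops \<Longrightarrow> continuous_on S f \<Longrightarrow> continuous_on S (\<lambda>x. A (f x))"
  by (rule bounded_linear.continuous_on[OF op_bounded_linear])

lemma op_tendsto: "A \<in> ops \<Longrightarrow> (f \<longlongrightarrow> l) F \<Longrightarrow> ((\<lambda>x. A (f x)) \<longlongrightarrow> A l) F"
  by (rule bounded_linear.tendsto[OF op_bounded_linear])

lemma ops_id: "(\<lambda>x. x) \<in> ops"
  by (rule opsI[of _ 1]) auto

lemma ops_zero: "(\<lambda>x. 0) \<in> ops"
  by (rule opsI[of _ 0]) auto

lemma ops_add: "A \<in> ops \<Longrightarrow> B \<in> ops \<Longrightarrow> (\<lambda>x. A x + B x) \<in> ops"
proof -
  assume AB: "A \<in> ops" "B \<in> ops"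
  obtain a b where "\<And>x. norm (A x) \<le> a * norm x" "\<And>x. norm (B x) \<le> b * norm x"
    using op_bound[OF AB(1)] op_bound[OF AB(2)] by metis
  then have "norm (A x + B x) \<le> (a + b) * norm x" for x
    using norm_triangle_mono[of "A x" "a * norm x" "B x" "b * norm x"] by (simp add: distrib_right)
  then show ?thesis
    by (intro opsI) (auto simp: op_simps[OF AB(1)] op_simps[OF AB(2)] scaleC_add_right)
qed

lemma ops_scaleC: "A \<in> ops \<Longrightarrow> (\<lambda>x. c *\<^sub>C A x) \<in> ops"
proof -
  assume A: "A \<in> ops"
  obtain a where "\<And>x. norm (A x) \<le> a * norm x" using op_bound[OF A] by metis
  then have "norm (c *\<^sub>C A x) \<le> (cmod c * a) * norm x" for x
    by (simp add: norm_scaleC mult.assoc mult_left_mono)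
  then show ?thesis
    by (intro opsI[of _ "cmod c * a"])
       (auto simp: op_simps[OF A] scaleC_add_right scaleC_scaleC mult.commute[of c])
qed

lemma ops_scaleR: "A \<in> ops \<Longrightarrow> (\<lambda>x. r *\<^sub>R A x) \<in> ops"
  unfolding scaleR_scaleC by (rule ops_scaleC)

lemma ops_minus: "A \<in> ops \<Longrightarrow> (\<lambda>x. - A x) \<in> ops"
  using ops_scaleC[of A "-1"] by (simp add: scaleC_minus_one)

lemma ops_diff: "A \<in> ops \<Longrightarrow> B \<in> ops \<Longrightarrow> (\<lambda>x. A x - B x) \<in> ops"
  using ops_add[of A "\<lambda>x. - B x"] ops_minus[of B] by simp

lemma ops_comp: "A \<in> ops \<Longrightarrow> B \<in> ops \<Longrightarrow> (\<lambda>x. A (B x)) \<in> ops"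
proof -
  assume AB: "A \<in> ops" "B \<in> ops"
  obtain a where a: "a \<ge> 0" "\<And>x. norm (A x) \<le> a * norm x" using op_bound[OF AB(1)] by metis
  obtain b where b: "\<And>x. norm (B x) \<le> b * norm x" using op_bound[OF AB(2)] by metis
  have "norm (A (B x)) \<le> (a * b) * norm x" for x
    using a(2)[of "B x"] mult_left_mono[OF b[of x] a(1)] by (simp add: mult.assoc)
  then show ?thesis
    by (intro opsI) (auto simp: op_simps[OF AB(1)] op_simps[OF AB(2)])
qed

lemmas ops_intros = ops_id ops_zero ops_add ops_scaleC ops_scaleR ops_minus ops_diff

lemma ops_proj: "csubspace S \<Longrightarrow> closed S \<Longrightarrow> proj S \<in> ops"
  by (rule opsI[of _ 1]) (auto simp: proj_add proj_scaleC norm_proj_le)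

lemma csubspace_range: "A \<in> ops \<Longrightarrow> csubspace (range A)"
  unfolding csubspace_def
  by (auto simp: op_simps[symmetric])

section \<open>The Riesz representation theorem and adjoints\<close>

lemma riesz_representation:
  fixes f :: "'a::complex_hilbert \<Rightarrow> complex"
  assumes add: "\<And>x y. f (x + y) = f x + f y" and sc: "\<And>c x. f (c *\<^sub>C x) = c * f x"
    and bd: "\<And>x. cmod (f x) \<le> B * norm x"
  shows "\<exists>y. \<forall>x. f x = cinner x y"
proof (cases "\<forall>x. f x = 0")
  case True
  then show ?thesis by (intro exI[of _ 0]) simp
next
  case False
  then obtain u where u: "f u \<noteq> 0" by blast
  have "bounded_linear f"
    by (rule bounded_linear_intro[of _ B])
       (auto simp: add sc scaleR_scaleC bd mult.commute scaleR_conv_of_real)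
  then have "continuous_on UNIV f" by (rule linear_continuous_on)
  define S where "S = {x. f x = 0}"
  have "closed S"
    unfolding S_def by (rule closed_Collect_eq[OF \<open>continuous_on UNIV f\<close>]) auto
  have f0: "f 0 = 0" using sc[of 0 0] by simp
  have "csubspace S" unfolding csubspace_def S_def by (auto simp: add sc f0)
  note S = \<open>csubspace S\<close> \<open>closed S\<close>
  define w where "w = u - proj S u"
  have "f (proj S u) = 0" using proj_in[OF S, of u] by (simp add: S_def)
  then have fw: "f w \<noteq> 0"
    using add[of w "proj S u"] u by (simp add: w_def)
  then have w0: "w \<noteq> 0" using f0 by auto
  \<comment> \<open>The vector \<open>w\<close> spans the orthogonal complement of the kernel
    \<open>S\<close>: subtracting from \<open>x\<close> the multiple of \<open>w\<close> with the
    same value of \<open>f\<close> lands in \<open>S\<close>.\<close>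
  have "f x = cinner x ((cnj (f w) / (norm w)\<^sup>2) *\<^sub>C w)" for x
  proof -
    have "x - (f x / f w) *\<^sub>C w \<in> S"
      using add[of "x - (f x / f w) *\<^sub>C w" "(f x / f w) *\<^sub>C w"] fw by (simp add: S_def sc)
    then have "cinner w (x - (f x / f w) *\<^sub>C w) = 0" unfolding w_def by (rule proj_orth[OF S])
    then have "cinner (x - (f x / f w) *\<^sub>C w) w = 0" by (simp add: cinner_eq_zero_iff_commute)
    then have "cinner x w = (f x / f w) * (norm w)\<^sup>2"
      by (simp add: cinner_diff_left cinner_scaleC_left cinner_self)
    then show ?thesis using fw w0 by (simp add: cinner_scaleC_right)
  qed
  then show ?thesis by blast
qed

lemma adjoint_exists:
  fixes A :: "'a::complex_hilbert \<Rightarrow> 'b::complex_hilbert"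
  assumes A: "A \<in> ops"
  shows "\<exists>B\<in>ops. \<forall>x y. cinner (A x) y = cinner x (B y)"
proof -
  obtain a where a: "a \<ge> 0" "\<And>x. norm (A x) \<le> a * norm x" using op_bound[OF A] by metis
  have "\<exists>z. \<forall>x. cinner (A x) y = cinner x z" for y
  proof (rule riesz_representation[of _ "a * norm y"])
    fix x
    have "cmod (cinner (A x) y) \<le> norm (A x) * norm y" by (rule cmod_cinner_le)
    also have "\<dots> \<le> a * norm x * norm y" using a(2)[of x] by (simp add: mult_right_mono)
    finally show "cmod (cinner (A x) y) \<le> a * norm y * norm x" by (simp add: mult_ac)
  qed (auto simp: op_simps[OF A] cinner_simps)
  then obtain B where B: "\<And>x y. cinner (A x) y = cinner x (B y)" by metis
  have "norm (B y) \<le> a * norm y" for y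
  proof -
    have "(norm (B y))\<^sup>2 = Re (cinner (A (B y)) y)" by (simp add: B cinner_self)
    also have "\<dots> \<le> norm (A (B y)) * norm y"
      using complex_Re_le_cmod cmod_cinner_le order_trans by blast
    also have "\<dots> \<le> a * norm (B y) * norm y" using a(2)[of "B y"] by (simp add: mult_right_mono)
    finally have "norm (B y) * norm (B y) \<le> norm (B y) * (a * norm y)"
      by (simp add: power2_eq_square mult_ac)
    then show ?thesis
      using a(1) by (cases "B y = 0") (simp_all add: mult_le_cancel_left_pos)
  qed
  moreover have "B (x + y) = B x + B y" for x y
    by (rule cinner_ext_right) (simp add: B[symmetric] cinner_add_right)
  moreover have "B (c *\<^sub>C x) = c *\<^sub>C B x" for c x
    by (rule cinner_ext_right) (simp add: B[symmetric] cinner_scaleC_right)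
  ultimately have "B \<in> ops" by (intro opsI[of _ a])
  with B show ?thesis by blast
qed

text \<open>Two candidates differ at \<open>y\<close> by a vector of the subspace \<open>S\<close>,
  which may itself be inserted for \<open>x\<close>. Off \<open>S'\<close> both vanish by the
  convention in \<open>bounded_ops\<close>.\<close>

lemma adj_on_eqI:
  assumes "B \<in> bounded_ops S' S" and "\<And>x y. x \<in> S \<Longrightarrow> y \<in> S' \<Longrightarrow> cinner (A x) y = cinner x (B y)"
    and S: "csubspace S"
  shows "adj_on S S' A = B"
  unfolding adj_on_def
proof (rule the_equality)
  show "B \<in> bounded_ops S' S \<and> (\<forall>x\<in>S. \<forall>y\<in>S'. cinner (A x) y = cinner x (B y))"
    using assms by blast
next
  fix B' assume B': "B' \<in> bounded_ops S' S \<and> (\<forall>x\<in>S. \<forall>y\<in>S'. cinner (A x) y = cinner x (B' y))"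
  show "B' = B"
  proof
    fix y
    show "B' y = B y"
    proof (cases "y \<in> S'")
      case True
      then have "B' y - B y \<in> S"
        using B' assms(1) S by (auto simp: bounded_ops_def intro: csubspace_diff)
      then have "cinner (B' y - B y) (B' y - B y) = 0"
        using B' assms(2)[OF _ True, of "B' y - B y"] True by (auto simp: cinner_diff_right)
      then show ?thesis by (simp add: cinner_self)
    next
      case False
      then show ?thesis using B' assms(1) by (auto simp: bounded_ops_def)
    qed
  qed
qed

lemma adj_eqI:
  "B \<in> ops \<Longrightarrow> (\<And>x y. cinner (A x) y = cinner x (B y)) \<Longrightarrow> adj A = B"
  by (rule adj_on_eqI) auto

lemma
  assumes "A \<in> ops"
  shows ops_adj: "adj A \<in> ops"
    and cinner_adj_right: "cinner x (adj A y) = cinner (A x) y"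
proof -
  obtain B where B: "B \<in> ops" "\<And>x y. cinner (A x) y = cinner x (B y)"
    using adjoint_exists[OF assms] by blast
  then have "adj A = B" by (rule adj_eqI)
  with B show "adj A \<in> ops" "cinner x (adj A y) = cinner (A x) y" by auto
qed

lemma cinner_adj_left: "A \<in> ops \<Longrightarrow> cinner (adj A x) y = cinner x (A y)"
  by (metis cinner_adj_right cinner_commute)

lemma adj_adj: "A \<in> ops \<Longrightarrow> adj (adj A) = A"
  by (rule adj_eqI) (auto simp: cinner_adj_left)

lemma op_maps_closure_range:
  assumes A: "A \<in> ops" and "\<And>x. A (D x) \<in> closure (range D')" and "x \<in> closure (range D)"
  shows "A x \<in> closure (range D')"
proof -
  have "A ` closure (range D) \<subseteq> closure (range D')"
    by (rule image_closure_subset)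
       (use assms in \<open>auto intro: op_continuous_on continuous_on_id\<close>)
  then show ?thesis using assms(3) by blast
qed

lemma adj_norm_le:
  assumes A: "A \<in> ops" and "0 \<le> r" and le: "\<And>x. norm (A x) \<le> r * norm x"
  shows "norm (adj A y) \<le> r * norm y"
proof (cases "adj A y = 0")
  case False
  have "(norm (adj A y))\<^sup>2 = Re (cinner (A (adj A y)) y)"
    using cinner_self[of "adj A y"] by (simp add: cinner_adj_right[OF A])
  also have "\<dots> \<le> norm (A (adj A y)) * norm y"
    using complex_Re_le_cmod cmod_cinner_le order_trans by blast
  also have "\<dots> \<le> r * norm (adj A y) * norm y"
    using le[of "adj A y"] by (simp add: mult_right_mono)
  finally have "norm (adj A y) * norm (adj A y) \<le> norm (adj A y) * (r * norm y)"
    by (simp add: power2_eq_square mult_ac)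
  then show ?thesis using False by (simp add: mult_le_cancel_left_pos)
qed (use assms in simp)

section \<open>Square roots\<close>

definition selfadj :: "('a::complex_hilbert \<Rightarrow> 'a) \<Rightarrow> bool" where
  "selfadj A \<longleftrightarrow> A \<in> ops \<and> (\<forall>x y. cinner (A x) y = cinner x (A y))"

lemma selfadj_ops: "selfadj A \<Longrightarrow> A \<in> ops"
  and selfadj_cinner: "selfadj A \<Longrightarrow> cinner (A x) y = cinner x (A y)"
  by (auto simp: selfadj_def)

lemma selfadj_adj: "selfadj A \<Longrightarrow> adj A = A"
  by (rule adj_eqI) (auto simp: selfadj_def)

lemma selfadj_iff_adj: "A \<in> ops \<Longrightarrow> selfadj A \<longleftrightarrow> adj A = A"
  by (metis selfadj_adj selfadj_def cinner_adj_right)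

lemma polarization:
  assumes A: "A \<in> ops"
  shows "4 * cinner (A x) y = cinner (A (x + y)) (x + y) - cinner (A (x - y)) (x - y)
    + \<i> * cinner (A (x + \<i> *\<^sub>C y)) (x + \<i> *\<^sub>C y) - \<i> * cinner (A (x - \<i> *\<^sub>C y)) (x - \<i> *\<^sub>C y)"
  by (simp add: op_simps[OF A] cinner_simps algebra_simps)

text \<open>Over the complex numbers the quadratic form determines the sesquilinear form, so real
  diagonal values already force symmetry.\<close>

lemma selfadj_iff_Im: "A \<in> ops \<Longrightarrow> selfadj A \<longleftrightarrow> (\<forall>x. Im (cinner (A x) x) = 0)"
proof
  assume "selfadj A"
  then have "cinner (A x) x = cnj (cinner (A x) x)" for x
    using cinner_commute[of x "A x"] selfadj_cinner[of A x x] by simp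
  then show "\<forall>x. Im (cinner (A x) x) = 0"
    by (auto simp: complex_eq_iff dest!: spec)
next
  assume A: "A \<in> ops" and im: "\<forall>x. Im (cinner (A x) x) = 0"
  then have real: "cinner (A x) x = cinner x (A x)" for x
    using im cinner_commute[of x "A x"] by (simp add: complex_eq_iff)
  have "cinner (A x) y = cinner x (A y)" for x y
  proof -
    have "4 * cinner x (A y) = cinner (x + y) (A (x + y)) - cinner (x - y) (A (x - y))
      + \<i> * cinner (x + \<i> *\<^sub>C y) (A (x + \<i> *\<^sub>C y)) - \<i> * cinner (x - \<i> *\<^sub>C y) (A (x - \<i> *\<^sub>C y))"
      by (simp add: op_simps[OF A] cinner_simps algebra_simps)
    then have "4 * cinner (A x) y = 4 * cinner x (A y)"
      using polarization[OF A, of x y] unfolding real by (simp only:)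
    then show ?thesis by simp
  qed
  with A show "selfadj A" by (simp add: selfadj_def)
qed

lemma nonneg_selfadj: "nonneg_op A \<Longrightarrow> selfadj A"
  by (subst selfadj_iff_Im) (auto simp: nonneg_op_def complex_nonneg_Reals_iff)

lemma nonneg_op_iff: "nonneg_op A \<longleftrightarrow> selfadj A \<and> (\<forall>x. 0 \<le> Re (cinner (A x) x))"
proof
  assume "nonneg_op A"
  then show "selfadj A \<and> (\<forall>x. 0 \<le> Re (cinner (A x) x))"
    by (auto simp: nonneg_selfadj) (auto simp: nonneg_op_def complex_nonneg_Reals_iff)
next
  assume "selfadj A \<and> (\<forall>x. 0 \<le> Re (cinner (A x) x))"
  then show "nonneg_op A"
    using selfadj_iff_Im[OF selfadj_ops, of A]
    by (auto simp: nonneg_op_def complex_nonneg_Reals_iff selfadj_ops)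
qed

text \<open>A zero of a nonnegative form is a minimum, so its first variation vanishes; in the
  direction \<open>- A y\<close> that variation is \<open>-2 * (norm (A y))^2\<close>.\<close>

lemma nonneg_op_kernel:
  assumes A: "nonneg_op A" and "cinner (A y) y = 0"
  shows "A y = 0"
proof -
  have sa: "selfadj A" and op: "A \<in> ops" using A nonneg_selfadj selfadj_ops by blast+
  have pos: "0 \<le> Re (cinner (A x) x)" for x using A by (simp add: nonneg_op_iff)
  obtain b where b: "b \<ge> 0" "\<And>x. norm (A x) \<le> b * norm x" using op_bound[OF op] by blast
  define z where "z = A y"
  have "2 * (norm z)\<^sup>2 \<le> t * Re (cinner (A z) z)" if "t > 0" for t
  proof -
    have "0 \<le> Re (cinner (A (y - t *\<^sub>R z)) (y - t *\<^sub>R z))" by (rule pos)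
    also have "\<dots> = - 2 * t * (norm z)\<^sup>2 + t * t * Re (cinner (A z) z)"
      using assms(2) by (simp add: op_simps[OF op] cinner_simps z_def cinner_self
          selfadj_cinner[OF sa, of "A y" y] algebra_simps)
    finally have "t * (2 * (norm z)\<^sup>2) \<le> t * (t * Re (cinner (A z) z))" by (simp add: algebra_simps)
    then show ?thesis using that by (simp only: mult_le_cancel_left_pos)
  qed note * = this
  have "2 * (norm z)\<^sup>2 \<le> 0"
  proof (rule ccontr)
    assume n: "\<not> 2 * (norm z)\<^sup>2 \<le> 0"
    define r where "r = Re (cinner (A z) z)"
    have "r \<ge> 0" using pos by (simp add: r_def)
    \<comment> \<open>The step \<open>t\<close> is so small that the quadratic term cannot
      compensate the linear one; \<open>r + 1\<close> avoids a division by zero.\<close>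
    have "2 * (norm z)\<^sup>2 \<le> ((norm z)\<^sup>2 / (r + 1)) * r"
      unfolding r_def by (rule *) (use n \<open>r \<ge> 0\<close> in \<open>simp add: r_def\<close>)
    also have "\<dots> \<le> (norm z)\<^sup>2"
      using \<open>r \<ge> 0\<close> by (simp add: divide_le_eq mult_left_mono)
    finally show False using n by simp
  qed
  then show ?thesis by (simp add: z_def)
qed

text \<open>The scalar sequence majorizing the iteration \<open>Y \<mapsto> (S + Y\<^sup>2)/2\<close>, whose fixed point
  \<open>Y = I - (I - S)\<^bsup>1/2\<^esup>\<close> yields the square root.\<close>

fun maj_seq :: "real \<Rightarrow> nat \<Rightarrow> real" where
  "maj_seq r 0 = 0"
| "maj_seq r (Suc n) = (r + (maj_seq r n)\<^sup>2) / 2"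

fun sqrt_iter :: "('a::complex_hilbert \<Rightarrow> 'a) \<Rightarrow> nat \<Rightarrow> 'a \<Rightarrow> 'a" where
  "sqrt_iter S 0 = (\<lambda>x. 0)"
| "sqrt_iter S (Suc n) = (\<lambda>x. (1/2) *\<^sub>R (S x + sqrt_iter S n (sqrt_iter S n x)))"

text \<open>The bound \<open>1 - sqrt (1 - r)\<close> is the smaller fixed point of
  \<open>t \<mapsto> (r + t^2) / 2\<close>, and this map is increasing on nonnegative
  numbers.\<close>

lemma
  assumes "0 \<le> r" "r \<le> 1"
  shows maj_seq_nonneg: "0 \<le> maj_seq r n"
    and maj_seq_le: "maj_seq r n \<le> 1 - sqrt (1 - r)"
proof -
  have "0 \<le> maj_seq r n \<and> maj_seq r n \<le> 1 - sqrt (1 - r)"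
  proof (induction n)
    case (Suc n)
    have "(maj_seq r n)\<^sup>2 \<le> (1 - sqrt (1 - r))\<^sup>2" using Suc by (simp add: power_mono)
    also have "\<dots> = 2 * (1 - sqrt (1 - r)) - r"
      using assms by (simp add: power2_diff)
    finally show ?case using assms by simp
  qed (use assms in auto)
  then show "0 \<le> maj_seq r n" "maj_seq r n \<le> 1 - sqrt (1 - r)" by auto
qed

lemma maj_seq_mono:
  assumes "0 \<le> r" "r \<le> 1"
  shows "maj_seq r n \<le> maj_seq r (Suc n)"
proof (induction n)
  case (Suc n)
  then have "(maj_seq r n)\<^sup>2 \<le> (maj_seq r (Suc n))\<^sup>2"
    using maj_seq_nonneg[OF assms] by (intro power_mono)
  then show ?case by simp
qed (use assms in simp)

lemma sqrt_iter_ops: "S \<in> ops \<Longrightarrow> sqrt_iter S n \<in> ops"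
proof (induction n)
  case (Suc n)
  have *: "sqrt_iter S n \<in> ops" using Suc by blast
  show ?case unfolding sqrt_iter.simps using Suc.prems by (intro ops_scaleR ops_add ops_comp[OF * *])
qed (simp add: ops_zero)

text \<open>The iterates are polynomials in \<open>S\<close>, so whatever intertwines
  \<open>S\<close> with \<open>S'\<close> intertwines their iterates, also between different spaces.
  The commutation relations of the square roots, such as \<open>V D_V = D_{V*} V\<close>, descend
  from this.\<close>

lemma sqrt_iter_intertwine:
  assumes "S \<in> ops" "S' \<in> ops" "W \<in> ops" and "\<And>x. W (S x) = S' (W x)"
  shows "W (sqrt_iter S n x) = sqrt_iter S' n (W x)"
  by (induction n arbitrary: x) (simp_all add: op_simps[OF assms(3)] assms(4))

lemma sqrt_iter_commute:
  "S \<in> ops \<Longrightarrow> sqrt_iter S m (sqrt_iter S n x) = sqrt_iter S n (sqrt_iter S m x)"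
  by (rule sqrt_iter_intertwine[symmetric, of S S])
     (auto simp: sqrt_iter_ops sqrt_iter_intertwine[of S S S])

lemma sqrt_iter_selfadj: "selfadj S \<Longrightarrow> cinner (sqrt_iter S n x) y = cinner x (sqrt_iter S n y)"
  by (induction n arbitrary: x y) (auto simp: cinner_simps selfadj_cinner)

text \<open>The root to be constructed is that of \<open>I - S\<close>. Defect operators have
  \<open>r = 1\<close>; the ball weights have \<open>r < 1\<close>, which makes the root
  invertible.\<close>

locale near_identity =
  fixes S :: "'a::complex_hilbert \<Rightarrow> 'a" and r :: real
  assumes sa: "selfadj S" and r: "0 \<le> r" "r \<le> 1" and le: "\<And>x. norm (S x) \<le> r * norm x"
begin

lemma S_ops: "S \<in> ops" using sa by (rule selfadj_ops)

lemma sqrt_iter_le: "norm (sqrt_iter S n x) \<le> maj_seq r n * norm x"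
proof (induction n arbitrary: x)
  case (Suc n)
  have "norm (sqrt_iter S n (sqrt_iter S n x)) \<le> maj_seq r n * norm (sqrt_iter S n x)" by (rule Suc)
  also have "\<dots> \<le> maj_seq r n * (maj_seq r n * norm x)"
    using Suc maj_seq_nonneg[OF r] by (intro mult_left_mono)
  finally have "norm (sqrt_iter S n (sqrt_iter S n x)) \<le> (maj_seq r n)\<^sup>2 * norm x"
    by (simp add: power2_eq_square mult.assoc)
  then have "norm (S x + sqrt_iter S n (sqrt_iter S n x)) \<le> (r + (maj_seq r n)\<^sup>2) * norm x"
    using norm_triangle_mono[OF le] by (simp add: distrib_right)
  then show ?case by (simp add: scaleR_right_distrib[symmetric] del: scaleR_right_distrib)
qed simp

text \<open>Consecutive iterates commute, so the difference of their squares factors as sum times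
  difference; the increments of the majorant factor in the same way.\<close>

lemma sqrt_iter_step:
  "norm (sqrt_iter S (Suc n) x - sqrt_iter S n x) \<le> (maj_seq r (Suc n) - maj_seq r n) * norm x"
proof (induction n arbitrary: x)
  case 0
  show ?case using le[of x] by simp
next
  case (Suc n)
  let ?A = "sqrt_iter S (Suc n)" and ?B = "sqrt_iter S n"
  let ?a = "maj_seq r (Suc n)" and ?b = "maj_seq r n"
  have ops: "?A \<in> ops" "?B \<in> ops" by (rule sqrt_iter_ops[OF S_ops])+
  let ?d = "?A x - ?B x"
  have "sqrt_iter S (Suc (Suc n)) x = (1/2) *\<^sub>R (S x + ?A (?A x))"
    by (subst sqrt_iter.simps(2)) (rule refl)
  moreover have "?A x = (1/2) *\<^sub>R (S x + ?B (?B x))"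
    by (subst sqrt_iter.simps(2)) (rule refl)
  ultimately have "sqrt_iter S (Suc (Suc n)) x - ?A x = (1/2) *\<^sub>R (?A (?A x) - ?B (?B x))"
    by (metis add_diff_cancel_left scaleR_right_diff_distrib)
  also have "?A (?A x) - ?B (?B x) = ?A ?d + ?B ?d"
    using sqrt_iter_commute[OF S_ops, of "Suc n" n x]
    by (simp add: op_diff[OF ops(1)] op_diff[OF ops(2)] del: sqrt_iter.simps)
  finally have eq: "norm (sqrt_iter S (Suc (Suc n)) x - ?A x) = norm (?A ?d + ?B ?d) / 2"
    by simp
  have "norm (?A ?d + ?B ?d) \<le> ?a * norm ?d + ?b * norm ?d"
    by (rule norm_triangle_mono; rule sqrt_iter_le)
  also have "\<dots> = (?a + ?b) * norm ?d" by (simp only: distrib_right)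
  also have "\<dots> \<le> (?a + ?b) * ((?a - ?b) * norm x)"
    by (rule mult_left_mono[OF Suc]) (use maj_seq_nonneg[OF r] in \<open>simp only: add_nonneg_nonneg\<close>)
  also have "\<dots> = (?a\<^sup>2 - ?b\<^sup>2) * norm x"
    by (simp add: algebra_simps power2_eq_square del: maj_seq.simps)
  also have "?a\<^sup>2 - ?b\<^sup>2 = 2 * (maj_seq r (Suc (Suc n)) - ?a)"
    by (subst maj_seq.simps(2)[of r "Suc n"], subst (3) maj_seq.simps(2)) (simp add: field_simps del: maj_seq.simps)
  finally show ?case unfolding eq by linarith
qed

text \<open>Telescoping bounds the increments by those of the majorant, which converges, being
  increasing and bounded.\<close>

lemma sqrt_iter_Cauchy: "Cauchy (\<lambda>n. sqrt_iter S n x)"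
proof -
  have diff: "norm (sqrt_iter S (m + k) x - sqrt_iter S m x) \<le> (maj_seq r (m + k) - maj_seq r m) * norm x"
    for m k
  proof (induction k)
    case (Suc k)
    have "norm (sqrt_iter S (m + Suc k) x - sqrt_iter S m x)
      \<le> norm (sqrt_iter S (Suc (m + k)) x - sqrt_iter S (m + k) x)
        + norm (sqrt_iter S (m + k) x - sqrt_iter S m x)"
      using norm_triangle_ineq[of "sqrt_iter S (Suc (m + k)) x - sqrt_iter S (m + k) x"
          "sqrt_iter S (m + k) x - sqrt_iter S m x"]
      by (simp del: sqrt_iter.simps)
    then show ?case using Suc sqrt_iter_step[of "m + k" x]
      by (simp add: left_diff_distrib del: sqrt_iter.simps maj_seq.simps)
  qed simp
  have "incseq (maj_seq r)"
    by (rule incseq_SucI) (rule maj_seq_mono[OF r])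
  moreover have "maj_seq r n \<le> 1" for n
    using maj_seq_le[OF r, of n] r real_sqrt_ge_zero[of "1 - r"] by linarith
  ultimately have "convergent (maj_seq r)"
    by (metis convergentI incseq_convergent)
  then have cau: "Cauchy (\<lambda>n. maj_seq r n * norm x)"
    by (intro convergent_Cauchy convergent_mult convergent_const)
  show ?thesis
  proof (rule CauchyI')
    fix e :: real assume "e > 0"
    then obtain M where M: "\<And>m n. m \<ge> M \<Longrightarrow> n \<ge> M \<Longrightarrow> norm (maj_seq r m * norm x - maj_seq r n * norm x) < e"
      using CauchyD[OF cau] by blast
    have "norm (sqrt_iter S m x - sqrt_iter S n x) < e" if "m \<ge> M" "m < n" for m n
    proof -
      have "norm (sqrt_iter S m x - sqrt_iter S n x) \<le> (maj_seq r n - maj_seq r m) * norm x"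
        using diff[of m "n - m"] that by (simp add: norm_minus_commute)
      also have "\<dots> \<le> norm (maj_seq r n * norm x - maj_seq r m * norm x)"
        by (simp add: left_diff_distrib)
      also have "\<dots> < e" using M[of n m] that by simp
      finally show ?thesis .
    qed
    then show "\<exists>M. \<forall>m\<ge>M. \<forall>n>m. dist (sqrt_iter S m x) (sqrt_iter S n x) < e"
      unfolding dist_norm by blast
  qed
qed

definition fixY :: "'a \<Rightarrow> 'a" where "fixY x = lim (\<lambda>n. sqrt_iter S n x)"

lemma sqrt_iter_lim: "(\<lambda>n. sqrt_iter S n x) \<longlonglongrightarrow> fixY x"
  unfolding fixY_def using sqrt_iter_Cauchy Cauchy_convergent convergent_LIMSEQ_iff by blast

lemma fixY_le: "norm (fixY x) \<le> (1 - sqrt (1 - r)) * norm x"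
proof (rule Lim_bounded[OF tendsto_norm[OF sqrt_iter_lim]])
  show "\<forall>n\<ge>0. norm (sqrt_iter S n x) \<le> (1 - sqrt (1 - r)) * norm x"
    using order_trans[OF sqrt_iter_le mult_right_mono[OF maj_seq_le[OF r] norm_ge_zero]] by simp
qed

lemma fixY_ops: "fixY \<in> ops"
proof (rule opsI[OF _ _ fixY_le])
  fix x y c
  show "fixY (x + y) = fixY x + fixY y"
    using sqrt_iter_lim[of "x + y"] tendsto_add[OF sqrt_iter_lim[of x] sqrt_iter_lim[of y]]
    unfolding op_add[OF sqrt_iter_ops[OF S_ops]] by (rule LIMSEQ_unique)
  have "(\<lambda>n. c *\<^sub>C sqrt_iter S n x) \<longlonglongrightarrow> c *\<^sub>C fixY x"
    by (rule op_tendsto[OF ops_scaleC[OF ops_id] sqrt_iter_lim])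
  with sqrt_iter_lim[of "c *\<^sub>C x"] show "fixY (c *\<^sub>C x) = c *\<^sub>C fixY x"
    unfolding op_scaleC[OF sqrt_iter_ops[OF S_ops]] by (rule LIMSEQ_unique)
qed

lemma fixY_selfadj: "cinner (fixY x) y = cinner x (fixY y)"
proof (rule LIMSEQ_unique)
  have c1: "continuous_on UNIV (\<lambda>z. cinner z y)" and c2: "continuous_on UNIV (\<lambda>z. cinner x z)"
    by (intro continuous_intros)+
  show "(\<lambda>n. cinner (sqrt_iter S n x) y) \<longlonglongrightarrow> cinner (fixY x) y"
    using continuous_on_tendsto_compose[OF c1 sqrt_iter_lim] by simp
  show "(\<lambda>n. cinner (sqrt_iter S n x) y) \<longlonglongrightarrow> cinner x (fixY y)"
    unfolding sqrt_iter_selfadj[OF sa]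
    using continuous_on_tendsto_compose[OF c2 sqrt_iter_lim] by simp
qed

lemma fixY_eq: "2 *\<^sub>R fixY x = S x + fixY (fixY x)"
proof (rule LIMSEQ_unique)
  show "(\<lambda>n. 2 *\<^sub>R sqrt_iter S (Suc n) x) \<longlonglongrightarrow> 2 *\<^sub>R fixY x"
    by (intro tendsto_intros LIMSEQ_Suc sqrt_iter_lim)
  \<comment> \<open>In the square both the operator and its argument move with \<open>n\<close>; the
    uniform bound 1 on the iterates disposes of the moving argument.\<close>
  have "(\<lambda>n. sqrt_iter S n (sqrt_iter S n x - fixY x)) \<longlonglongrightarrow> 0"
  proof (rule Lim_null_comparison)
    have m1: "maj_seq r n \<le> 1" for n
      using maj_seq_le[OF r, of n] r real_sqrt_ge_zero[of "1 - r"] by linarith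
    show "\<forall>\<^sub>F n in sequentially. norm (sqrt_iter S n (sqrt_iter S n x - fixY x)) \<le> norm (sqrt_iter S n x - fixY x)"
      using order_trans[OF sqrt_iter_le mult_right_mono[OF m1 norm_ge_zero]] by simp
    show "(\<lambda>n. norm (sqrt_iter S n x - fixY x)) \<longlonglongrightarrow> 0"
      using sqrt_iter_lim[of x] by (simp add: LIM_zero tendsto_norm_zero)
  qed
  then have "(\<lambda>n. sqrt_iter S n (sqrt_iter S n x)) \<longlonglongrightarrow> fixY (fixY x)"
    using tendsto_add[OF _ sqrt_iter_lim[of "fixY x"],
        of "\<lambda>n. sqrt_iter S n (sqrt_iter S n x - fixY x)" 0]
    by (simp add: op_diff[OF sqrt_iter_ops[OF S_ops]])
  then show "(\<lambda>n. 2 *\<^sub>R sqrt_iter S (Suc n) x) \<longlonglongrightarrow> S x + fixY (fixY x)"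
    by (simp add: tendsto_add)
qed

definition sq_root :: "'a \<Rightarrow> 'a" where "sq_root x = x - fixY x"

lemma root_ops: "sq_root \<in> ops"
  unfolding sq_root_def[abs_def] by (intro ops_intros fixY_ops)

lemma root_nonneg: "nonneg_op sq_root"
proof -
  have "selfadj sq_root"
    unfolding selfadj_def using root_ops by (simp add: sq_root_def cinner_simps fixY_selfadj)
  moreover have "0 \<le> Re (cinner (sq_root x) x)" for x
  proof -
    have "Re (cinner (fixY x) x) \<le> norm (fixY x) * norm x"
      using complex_Re_le_cmod cmod_cinner_le order_trans by blast
    also have "\<dots> \<le> norm x * norm x"
      using fixY_le[of x] mult_right_mono[of "1 - sqrt (1 - r)" 1 "norm x"] r
      by (intro mult_right_mono) auto
    finally show ?thesis
      by (simp add: sq_root_def cinner_simps cinner_self power2_eq_square)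
  qed
  ultimately show ?thesis by (simp add: nonneg_op_iff)
qed

lemma root_root: "sq_root (sq_root x) = x - S x"
  using fixY_eq[of x] by (simp add: sq_root_def op_diff[OF fixY_ops] scaleR_2 algebra_simps)

lemma root_commute:
  assumes "W \<in> ops" "\<And>x. W (S x) = S (W x)"
  shows "W (sq_root x) = sq_root (W x)"
proof -
  have "(\<lambda>n. W (sqrt_iter S n x)) \<longlonglongrightarrow> W (fixY x)"
    by (rule op_tendsto[OF assms(1) sqrt_iter_lim])
  then have "W (fixY x) = fixY (W x)"
    using sqrt_iter_lim[of "W x"]
    unfolding sqrt_iter_intertwine[OF S_ops S_ops assms] by (rule LIMSEQ_unique)
  then show ?thesis by (simp add: sq_root_def op_diff[OF assms(1)])
qed

text \<open>Another nonnegative root \<open>B\<close> commutes with \<open>S = I - B^2\<close>,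
  hence with \<open>sq_root\<close>, so \<open>y = B x - sq_root x\<close> satisfies
  \<open>B y + sq_root y = 0\<close>. Two nonnegative forms with sum zero both vanish, so
  \<open>B y\<close> and \<open>sq_root y\<close> are zero, and then so is
  \<open>cinner y y\<close>.\<close>

lemma op_sqrt_eq: "op_sqrt (\<lambda>x. x - S x) = sq_root"
  unfolding op_sqrt_def
proof (rule the_equality)
  show "nonneg_op sq_root \<and> sq_root \<circ> sq_root = (\<lambda>x. x - S x)"
    using root_nonneg root_root by (auto simp: fun_eq_iff)
next
  fix B assume "nonneg_op B \<and> B \<circ> B = (\<lambda>x. x - S x)"
  then have B: "nonneg_op B" and BB: "B (B x) = x - S x" for x by (auto simp: fun_eq_iff)
  have Bop: "B \<in> ops" and Bsa: "selfadj B" using B by (auto simp: nonneg_op_def nonneg_selfadj)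
  have Sx: "S x = x - B (B x)" for x by (simp add: BB)
  have comm: "B (sq_root x) = sq_root (B x)" for x
    by (rule root_commute[OF Bop]) (simp add: Sx op_diff[OF Bop])
  show "B = sq_root"
  proof
    fix x
    define y where "y = B x - sq_root x"
    have "B y + sq_root y = 0"
      by (simp add: y_def op_diff[OF Bop] op_diff[OF root_ops] BB root_root comm)
    then have "cinner (B y) y + cinner (sq_root y) y = 0"
      by (simp add: cinner_add_left[symmetric])
    moreover have "cinner (B y) y \<in> \<real>\<^sub>\<ge>\<^sub>0" "cinner (sq_root y) y \<in> \<real>\<^sub>\<ge>\<^sub>0"
      using B root_nonneg by (auto simp: nonneg_op_def)
    ultimately have "cinner (B y) y = 0" "cinner (sq_root y) y = 0"
      by (auto simp: complex_nonneg_Reals_iff complex_eq_iff)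
    then have "B y = 0" "sq_root y = 0" using B root_nonneg nonneg_op_kernel by blast+
    then have "cinner y y = 0"
      using selfadj_cinner[OF Bsa, of x y] selfadj_cinner[OF nonneg_selfadj[OF root_nonneg], of x y]
      by (subst (1) y_def) (simp add: cinner_diff_left)
    then show "B x = sq_root x" by (simp add: y_def cinner_self)
  qed
qed

text \<open>Solving \<open>sq_root x = h\<close> means finding a fixed point of
  \<open>x \<mapsto> h + fixY x\<close>, a strict contraction with constant
  \<open>1 - sqrt (1 - r)\<close>.\<close>

lemma bij_root:
  assumes "r < 1"
  shows "bij sq_root"
proof -
  let ?q = "1 - sqrt (1 - r)"
  have q: "0 \<le> ?q" "?q < 1" using assms r by auto
  have uniq: "\<exists>!x. h + fixY x = x" for h
  proof (rule banach_fix_type[OF q])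
    show "\<forall>x. \<forall>y. dist (h + fixY x) (h + fixY y) \<le> ?q * dist x y"
      using fixY_le by (simp add: dist_norm op_diff[OF fixY_ops, symmetric])
  qed
  have iff: "sq_root x = h \<longleftrightarrow> h + fixY x = x" for x h by (auto simp: sq_root_def algebra_simps)
  have "\<exists>!x. sq_root x = h" for h using uniq[of h] by (simp add: iff)
  then show ?thesis unfolding bij_def inj_def surj_def by metis
qed

lemma norm_root_ge: "sqrt (1 - r) * norm x \<le> norm (sq_root x)"
  using norm_triangle_ineq2[of x "fixY x"] fixY_le[of x] by (simp add: sq_root_def algebra_simps)

end

lemma op_sqrt_intertwine:
  assumes "near_identity S r" "near_identity S' r'" and W: "W \<in> ops" and WS: "\<And>x. W (S x) = S' (W x)"
  shows "W (op_sqrt (\<lambda>x. x - S x) x) = op_sqrt (\<lambda>x. x - S' x) (W x)"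
proof -
  interpret A: near_identity S r by fact
  interpret B: near_identity S' r' by fact
  have "(\<lambda>n. W (sqrt_iter S n x)) \<longlonglongrightarrow> W (A.fixY x)"
    by (rule op_tendsto[OF W A.sqrt_iter_lim])
  then have "W (A.fixY x) = B.fixY (W x)"
    using B.sqrt_iter_lim[of "W x"]
    unfolding sqrt_iter_intertwine[OF A.S_ops B.S_ops W WS] by (rule LIMSEQ_unique)
  then show ?thesis
    by (simp add: A.op_sqrt_eq B.op_sqrt_eq A.sq_root_def B.sq_root_def op_diff[OF W])
qed

section \<open>Contractions and defect operators\<close>

text \<open>The a priori bound makes the supremum meaningful. It also forces \<open>A 0 = 0\<close>
  when 0 is in \<open>S\<close>, which the quotient convention at 0 would not detect.\<close>

lemma op_norm_le_1_iff:
  assumes "S \<noteq> {}" and bd: "\<And>x. x \<in> S \<Longrightarrow> norm (A x) \<le> B * norm x"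
  shows "op_norm S A \<le> 1 \<longleftrightarrow> (\<forall>x\<in>S. norm (A x) \<le> norm x)"
proof -
  have "norm (A x) / norm x \<le> max B 0" if "x \<in> S" for x
    using order_trans[OF bd[OF that] mult_right_mono[of B "max B 0" "norm x"]]
    by (cases "x = 0") (auto simp: divide_le_eq)
  then have "bdd_above ((\<lambda>x. norm (A x) / norm x) ` S)"
    by (intro bdd_aboveI[of _ "max B 0"]) auto
  then have "op_norm S A \<le> 1 \<longleftrightarrow> (\<forall>x\<in>S. norm (A x) / norm x \<le> 1)"
    unfolding op_norm_def using assms(1) by (rule cSUP_le_iff[rotated])
  also have "\<dots> \<longleftrightarrow> (\<forall>x\<in>S. norm (A x) \<le> norm x)"
  proof (rule ball_cong[OF refl])
    fix x assume "x \<in> S"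
    then show "norm (A x) / norm x \<le> 1 \<longleftrightarrow> norm (A x) \<le> norm x"
      using bd[of x] by (cases "x = 0") (auto simp: divide_le_eq)
  qed
  finally show ?thesis .
qed

lemma contractions_iff:
  assumes "S \<noteq> {}"
  shows "A \<in> contractions S S' \<longleftrightarrow> A \<in> bounded_ops S S' \<and> (\<forall>x\<in>S. norm (A x) \<le> norm x)"
proof -
  have "op_norm S A \<le> 1 \<longleftrightarrow> (\<forall>x\<in>S. norm (A x) \<le> norm x)" if A: "A \<in> bounded_ops S S'"
  proof -
    obtain B where "\<And>x. x \<in> S \<Longrightarrow> norm (A x) \<le> B * norm x"
      using A unfolding bounded_ops_def by blast
    then show ?thesis using assms by (intro op_norm_le_1_iff)
  qed
  then show ?thesis by (auto simp: contractions_def)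
qed

abbreviation contrs :: "('a::complex_hilbert \<Rightarrow> 'b::complex_hilbert) set" where
  "contrs \<equiv> contractions UNIV UNIV"

lemma contrs_iff: "A \<in> contrs \<longleftrightarrow> A \<in> ops \<and> (\<forall>x. norm (A x) \<le> norm x)"
  by (simp add: contractions_iff)

lemma contrsI: "A \<in> ops \<Longrightarrow> (\<And>x. norm (A x) \<le> norm x) \<Longrightarrow> A \<in> contrs"
  by (simp add: contrs_iff)

lemma contrs_ops: "A \<in> contrs \<Longrightarrow> A \<in> ops"
  and contrs_le: "A \<in> contrs \<Longrightarrow> norm (A x) \<le> norm x"
  by (simp_all add: contrs_iff)

lemma contrs_adj: "A \<in> contrs \<Longrightarrow> adj A \<in> contrs"
  using adj_norm_le[of A 1] by (auto simp: contrs_iff ops_adj)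

lemma cinner_comp_adj:
  "A \<in> ops \<Longrightarrow> cinner (adj A (A x)) y = cinner x (adj A (A y))"
  by (simp add: cinner_adj_left cinner_adj_right)

lemma near_identity_scaled:
  assumes V: "V \<in> contrs" and "0 \<le> r" "r \<le> 1"
  shows "near_identity (\<lambda>x. r *\<^sub>R adj V (V x)) r"
proof
  have ops: "V \<in> ops" "adj V \<in> ops" using V by (simp_all add: contrs_ops ops_adj)
  show "selfadj (\<lambda>x. r *\<^sub>R adj V (V x))"
    unfolding selfadj_def
    using ops by (auto intro!: ops_scaleR ops_comp[of "adj V" V] simp: cinner_simps cinner_comp_adj)
  fix x
  have "norm (adj V (V x)) \<le> norm x"
    using contrs_le[OF contrs_adj[OF V]] contrs_le[OF V] order_trans by blast
  then show "norm (r *\<^sub>R adj V (V x)) \<le> r * norm x" using assms by (simp add: mult_left_mono)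
qed (use assms in auto)

lemma near_identity_defect: "V \<in> contrs \<Longrightarrow> near_identity (\<lambda>x. adj V (V x)) 1"
  using near_identity_scaled[of V 1] by simp

context
  fixes V :: "'a::complex_hilbert \<Rightarrow> 'b::complex_hilbert"
  assumes V: "V \<in> contrs"
begin

interpretation near_identity "\<lambda>x. adj V (V x)" 1 by (rule near_identity_defect[OF V])

lemma defect_selfadj: "selfadj (defect V)"
  unfolding defect_def op_sqrt_eq by (rule nonneg_selfadj[OF root_nonneg])

lemma defect_ops: "defect V \<in> ops"
  by (rule selfadj_ops[OF defect_selfadj])

lemma defect_cinner: "cinner (defect V x) y = cinner x (defect V y)"
  by (rule selfadj_cinner[OF defect_selfadj])

lemma defect_defect: "defect V (defect V x) = x - adj V (V x)"
  unfolding defect_def op_sqrt_eq by (rule root_root)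

lemma norm_defect: "(norm (defect V x))\<^sup>2 = (norm x)\<^sup>2 - (norm (V x))\<^sup>2"
proof -
  have "cinner (defect V x) (defect V x) = cinner x x - cinner (V x) (V x)"
    by (simp add: defect_cinner defect_defect cinner_simps cinner_adj_right contrs_ops[OF V])
  then have "complex_of_real ((norm (defect V x))\<^sup>2) = of_real ((norm x)\<^sup>2 - (norm (V x))\<^sup>2)"
    by (simp add: cinner_self)
  then show ?thesis using of_real_eq_iff by blast
qed

lemma norm_defect_le: "norm (defect V x) \<le> norm x"
  by (rule power2_le_imp_le) (simp_all add: norm_defect)

end

lemma csubspace_defect_space: "V \<in> contrs \<Longrightarrow> csubspace (defect_space V)"
  unfolding defect_space_def by (intro csubspace_closure csubspace_range defect_ops)

lemma closed_defect_space: "closed (defect_space V)"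
  by (simp add: defect_space_def)

lemma range_in_closure: "f x \<in> closure (range f)"
  by (rule subsetD[OF closure_subset]) simp

lemma defect_in_space: "defect V x \<in> defect_space V"
  unfolding defect_space_def by (rule range_in_closure)

lemma defect_space_nonempty: "defect_space V \<noteq> {}"
  using defect_in_space by blast

text \<open>\<open>V\<close> intertwines \<open>V* V\<close> with \<open>V V*\<close>, hence also
  the roots of their complements to the identity.\<close>

lemma defect_intertwine:
  assumes V: "V \<in> contrs"
  shows "V (defect V x) = defect (adj V) (V x)"
  unfolding defect_def[of V] defect_def[of "adj V"]
  by (rule op_sqrt_intertwine[OF near_identity_defect[OF V] near_identity_defect[OF contrs_adj[OF V]]])
     (simp_all add: contrs_ops[OF V] adj_adj)

lemma defect_intertwine_adj:
  assumes V: "V \<in> contrs"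
  shows "adj V (defect (adj V) x) = defect V (adj V x)"
  using defect_intertwine[OF contrs_adj[OF V], of x] by (simp add: adj_adj contrs_ops[OF V])

lemma contrs_defect_space:
  assumes V: "V \<in> contrs" and "x \<in> defect_space V"
  shows "V x \<in> defect_space (adj V)"
  using op_maps_closure_range[OF contrs_ops[OF V], of "defect V" "defect (adj V)"] assms(2)
  unfolding defect_space_def defect_intertwine[OF V]
  using defect_in_space[of "adj V", unfolded defect_space_def] by blast

lemma contrs_adj_defect_space:
  assumes V: "V \<in> contrs" and "x \<in> defect_space (adj V)"
  shows "adj V x \<in> defect_space V"
  using contrs_defect_space[OF contrs_adj[OF V] assms(2)] by (simp add: adj_adj contrs_ops[OF V])

text \<open>The block operator with rows \<open>(V, D_{V*})\<close> and
  \<open>(D_V, - adj V)\<close> is isometric; it is the Julia operator of \<open>V\<close>. The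
  cross terms cancel by \<open>defect_intertwine\<close>.\<close>

lemma norm_row_defect:
  assumes V: "V \<in> contrs"
  shows "(norm (V y + defect (adj V) k))\<^sup>2 + (norm (defect V y - adj V k))\<^sup>2 = (norm y)\<^sup>2 + (norm k)\<^sup>2"
proof -
  have "cinner (V y) (defect (adj V) k) = cinner (defect V y) (adj V k)"
    using contrs_adj[OF V] by (simp add: cinner_adj_right[OF contrs_ops[OF V]]
        defect_cinner[symmetric] defect_intertwine[OF V])
  then show ?thesis
    unfolding norm_add_sq norm_diff_sq norm_defect[OF V] norm_defect[OF contrs_adj[OF V]] by simp
qed

lemma closure_range_orthogonal:
  assumes "D \<in> ops" "x \<in> closure (range D)" "\<And>h. cinner (D h) z = 0"
  shows "cinner x z = 0"
proof -
  have "closed {x. cinner x z = 0}"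
    by (rule closed_Collect_eq) (intro continuous_intros)+
  then have "closure (range D) \<subseteq> {x. cinner x z = 0}"
    using assms(3) by (intro closure_minimal) auto
  then show ?thesis using assms(2) by blast
qed

lemma defect_kernel_orthogonal:
  assumes V: "V \<in> contrs" and "x \<in> defect_space V" "defect V z = 0"
  shows "cinner x z = 0"
  using assms(2) unfolding defect_space_def
  by (rule closure_range_orthogonal[OF defect_ops[OF V]]) (simp add: defect_cinner[OF V] assms(3))

text \<open>The kernel of a selfadjoint operator is orthogonal to the closure of its range. This
  gives meaning to the inverses behind \<open>Q0_graph\<close>.\<close>

lemma defect_inj:
  assumes V: "V \<in> contrs" and "x \<in> defect_space V" "y \<in> defect_space V" "defect V x = defect V y"
  shows "x = y"
proof -
  have "cinner (x - y) (x - y) = 0"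
    using assms csubspace_diff[OF csubspace_defect_space[OF V]]
    by (intro defect_kernel_orthogonal[OF V]) (auto simp: op_diff[OF defect_ops[OF V]])
  then show ?thesis by (simp add: cinner_self)
qed

lemma defect_proj:
  assumes V: "V \<in> contrs"
  shows "defect V (proj (defect_space V) x) = defect V x"
proof -
  note S = csubspace_defect_space[OF V] closed_defect_space[of V]
  let ?u = "x - proj (defect_space V) x"
  have "cinner z (defect V ?u) = 0" for z
    using proj_orth[OF S defect_in_space, of x z]
    by (simp add: defect_cinner[OF V, symmetric] cinner_eq_zero_iff_commute)
  then have "cinner (defect V ?u) (defect V ?u) = 0" by blast
  then show ?thesis by (simp add: cinner_self op_diff[OF defect_ops[OF V]])
qed

section \<open>Douglas factorization\<close>

text \<open>The factor is the closure of the graph \<open>{(D h, Z h)}\<close>, composed with the projection onto the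
  closure of the range of \<open>D\<close>.\<close>

lemma douglas:
  fixes Z :: "'a::complex_hilbert \<Rightarrow> 'c::complex_hilbert" and D :: "'a \<Rightarrow> 'b::complex_hilbert"
  assumes Z: "Z \<in> ops" and D: "D \<in> ops" and c: "0 \<le> c" and le: "\<And>h. norm (Z h) \<le> c * norm (D h)"
  obtains W where "W \<in> ops" "\<And>h. W (D h) = Z h" "\<And>x. norm (W x) \<le> c * norm x"
    "\<And>x. W x \<in> closure (range Z)" "\<And>x. (\<And>h. cinner x (D h) = 0) \<Longrightarrow> W x = 0"
proof -
  define G where "G = closure (range (\<lambda>h. (D h, Z h)))"
  have sub: "csubspace G"
    unfolding G_def
  proof (rule csubspace_closure)
    show "csubspace (range (\<lambda>h. (D h, Z h)))"
      unfolding csubspace_def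
      using op_zero[OF D] op_zero[OF Z]
      by (auto simp: scaleC_prod_def op_add[OF Z, symmetric] op_add[OF D, symmetric]
          op_scaleC[OF Z, symmetric] op_scaleC[OF D, symmetric] zero_prod_def
          intro!: image_eqI[of _ _ 0])
  qed
  have Gle: "norm (snd p) \<le> c * norm (fst p)" if "p \<in> G" for p
  proof -
    have "closed {p::'b \<times> 'c. norm (snd p) \<le> c * norm (fst p)}"
      by (intro closed_Collect_le continuous_intros)
    then have "G \<subseteq> {p. norm (snd p) \<le> c * norm (fst p)}"
      unfolding G_def by (rule closure_minimal[rotated]) (use le in auto)
    then show ?thesis using that by blast
  qed
  \<comment> \<open>The estimate survives the closure and makes the closed graph
    single-valued.\<close>
  have Guniq: "y = y'" if "(x, y) \<in> G" "(x, y') \<in> G" for x y y'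
    using Gle[OF csubspace_diff[OF sub that]] by simp
  note R = csubspace_closure[OF csubspace_range[OF D]] closed_closure[of "range D"]
  let ?P = "proj (closure (range D))"
  have Gex: "\<exists>y. (x, y) \<in> G" if x: "x \<in> closure (range D)" for x
  proof -
    obtain a where a: "\<forall>n. a n \<in> range D" "a \<longlonglongrightarrow> x"
      using x unfolding closure_sequential by blast
    have "\<forall>n. \<exists>h. a n = D h" using a(1) by blast
    then obtain h where h: "\<And>n. a n = D (h n)" by metis
    have "Cauchy (\<lambda>n. Z (h n))"
    proof (rule metric_CauchyI)
      fix e :: real assume "e > 0"
      have "Cauchy a" using a(2) by (intro convergent_Cauchy convergentI)
      \<comment> \<open>\<open>c + 1\<close> replaces \<open>c\<close>, which may be zero.\<close>
      then obtain M where M: "\<And>m n. m \<ge> M \<Longrightarrow> n \<ge> M \<Longrightarrow> dist (a m) (a n) < e / (c + 1)"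
        using metric_CauchyD[of a "e / (c + 1)"] \<open>e > 0\<close> c by auto
      have "dist (Z (h m)) (Z (h n)) < e" if "m \<ge> M" "n \<ge> M" for m n
      proof -
        have "dist (Z (h m)) (Z (h n)) \<le> c * dist (a m) (a n)"
          using le[of "h m - h n"] by (simp add: dist_norm h op_diff[OF Z] op_diff[OF D])
        also have "\<dots> \<le> (c + 1) * dist (a m) (a n)" by (simp add: mult_right_mono)
        also have "\<dots> < e" using M[OF that] c by (simp add: field_simps)
        finally show ?thesis .
      qed
      then show "\<exists>M. \<forall>m\<ge>M. \<forall>n\<ge>M. dist (Z (h m)) (Z (h n)) < e" by blast
    qed
    then obtain y where "(\<lambda>n. Z (h n)) \<longlonglongrightarrow> y" using Cauchy_convergent convergent_def by blast
    moreover have "(\<lambda>n. D (h n)) \<longlonglongrightarrow> x" using a(2) h by (simp flip: h)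
    ultimately have "(\<lambda>n. (D (h n), Z (h n))) \<longlonglongrightarrow> (x, y)"
      by (intro tendsto_Pair)
    then have "(x, y) \<in> G"
      unfolding G_def closure_sequential by (intro exI[of _ "\<lambda>n. (D (h n), Z (h n))"]) auto
    then show ?thesis by blast
  qed
  define W where "W x = (THE y. (?P x, y) \<in> G)" for x
  have WG: "(?P x, W x) \<in> G" for x
  proof -
    have "\<exists>!y. (?P x, y) \<in> G" using Gex[OF proj_in[OF R]] Guniq by blast
    then show ?thesis unfolding W_def by (rule theI')
  qed
  have WI: "W x = y" if "(?P x, y) \<in> G" for x y using Guniq[OF WG that] .
  have Wle: "norm (W x) \<le> c * norm x" for x
    using Gle[OF WG, of x] mult_left_mono[OF norm_proj_le[OF R, of x] c] by simp
  show thesis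
  proof (rule that)
    show "W \<in> ops"
    proof (rule opsI[OF _ _ Wle])
      show "W (x + y) = W x + W y" for x y
        using csubspace_add[OF sub WG WG, of x y] by (intro WI) (simp add: proj_add[OF R])
      show "W (c *\<^sub>C x) = c *\<^sub>C W x" for c x
        using csubspace_scaleC[OF sub WG, of c x]
        by (intro WI) (simp add: proj_scaleC[OF R] scaleC_prod_def)
    qed
    have mem: "D h \<in> closure (range D)" for h by (rule range_in_closure)
    show "W (D h) = Z h" for h
    proof (rule WI)
      show "(?P (D h), Z h) \<in> G"
        unfolding proj_same[OF R mem] G_def by (rule range_in_closure)
    qed
    show "norm (W x) \<le> c * norm x" for x by (rule Wle)
    show "W x \<in> closure (range Z)" for x
    proof -
      have "snd ` G \<subseteq> closure (range Z)"
        unfolding G_def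
        by (rule image_closure_subset) (auto intro!: continuous_intros subsetD[OF closure_subset])
      then show ?thesis using WG[of x] by force
    qed
    show "W x = 0" if "\<And>h. cinner x (D h) = 0" for x
    proof -
      have "cinner (x - 0) z = 0" if z: "z \<in> closure (range D)" for z
      proof -
        have "cinner z x = 0"
          by (rule closure_range_orthogonal[OF D z])
             (use \<open>\<And>h. cinner x (D h) = 0\<close> in \<open>simp add: cinner_eq_zero_iff_commute\<close>)
        then show ?thesis by (simp add: cinner_eq_zero_iff_commute)
      qed
      then have "?P x = 0" by (rule proj_eqI[OF R csubspace_0[OF R(1)]])
      then have "W x \<in> {y. (0, y) \<in> G}" using WG[of x] by simp
      then show ?thesis using Gle[of "(0, W x)"] by simp
    qed
  qed
qed

text \<open>The dual form: \<open>douglas\<close> applied to the adjoints gives \<open>W'\<close>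
  with \<open>W' D* = B*\<close>, and the adjoint of \<open>W'\<close> is the solution. As
  \<open>W'\<close> kills the orthogonal complement of the range of \<open>D*\<close>, its adjoint
  takes values in the closure of that range.\<close>

lemma douglas_range:
  fixes B :: "'b::complex_hilbert \<Rightarrow> 'c::complex_hilbert" and D :: "'a::complex_hilbert \<Rightarrow> 'c"
  assumes B: "B \<in> ops" and D: "D \<in> ops" and c: "0 \<le> c"
    and le: "\<And>k. norm (adj B k) \<le> c * norm (adj D k)"
  obtains W where "W \<in> ops" "\<And>h. D (W h) = B h" "\<And>x. norm (W x) \<le> c * norm x"
    "\<And>x. W x \<in> closure (range (adj D))"
proof -
  obtain W' where W': "W' \<in> ops" "\<And>h. W' (adj D h) = adj B h" "\<And>x. norm (W' x) \<le> c * norm x"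
    "\<And>x. (\<And>h. cinner x (adj D h) = 0) \<Longrightarrow> W' x = 0"
    using douglas[OF ops_adj[OF B] ops_adj[OF D] c le] by metis
  have "D (adj W' h) = B h" for h
    by (rule cinner_ext_right)
       (simp add: cinner_adj_left[OF D, symmetric] cinner_adj_right[OF W'(1)] W'(2) cinner_adj_left[OF B])
  moreover have "adj W' x \<in> closure (range (adj D))" for x
  proof -
    note R = csubspace_closure[OF csubspace_range[OF ops_adj[OF D]]] closed_closure[of "range (adj D)"]
    define u where "u = adj W' x - proj (closure (range (adj D))) (adj W' x)"
    have orth: "cinner u z = 0" if "z \<in> closure (range (adj D))" for z
      unfolding u_def using that by (rule proj_orth[OF R])
    then have "W' u = 0" by (intro W'(4) orth range_in_closure)
    then have "cinner u (adj W' x) = 0" by (simp add: cinner_adj_right[OF W'(1)])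
    moreover have "cinner u (proj (closure (range (adj D))) (adj W' x)) = 0"
      by (rule orth[OF proj_in[OF R]])
    ultimately have "cinner u u = 0" by (subst (2) u_def) (simp add: cinner_diff_right)
    then have "adj W' x = proj (closure (range (adj D))) (adj W' x)" by (simp add: cinner_self u_def)
    then show ?thesis using proj_in[OF R] by metis
  qed
  ultimately show thesis
    using that[of "adj W'"] ops_adj[OF W'(1)] adj_norm_le[OF W'(1) c W'(3)] by blast
qed

text \<open>The adjoint of the contractive row \<open>(A, B)\<close> satisfies \<open>\<parallel>B*k\<parallel> \<le> \<parallel>D\<^bsub>A*\<^esub>k\<parallel>\<close>, so that Douglas'
  lemma applies.\<close>

lemma row_contraction:
  fixes A :: "'a::complex_hilbert \<Rightarrow> 'c::complex_hilbert" and B :: "'b::complex_hilbert \<Rightarrow> 'c"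
  assumes A: "A \<in> contrs" and B: "B \<in> ops"
    and le: "\<And>y g. (norm (A y + B g))\<^sup>2 \<le> (norm y)\<^sup>2 + (norm g)\<^sup>2"
  obtains C where "C \<in> contrs" "\<And>g. B g = defect (adj A) (C g)" "\<And>g. C g \<in> defect_space (adj A)"
proof -
  note Aop = contrs_ops[OF A] and A' = contrs_adj[OF A]
  have "norm (adj B k) \<le> 1 * norm (adj (defect (adj A)) k)" for k
  proof -
    \<comment> \<open>\<open>N\<close> is the squared norm of the adjoint row at \<open>k\<close>.
      Feeding that vector back into the row gives \<open>N \<le> sqrt N * norm k\<close>, hence
      \<open>N \<le> (norm k)^2\<close>.\<close>
    define N where "N = (norm (adj A k))\<^sup>2 + (norm (adj B k))\<^sup>2"
    have "N = Re (cinner (A (adj A k) + B (adj B k)) k)"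
      using cinner_adj_right[OF Aop, of "adj A k" k] cinner_adj_right[OF B, of "adj B k" k]
      by (simp add: N_def cinner_add_left cinner_self)
         (metis Re_complex_of_real of_real_power)
    also have "\<dots> \<le> norm (A (adj A k) + B (adj B k)) * norm k"
      using complex_Re_le_cmod cmod_cinner_le order_trans by blast
    also have "\<dots> \<le> sqrt N * norm k"
      using le[of "adj A k" "adj B k"] by (intro mult_right_mono real_le_rsqrt) (auto simp: N_def)
    finally have "sqrt N * sqrt N \<le> sqrt N * norm k" by (simp add: N_def)
    moreover have "0 \<le> N" by (simp add: N_def)
    ultimately have "sqrt N \<le> norm k"
      using mult_left_le_imp_le[of "sqrt N" "sqrt N" "norm k"] by (cases "N = 0") auto
    then have "N \<le> (norm k)\<^sup>2" using \<open>0 \<le> N\<close> by (simp add: sqrt_le_D)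
    then have "(norm (adj B k))\<^sup>2 \<le> (norm (defect (adj A) k))\<^sup>2"
      by (simp add: N_def norm_defect[OF A'])
    then have "norm (adj B k) \<le> norm (defect (adj A) k)"
      by (rule power2_le_imp_le) simp
    then show ?thesis
      by (simp add: selfadj_adj[OF defect_selfadj[OF A']])
  qed
  then obtain C where C: "C \<in> ops" "\<And>h. defect (adj A) (C h) = B h" "\<And>x. norm (C x) \<le> 1 * norm x"
    "\<And>x. C x \<in> closure (range (adj (defect (adj A))))"
    by (rule douglas_range[OF B defect_ops[OF A'] zero_le_one]) blast
  show thesis
  proof (rule that)
    show "C \<in> contrs" using C(1,3) by (simp add: contrs_iff)
    show "B g = defect (adj A) (C g)" for g by (simp add: C(2))
    show "C g \<in> defect_space (adj A)" for g
      using C(4) by (simp add: selfadj_adj[OF defect_selfadj[OF A']] defect_space_def)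
  qed
qed

text \<open>Being set to 0 off \<open>S\<close>, an element of \<open>bounded_ops S S'\<close> is in
  general not linear on the whole space. Composing with the projection makes the facts about
  everywhere defined operators applicable.\<close>

lemma bounded_ops_proj:
  assumes S: "csubspace S" "closed S" and K: "K \<in> bounded_ops S S'"
  shows "(\<lambda>x. K (proj S x)) \<in> ops"
proof -
  obtain B where B: "\<And>x. x \<in> S \<Longrightarrow> norm (K x) \<le> B * norm x"
    using K unfolding bounded_ops_def by blast
  have "norm (K (proj S x)) \<le> max B 0 * norm x" for x
  proof -
    have "norm (K (proj S x)) \<le> B * norm (proj S x)" by (rule B[OF proj_in[OF S]])
    also have "\<dots> \<le> max B 0 * norm (proj S x)" by (simp add: mult_right_mono)
    also have "\<dots> \<le> max B 0 * norm x" using norm_proj_le[OF S] by (intro mult_left_mono) auto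
    finally show ?thesis .
  qed
  then show ?thesis
    using K proj_in[OF S] by (intro opsI) (auto simp: proj_add[OF S] proj_scaleC[OF S] bounded_ops_def)
qed

lemma ops_restrict:
  assumes S: "csubspace S" and W: "W \<in> ops" and "\<And>x. x \<in> S \<Longrightarrow> W x \<in> S'"
  shows "(\<lambda>x. if x \<in> S then W x else 0) \<in> bounded_ops S S'"
proof -
  obtain B where "\<And>x. norm (W x) \<le> B * norm x" using op_bound[OF W] by blast
  then show ?thesis
    unfolding bounded_ops_def using assms
    by (auto simp: csubspace_add csubspace_scaleC op_simps[OF W] intro!: exI[of _ B])
qed

lemma bounded_ops_eqI:
  assumes K: "K \<in> bounded_ops S S'" "K' \<in> bounded_ops S S'" and "\<And>x. x \<in> S \<Longrightarrow> K x = K' x"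
  shows "K = K'"
  using assms by (auto simp: bounded_ops_def fun_eq_iff) metis

section \<open>The operator ball\<close>

lemma ops_inv:
  assumes A: "A \<in> ops" "bij A" and "0 < c" and ge: "\<And>x. c * norm x \<le> norm (A x)"
  shows "inv A \<in> ops"
proof (rule opsI[of _ "1 / c"])
  have Ainv: "A (inv A x) = x" for x using A(2) by (simp add: bij_is_surj surj_f_inv_f)
  have eqI: "inv A x = y" if "A y = x" for x y using that A(2) by (metis bij_inv_eq_iff)
  show "inv A (x + y) = inv A x + inv A y" for x y
    by (rule eqI) (simp add: op_add[OF A(1)] Ainv)
  show "inv A (a *\<^sub>C x) = a *\<^sub>C inv A x" for a x
    by (rule eqI) (simp add: op_scaleC[OF A(1)] Ainv)
  show "norm (inv A x) \<le> 1 / c * norm x" for x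
    using ge[of "inv A x"] \<open>0 < c\<close> by (simp add: Ainv field_simps)
qed

text \<open>\<open>s\<close> and \<open>c\<close> are the sine and cosine of an angle strictly
  between 0 and \<open>\<pi>/2\<close>: \<open>c > 0\<close> makes the weights invertible, and
  \<open>s > 0\<close> allows solving for \<open>M\<close>.\<close>

locale weighted =
  fixes V :: "'a::complex_hilbert \<Rightarrow> 'b::complex_hilbert" and s c :: real
  assumes V: "V \<in> contrs" and s: "0 < s" and c: "0 < c" and sc: "s\<^sup>2 + c\<^sup>2 = 1"
begin

lemma weighted_adj: "weighted (adj V) s c"
  by standard (use contrs_adj[OF V] s c sc in auto)

lemma Vop: "V \<in> ops" and V'op: "adj V \<in> ops"
  using V contrs_ops ops_adj by blast+

lemma s2_le: "s\<^sup>2 \<le> 1" and s2_lt: "s\<^sup>2 < 1"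
  using sc c zero_less_power[OF c, of 2] by linarith+

lemma near: "near_identity (\<lambda>x. s\<^sup>2 *\<^sub>R adj V (V x)) (s\<^sup>2)"
  by (rule near_identity_scaled[OF V _ s2_le]) simp

text \<open>The root of \<open>ball_weight\<close>: since \<open>s^2 + c^2 = 1\<close>, the weight
  \<open>s^2 D_V^2 + c^2\<close> equals \<open>I - s^2 V* V\<close>.\<close>

definition R :: "'a \<Rightarrow> 'a" where "R = op_sqrt (\<lambda>x. x - s\<^sup>2 *\<^sub>R adj V (V x))"

sublocale near_identity "\<lambda>x. s\<^sup>2 *\<^sub>R adj V (V x)" "s\<^sup>2" by (rule near)

lemma R_root: "R = sq_root" unfolding R_def by (rule op_sqrt_eq)

lemma R_ops: "R \<in> ops" unfolding R_root by (rule root_ops)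

lemma R_cinner: "cinner (R x) y = cinner x (R y)"
  unfolding R_root by (rule selfadj_cinner[OF nonneg_selfadj[OF root_nonneg]])

lemma R_R: "R (R x) = x - s\<^sup>2 *\<^sub>R adj V (V x)"
  unfolding R_root by (rule root_root)

lemma bij_R: "bij R"
  unfolding R_root by (rule bij_root[OF s2_lt])

lemma R_inv: "R (inv R x) = x" and inv_R: "inv R (R x) = x"
  using bij_R by (simp_all add: bij_is_surj surj_f_inv_f bij_is_inj)

lemma R_inject: "R x = R y \<longleftrightarrow> x = y"
  using bij_R by (auto dest: bij_is_inj simp: inj_eq)

lemma inv_R_ops: "inv R \<in> ops"
proof (rule ops_inv[OF R_ops bij_R c])
  have "sqrt (1 - s\<^sup>2) = c" using sc c real_sqrt_unique[of c "1 - s\<^sup>2"] by simp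
  then show "c * norm x \<le> norm (R x)" for x
    unfolding R_root using norm_root_ge by metis
qed

lemma R_defect: "R (defect V x) = defect V (R x)"
proof -
  have S: "s\<^sup>2 *\<^sub>R adj V (V x) = s\<^sup>2 *\<^sub>R (x - defect V (defect V x))" for x
    by (simp add: defect_defect[OF V])
  show ?thesis unfolding R_root
    by (rule root_commute[symmetric, OF defect_ops[OF V]])
       (simp add: S op_diff[OF defect_ops[OF V]] op_scaleR[OF defect_ops[OF V]])
qed

lemma norm_R: "(norm (R x))\<^sup>2 = (norm x)\<^sup>2 - s\<^sup>2 * (norm (V x))\<^sup>2"
proof -
  have "cinner (R x) (R x) = cinner x x - of_real (s\<^sup>2) * cinner (V x) (V x)"
    by (simp add: R_cinner R_R cinner_simps cinner_adj_right[OF Vop])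
  then have "complex_of_real ((norm (R x))\<^sup>2) = of_real ((norm x)\<^sup>2 - s\<^sup>2 * (norm (V x))\<^sup>2)"
    by (simp add: cinner_self)
  then show ?thesis using of_real_eq_iff by blast
qed

lemma R_weight: "sin \<phi> = s \<Longrightarrow> cos \<phi> = c \<Longrightarrow> ball_weight \<phi> V = (\<lambda>x. x - s\<^sup>2 *\<^sub>R adj V (V x))"
proof
  fix x :: 'a
  assume "sin \<phi> = s" "cos \<phi> = c"
  moreover have "s\<^sup>2 *\<^sub>R x + c\<^sup>2 *\<^sub>R x = x" unfolding scaleR_left_distrib[symmetric] sc by simp
  ultimately show "ball_weight \<phi> V x = x - s\<^sup>2 *\<^sub>R adj V (V x)"
    by (simp add: ball_weight_def defect_defect[OF V] scaleR_right_diff_distrib algebra_simps)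
qed

lemma inv_weight: "inv (\<lambda>x. x - s\<^sup>2 *\<^sub>R adj V (V x)) x = inv R (inv R x)"
proof -
  have "(\<lambda>x. x - s\<^sup>2 *\<^sub>R adj V (V x)) = R \<circ> R" by (simp add: fun_eq_iff R_R)
  then show ?thesis using bij_R by (simp add: o_inv_distrib)
qed

interpretation A: weighted "adj V" s c by (rule weighted_adj)

lemma V'_AR: "adj V (A.R x) = R (adj V x)"
  unfolding R_def A.R_def
  by (rule op_sqrt_intertwine[OF A.near near V'op]) (simp add: adj_adj[OF Vop] op_scaleR[OF V'op])

text \<open>To be read with \<open>h = A.R k\<close> and \<open>x = X h\<close>: written in terms of \<open>k\<close>, completing the square
  in \<open>X h\<close> involves no inverses.\<close>

lemma complete_square:
  "s\<^sup>2 * (norm (V x + defect (adj V) (A.R k)))\<^sup>2 - (norm x)\<^sup>2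
    = s\<^sup>2 * (norm (defect (adj V) k))\<^sup>2 - (norm (R x - s\<^sup>2 *\<^sub>R defect V (adj V k)))\<^sup>2"
proof -
  let ?w = "defect V (adj V k)" and ?d = "defect (adj V) k"
  have Vd: "adj V ?d = ?w" by (rule defect_intertwine_adj[OF V])
  have "defect (adj V) (A.R k) = A.R ?d" by (simp add: A.R_defect)
  then have "(norm (defect (adj V) (A.R k)))\<^sup>2 = (norm ?d)\<^sup>2 - s\<^sup>2 * (norm ?w)\<^sup>2"
    by (simp add: A.norm_R Vd)
  moreover have "cinner (V x) (defect (adj V) (A.R k)) = cinner (R x) ?w"
    by (simp add: cinner_adj_right[OF Vop, symmetric] defect_intertwine_adj[OF V] V'_AR R_cinner R_defect)
  moreover have "(norm (s\<^sup>2 *\<^sub>R ?w))\<^sup>2 = s\<^sup>2 * (s\<^sup>2 * (norm ?w)\<^sup>2)"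
    by (simp add: power_mult_distrib power2_eq_square)
  ultimately show ?thesis
    unfolding norm_add_sq norm_diff_sq norm_R
    by (simp only: cinner_scaleR_right) (simp add: algebra_simps del: norm_scaleR)
qed

text \<open>Here \<open>- s m\<close> is the deviation of \<open>R x\<close> from the centre found
  in \<open>complete_square\<close>. Applying \<open>R\<close> to \<open>V* h - D_V x\<close> at
  \<open>h = A.R k\<close>, the terms with \<open>V* V V* k\<close> cancel, and \<open>V* k\<close>
  keeps the coefficient \<open>1 - s^2 = c^2\<close>; this is the origin of the centre of the
  ball.\<close>

lemma R_factor:
  assumes "R x = s\<^sup>2 *\<^sub>R defect V (adj V k) - s *\<^sub>R m"
  shows "R (adj V (A.R k) - defect V x) = s *\<^sub>R defect V m + c\<^sup>2 *\<^sub>R adj V k"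
proof -
  have 1: "R (adj V (A.R k)) = adj V k - s\<^sup>2 *\<^sub>R adj V (V (adj V k))"
    by (simp add: V'_AR R_R)
  have "R (defect V x) = s\<^sup>2 *\<^sub>R (adj V k - adj V (V (adj V k))) - s *\<^sub>R defect V m"
    unfolding R_defect assms using defect_ops[OF V]
    by (simp add: op_simps defect_defect[OF V])
  moreover have "c\<^sup>2 *\<^sub>R adj V k = adj V k - s\<^sup>2 *\<^sub>R adj V k"
    unfolding arg_cong[OF sc, of "\<lambda>t. t - s\<^sup>2", simplified]
    by (simp add: scaleR_left_diff_distrib)
  ultimately show ?thesis using 1
    by (simp add: op_diff[OF R_ops] scaleR_right_diff_distrib)
qed

end

text \<open>A description of the ball without inverses; for \<open>s = 0\<close> and
  \<open>c \<noteq> 0\<close> it forces \<open>X = 0\<close> and \<open>U = V*\<close>. The last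
  clause is \<open>c * norm (X h) \<le> s * norm (D_U h)\<close> squared. The range condition makes
  \<open>X\<close> unique and ensures that \<open>V\<close> maps its values into the closure of the
  range of \<open>D_{V*}\<close>.\<close>

definition ball_factor :: "real \<Rightarrow> real \<Rightarrow> ('a::complex_hilbert \<Rightarrow> 'b::complex_hilbert) \<Rightarrow> ('b \<Rightarrow> 'a) \<Rightarrow> ('b \<Rightarrow> 'a) \<Rightarrow> bool" where
  "ball_factor s c V U X \<longleftrightarrow> X \<in> ops \<and> (\<forall>h. X h \<in> defect_space V) \<and>
     (\<forall>h. U h = adj V h - defect V (X h)) \<and> U \<in> contrs \<and>
     (\<forall>h. c\<^sup>2 * (norm (X h))\<^sup>2 \<le> s\<^sup>2 * ((norm h)\<^sup>2 - (norm (U h))\<^sup>2))"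

text \<open>This is \<open>norm_row_defect\<close>, whose second component is \<open>U h\<close> up
  to sign.\<close>

lemma factor_norm:
  assumes V: "V \<in> contrs" and U: "U h = adj V h - defect V x"
  shows "(norm (V x + defect (adj V) h))\<^sup>2 = (norm x)\<^sup>2 + ((norm h)\<^sup>2 - (norm (U h))\<^sup>2)"
  using norm_row_defect[OF V, of x h] by (simp add: U norm_minus_commute)

context weighted
begin

interpretation A: weighted "adj V" s c by (rule weighted_adj)

text \<open>Given \<open>M\<close>, the factor \<open>X h\<close> solves
  \<open>R x = s^2 D_V V* k - s M D_{V*} k\<close> at \<open>h = A.R k\<close>. Contractivity of
  \<open>M\<close> and \<open>complete_square\<close> give the norm inequality.\<close>

lemma ball_formula_factor:
  assumes M: "M \<in> contractions (defect_space (adj V)) (defect_space V)"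
    and U: "\<And>h. U h = s *\<^sub>R inv R (defect V (M (defect (adj V) (inv A.R h)))) + c\<^sup>2 *\<^sub>R inv R (inv R (adj V h))"
  shows "\<exists>X. ball_factor s c V U X"
proof -
  note V' = contrs_adj[OF V]
  note S = csubspace_defect_space[OF V'] closed_defect_space[of "adj V"]
  note S2 = csubspace_defect_space[OF V]
  have Mb: "M \<in> bounded_ops (defect_space (adj V)) (defect_space V)"
    and Mle: "norm (M x) \<le> norm x" if "x \<in> defect_space (adj V)" for x
    using M that by (auto simp: contractions_iff[OF defect_space_nonempty])
  \<comment> \<open>The projection changes no value here; it exhibits \<open>N\<close> as a
    composition of everywhere defined bounded operators.\<close>
  define N where "N k = M (proj (defect_space (adj V)) (defect (adj V) k))" for k
  have N_ops: "N \<in> ops"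
    unfolding N_def[abs_def]
    by (rule ops_comp[OF bounded_ops_proj[OF S, of M] defect_ops[OF V'], of "defect_space V"])
       (use M in \<open>simp add: contractions_def\<close>)
  have N: "N k = M (defect (adj V) k)" for k
    by (simp add: N_def proj_same[OF S defect_in_space])
  have NS: "N k \<in> defect_space V" for k
    using M defect_in_space[of "adj V" k] by (simp add: N contractions_def bounded_ops_def)
  define X where "X h = inv R (s\<^sup>2 *\<^sub>R defect V (adj V (inv A.R h)) - s *\<^sub>R N (inv A.R h))" for h
  have RX: "R (X h) = s\<^sup>2 *\<^sub>R defect V (adj V (inv A.R h)) - s *\<^sub>R N (inv A.R h)" for h
    by (simp add: X_def R_inv)
  have X_ops: "X \<in> ops"
    unfolding X_def[abs_def]
    by (intro ops_comp[OF inv_R_ops] ops_diff ops_scaleR ops_comp[OF N_ops A.inv_R_ops]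
        ops_comp[OF defect_ops[OF V]] ops_comp[OF V'op A.inv_R_ops])
  have invR_defect: "inv R (defect V x) = defect V (inv R x)" for x
    using R_inject[of "inv R (defect V x)" "defect V (inv R x)"] by (simp add: R_inv R_defect)
  have XS: "X h \<in> defect_space V" for h
    unfolding X_def
  proof (rule op_maps_closure_range[OF inv_R_ops, of "defect V" "defect V", folded defect_space_def])
    show "inv R (defect V x) \<in> defect_space V" for x
      unfolding invR_defect by (rule defect_in_space)
    show "s\<^sup>2 *\<^sub>R defect V (adj V (inv A.R h)) - s *\<^sub>R N (inv A.R h) \<in> defect_space V"
      by (intro csubspace_diff[OF S2] csubspace_scaleR[OF S2] NS defect_in_space)
  qed
  have UX: "U h = adj V h - defect V (X h)" for h
  proof -
    define k where "k = inv A.R h"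
    have h: "h = A.R k" by (simp add: k_def A.R_inv)
    have "R (adj V h - defect V (X h)) = s *\<^sub>R defect V (N k) + c\<^sup>2 *\<^sub>R adj V k"
      unfolding h by (rule R_factor) (simp add: RX A.inv_R)
    moreover have "R (U h) = s *\<^sub>R defect V (N k) + c\<^sup>2 *\<^sub>R adj V k"
      unfolding U by (simp add: op_add[OF R_ops] op_scaleR[OF R_ops] R_inv N k_def[symmetric])
        (simp add: h V'_AR inv_R)
    ultimately show ?thesis using R_inject by metis
  qed
  have bound: "c\<^sup>2 * (norm (X h))\<^sup>2 \<le> s\<^sup>2 * ((norm h)\<^sup>2 - (norm (U h))\<^sup>2)" for h
  proof -
    define k where "k = inv A.R h"
    have h: "h = A.R k" by (simp add: k_def A.R_inv)
    have "R (X h) - s\<^sup>2 *\<^sub>R defect V (adj V k) = - (s *\<^sub>R N k)" by (simp add: RX k_def)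
    then have "(norm (R (X h) - s\<^sup>2 *\<^sub>R defect V (adj V k)))\<^sup>2 = s\<^sup>2 * (norm (N k))\<^sup>2"
      by (simp add: power_mult_distrib)
    moreover have "(norm (N k))\<^sup>2 \<le> (norm (defect (adj V) k))\<^sup>2"
      unfolding N by (intro power_mono Mle defect_in_space norm_ge_zero)
    then have "s\<^sup>2 * (norm (N k))\<^sup>2 \<le> s\<^sup>2 * (norm (defect (adj V) k))\<^sup>2" by (simp add: mult_left_mono)
    ultimately have "(norm (X h))\<^sup>2 \<le> s\<^sup>2 * (norm (V (X h) + defect (adj V) h))\<^sup>2"
      using complete_square[of "X h" k] unfolding h by linarith
    also have "\<dots> = s\<^sup>2 * (norm (X h))\<^sup>2 + s\<^sup>2 * ((norm h)\<^sup>2 - (norm (U h))\<^sup>2)"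
      by (simp add: factor_norm[where U=U, OF V UX] distrib_left)
    finally show ?thesis
      using arg_cong[OF sc, of "\<lambda>t. t * (norm (X h))\<^sup>2"] by (simp add: distrib_right)
  qed
  have "U \<in> contrs"
  proof (rule contrsI)
    show "U \<in> ops"
      unfolding UX[abs_def] by (intro ops_diff V'op ops_comp[OF defect_ops[OF V] X_ops])
    show "norm (U h) \<le> norm h" for h
    proof -
      have "0 \<le> s\<^sup>2 * ((norm h)\<^sup>2 - (norm (U h))\<^sup>2)"
        using bound[of h] order_trans[of 0 "c\<^sup>2 * (norm (X h))\<^sup>2"] by simp
      then have "(norm (U h))\<^sup>2 \<le> (norm h)\<^sup>2" using s by (simp add: zero_le_mult_iff)
      then show ?thesis by (rule power2_le_imp_le) simp
    qed
  qed
  then show ?thesis unfolding ball_factor_def using X_ops XS UX bound by blast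
qed

text \<open>The same equation is solved for \<open>N = M D_{V*}\<close>. Completing the square turns
  the bound on \<open>X\<close> into \<open>norm (N k) \<le> norm (D_{V*} k)\<close>, from which
  Douglas' lemma produces \<open>M\<close>.\<close>

lemma factor_ball_formula:
  assumes X: "ball_factor s c V U X"
  shows "\<exists>M \<in> contractions (defect_space (adj V)) (defect_space V). \<forall>h.
    U h = s *\<^sub>R inv R (defect V (M (defect (adj V) (inv A.R h)))) + c\<^sup>2 *\<^sub>R inv R (inv R (adj V h))"
proof -
  note V' = contrs_adj[OF V]
  note S = csubspace_defect_space[OF V'] closed_defect_space[of "adj V"]
  note S2 = csubspace_defect_space[OF V]
  have X_ops: "X \<in> ops" and XS: "X h \<in> defect_space V" and UX: "U h = adj V h - defect V (X h)"
    and bound: "c\<^sup>2 * (norm (X h))\<^sup>2 \<le> s\<^sup>2 * ((norm h)\<^sup>2 - (norm (U h))\<^sup>2)" for h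
    using X by (auto simp: ball_factor_def)
  define N where "N k = s *\<^sub>R defect V (adj V k) - (1 / s) *\<^sub>R R (X (A.R k))" for k
  have RX: "R (X (A.R k)) = s\<^sup>2 *\<^sub>R defect V (adj V k) - s *\<^sub>R N k" for k
    using s by (simp add: N_def scaleR_right_diff_distrib power2_eq_square)
  have N_ops: "N \<in> ops"
    unfolding N_def[abs_def]
    by (intro ops_diff ops_scaleR ops_comp[OF defect_ops[OF V] V'op]
        ops_comp[OF R_ops] ops_comp[OF X_ops A.R_ops])
  have RS: "R x \<in> defect_space V" if "x \<in> defect_space V" for x
    by (rule op_maps_closure_range[OF R_ops, of "defect V" "defect V", folded defect_space_def])
       (simp_all add: that R_defect defect_in_space)
  have NS: "N k \<in> defect_space V" for k
    unfolding N_def by (intro csubspace_diff[OF S2] csubspace_scaleR[OF S2] RS XS defect_in_space)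
  have Nle: "norm (N k) \<le> 1 * norm (defect (adj V) k)" for k
  proof -
    define h where "h = A.R k"
    have "(norm (X h))\<^sup>2 \<le> s\<^sup>2 * (norm (X h))\<^sup>2 + s\<^sup>2 * ((norm h)\<^sup>2 - (norm (U h))\<^sup>2)"
      using bound[of h] arg_cong[OF sc, of "\<lambda>t. t * (norm (X h))\<^sup>2"] by (simp add: distrib_right)
    also have "\<dots> = s\<^sup>2 * (norm (V (X h) + defect (adj V) h))\<^sup>2"
      by (simp add: factor_norm[where U=U, OF V UX] distrib_left)
    finally have "(norm (R (X h) - s\<^sup>2 *\<^sub>R defect V (adj V k)))\<^sup>2 \<le> s\<^sup>2 * (norm (defect (adj V) k))\<^sup>2"
      using complete_square[of "X h" k] unfolding h_def by linarith
    moreover have "R (X h) - s\<^sup>2 *\<^sub>R defect V (adj V k) = - (s *\<^sub>R N k)" by (simp add: RX h_def)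
    ultimately have "s\<^sup>2 * (norm (N k))\<^sup>2 \<le> s\<^sup>2 * (norm (defect (adj V) k))\<^sup>2"
      by (simp add: power_mult_distrib)
    then have "(norm (N k))\<^sup>2 \<le> (norm (defect (adj V) k))\<^sup>2" using s by simp
    then show ?thesis using power2_le_imp_le[of "norm (N k)" "norm (defect (adj V) k)"] by simp
  qed
  obtain W where W: "W \<in> ops" "\<And>h. W (defect (adj V) h) = N h" "\<And>x. norm (W x) \<le> 1 * norm x"
    "\<And>x. W x \<in> closure (range N)"
    by (rule douglas[OF N_ops defect_ops[OF V'] zero_le_one Nle]) blast
  have "closure (range N) \<subseteq> defect_space V"
    using NS by (intro closure_minimal closed_defect_space) auto
  then have WS: "W x \<in> defect_space V" for x using W(4) by blast
  define M where "M x = (if x \<in> defect_space (adj V) then W x else 0)" for x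
  have M: "M \<in> contractions (defect_space (adj V)) (defect_space V)"
    unfolding contractions_iff[OF defect_space_nonempty] M_def[abs_def]
    using ops_restrict[OF S(1) W(1), of "defect_space V"] WS W(3) by simp
  have "U h = s *\<^sub>R inv R (defect V (M (defect (adj V) (inv A.R h)))) + c\<^sup>2 *\<^sub>R inv R (inv R (adj V h))" for h
  proof -
    define k where "k = inv A.R h"
    have h: "h = A.R k" by (simp add: k_def A.R_inv)
    have Mk: "M (defect (adj V) k) = N k" by (simp add: M_def defect_in_space W(2))
    have "R (U h) = s *\<^sub>R defect V (N k) + c\<^sup>2 *\<^sub>R adj V k"
      unfolding UX h by (rule R_factor) (rule RX)
    moreover have "R (s *\<^sub>R inv R (defect V (M (defect (adj V) k))) + c\<^sup>2 *\<^sub>R inv R (inv R (adj V h)))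
        = s *\<^sub>R defect V (N k) + c\<^sup>2 *\<^sub>R adj V k"
      by (simp add: op_add[OF R_ops] op_scaleR[OF R_ops] R_inv Mk) (simp add: h V'_AR inv_R)
    ultimately show ?thesis unfolding k_def[symmetric] using R_inject by metis
  qed
  with M show ?thesis by blast
qed

lemma operator_ball_iff:
  assumes "sin \<phi> = s" "cos \<phi> = c"
  shows "U \<in> operator_ball \<phi> V \<longleftrightarrow> (\<exists>X. ball_factor s c V U X)"
proof -
  have "\<phi> \<noteq> pi / 2" "\<phi> \<noteq> 0" using assms s c cos_pi_half sin_zero by (metis less_irrefl)+
  then have "U \<in> operator_ball \<phi> V \<longleftrightarrow> (\<exists>M \<in> contractions (defect_space (adj V)) (defect_space V). \<forall>h.
    U h = s *\<^sub>R inv R (defect V (M (defect (adj V) (inv A.R h)))) + c\<^sup>2 *\<^sub>R inv R (inv R (adj V h)))"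
    unfolding operator_ball_def R_weight[OF assms] A.R_weight[OF assms] R_def[symmetric]
      A.R_def[symmetric] inv_weight assms by (auto simp: fun_eq_iff)
  then show ?thesis using ball_formula_factor factor_ball_formula by blast
qed

end

lemma ball_factor_0_iff:
  assumes V: "V \<in> contrs" and "c \<noteq> 0"
  shows "(\<exists>X. ball_factor 0 c V U X) \<longleftrightarrow> U = adj V"
proof
  assume "\<exists>X. ball_factor 0 c V U X"
  then show "U = adj V"
    using \<open>c \<noteq> 0\<close> by (auto simp: ball_factor_def fun_eq_iff mult_le_0_iff op_zero[OF defect_ops[OF V]])
next
  assume "U = adj V"
  then have "ball_factor 0 c V U (\<lambda>h. 0)"
    using csubspace_0[OF csubspace_defect_space[OF V]]
    by (simp add: ball_factor_def ops_zero contrs_adj[OF V] op_zero[OF defect_ops[OF V]])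
  then show "\<exists>X. ball_factor 0 c V U X" by blast
qed

lemma operator_ball_factor:
  assumes V: "V \<in> contrs" and "0 \<le> \<phi>" "\<phi> < pi / 2"
  shows "U \<in> operator_ball \<phi> V \<longleftrightarrow> (\<exists>X. ball_factor (sin \<phi>) (cos \<phi>) V U X)"
proof (cases "\<phi> = 0")
  case True
  then show ?thesis using ball_factor_0_iff[OF V, of 1 U] by (simp add: operator_ball_def)
next
  case False
  then interpret weighted V "sin \<phi>" "cos \<phi>"
    by unfold_locales (use assms in \<open>auto intro!: sin_gt_zero cos_gt_zero\<close>)
  show ?thesis by (rule operator_ball_iff) simp_all
qed

section \<open>The operator Q and the operator hole\<close>

text \<open>The density argument behind the passages from vectors \<open>D_U h\<close> to general
  elements of a defect space.\<close>

lemma closed_le_defect_space: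
  fixes f g :: "'a::complex_hilbert \<Rightarrow> real"
  assumes "continuous_on UNIV f" "continuous_on UNIV g"
    and "\<And>h. f (defect U h) \<le> g (defect U h)" and "x \<in> defect_space U"
  shows "f x \<le> g x"
proof -
  have "closed {x. f x \<le> g x}" by (intro closed_Collect_le assms)
  then have "defect_space U \<subseteq> {x. f x \<le> g x}"
    unfolding defect_space_def by (rule closure_minimal[rotated]) (use assms(3) in auto)
  then show ?thesis using assms(4) by blast
qed

lemma op_continuous: "A \<in> ops \<Longrightarrow> continuous_on S A"
  by (rule linear_continuous_on[OF op_bounded_linear])

locale ball_element =
  fixes V :: "'a::complex_hilbert \<Rightarrow> 'b::complex_hilbert" and U X :: "'b \<Rightarrow> 'a" and s c :: real
  assumes V: "V \<in> contrs" and factor: "ball_factor s c V U X" and c: "0 < c" and sc: "s\<^sup>2 + c\<^sup>2 = 1"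
begin

lemma X_ops: "X \<in> ops" and X_space: "X h \<in> defect_space V"
  and U_eq: "U h = adj V h - defect V (X h)" and U: "U \<in> contrs"
  and X_le: "c\<^sup>2 * (norm (X h))\<^sup>2 \<le> s\<^sup>2 * ((norm h)\<^sup>2 - (norm (U h))\<^sup>2)"
  using factor by (auto simp: ball_factor_def)

lemmas V' = contrs_adj[OF V]

text \<open>This will turn out to be \<open>Q D_U\<close>, written down through \<open>X\<close>
  before \<open>Q\<close> is available.\<close>

definition Y :: "'b \<Rightarrow> 'b" where "Y h = V (X h) + defect (adj V) h"

lemma Y_ops: "Y \<in> ops"
  unfolding Y_def[abs_def] by (intro ops_add ops_comp[OF contrs_ops[OF V] X_ops] defect_ops[OF V'])

lemma Y_space: "Y h \<in> defect_space (adj V)"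
  unfolding Y_def
  by (intro csubspace_add[OF csubspace_defect_space[OF V']] contrs_defect_space[OF V X_space] defect_in_space)

lemma defect_Y: "defect (adj V) (Y h) = h - V (U h)"
  by (simp add: Y_def op_add[OF defect_ops[OF V']] defect_intertwine[OF V, symmetric] defect_defect[OF V']
      adj_adj[OF contrs_ops[OF V]] U_eq op_diff[OF contrs_ops[OF V]])

lemma norm_Y: "(norm (Y h))\<^sup>2 = (norm (X h))\<^sup>2 + ((norm h)\<^sup>2 - (norm (U h))\<^sup>2)"
  unfolding Y_def by (rule factor_norm[where U = U, OF V U_eq])

text \<open>Adding the bound on \<open>X\<close> to \<open>norm_Y\<close> leaves the coefficient
  \<open>s^2 + c^2 = 1\<close> in front of \<open>(norm (D_U h))^2\<close>. The resulting bound
  \<open>1 / c\<close> for \<open>Q\<close> degenerates as the angle tends to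
  \<open>\<pi>/2\<close>.\<close>

lemma norm_Y_le: "norm (Y h) \<le> (1 / c) * norm (defect U h)"
proof -
  have "c\<^sup>2 * (norm (Y h))\<^sup>2 \<le> s\<^sup>2 * (norm (defect U h))\<^sup>2 + c\<^sup>2 * (norm (defect U h))\<^sup>2"
    using X_le[of h] by (simp add: norm_Y norm_defect[OF U] distrib_left)
  also have "\<dots> = (norm (defect U h))\<^sup>2"
    by (simp only: distrib_right[symmetric] sc)
  finally have "(c * norm (Y h))\<^sup>2 \<le> (norm (defect U h))\<^sup>2" by (simp add: power_mult_distrib)
  then have "c * norm (Y h) \<le> norm (defect U h)" by (rule power2_le_imp_le) simp
  then show ?thesis using c by (simp add: field_simps)
qed

text \<open>Injectivity of \<open>D_{V*}\<close> on its defect space fixes the values on the range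
  of \<open>D_U\<close>, continuity those on the closure.\<close>

lemma is_Q_unique:
  assumes "is_Q V U Q" "is_Q V U Q'"
  shows "Q = Q'"
proof -
  note S = csubspace_defect_space[OF U] closed_defect_space[of U]
  have Q: "Q \<in> bounded_ops (defect_space U) (defect_space (adj V))"
    "Q' \<in> bounded_ops (defect_space U) (defect_space (adj V))"
    and eq: "h - V (U h) = defect (adj V) (Q (defect U h))" "h - V (U h) = defect (adj V) (Q' (defect U h))" for h
    using assms by (auto simp: is_Q_def)
  have "Q (defect U h) = Q' (defect U h)" for h
    using Q eq[of h] defect_in_space[of U h]
    by (auto simp: bounded_ops_def intro: defect_inj[OF V'])
  then have **: "norm (Q (proj (defect_space U) (defect U h)) - Q' (proj (defect_space U) (defect U h))) \<le> 0" for h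
    by (simp add: proj_same[OF S defect_in_space])
  have "continuous_on UNIV (\<lambda>x. norm (Q (proj (defect_space U) x) - Q' (proj (defect_space U) x)))"
    by (intro continuous_on_norm op_continuous ops_diff bounded_ops_proj[OF S Q(1)]
        bounded_ops_proj[OF S Q(2)])
  from closed_le_defect_space[OF this continuous_on_const **]
  have *: "norm (Q (proj (defect_space U) x) - Q' (proj (defect_space U) x)) \<le> 0"
    if "x \<in> defect_space U" for x
    using that .
  show ?thesis
    by (rule bounded_ops_eqI[OF Q]) (use *[unfolded norm_le_zero_iff] proj_same[OF S] in simp)
qed

lemma is_Q_exists: "\<exists>Q. is_Q V U Q \<and> (\<forall>h. Q (defect U h) = Y h)"
proof -
  have c1: "0 \<le> 1 / c" using c by simp
  obtain W where W: "W \<in> ops" "\<And>h. W (defect U h) = Y h" "\<And>x. W x \<in> closure (range Y)"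
    by (rule douglas[OF Y_ops defect_ops[OF U] c1 norm_Y_le]) blast
  have "closure (range Y) \<subseteq> defect_space (adj V)"
    using Y_space by (intro closure_minimal closed_defect_space) auto
  then have WS: "W x \<in> defect_space (adj V)" for x using W(3) by blast
  let ?Q = "\<lambda>x. if x \<in> defect_space U then W x else 0"
  have Qb: "?Q \<in> bounded_ops (defect_space U) (defect_space (adj V))"
    by (rule ops_restrict[OF csubspace_defect_space[OF U] W(1) WS])
  have QY: "?Q (defect U h) = Y h" for h by (simp add: defect_in_space W(2))
  then have "is_Q V U ?Q" unfolding is_Q_def using Qb by (simp only: QY defect_Y) simp
  then show ?thesis using QY by blast
qed

lemma ex1_Q: "\<exists>!Q. is_Q V U Q"
  using is_Q_exists is_Q_unique by blast

lemma Q_op_is_Q: "is_Q V U (Q_op V U)"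
  unfolding Q_op_def by (rule theI'[OF ex1_Q])

lemma Q_op_bounded: "Q_op V U \<in> bounded_ops (defect_space U) (defect_space (adj V))"
  using Q_op_is_Q by (simp add: is_Q_def)

lemma Q_op_defect: "Q_op V U (defect U h) = Y h"
  using is_Q_exists is_Q_unique[OF Q_op_is_Q] by metis

lemma Q0_graph_eq: "Q0_graph V U = range (\<lambda>h. (defect U h, Y h))"
proof (intro equalityI subsetI)
  fix p assume "p \<in> Q0_graph V U"
  then obtain h k where p: "p = (defect U h, k)" "k \<in> defect_space (adj V)" "h - V (U h) = defect (adj V) k"
    by (auto simp: Q0_graph_def)
  then have "defect (adj V) k = defect (adj V) (Y h)" by (simp add: defect_Y)
  then have "k = Y h" by (rule defect_inj[OF V' p(2) Y_space])
  then show "p \<in> range (\<lambda>h. (defect U h, Y h))" using p(1) by blast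
next
  note S = csubspace_defect_space[OF U] closed_defect_space[of U]
  fix p assume "p \<in> range (\<lambda>h. (defect U h, Y h))"
  then obtain h where p: "p = (defect U h, Y h)" by blast
  \<comment> \<open>The graph demands \<open>h\<close> in the closure of the range of
    \<open>D_U\<close>. Projecting changes neither \<open>D_U h\<close> nor, since \<open>Y\<close>
    factors through \<open>D_U\<close>, the value \<open>Y h\<close>.\<close>
  define h' where "h' = proj (defect_space U) h"
  have d: "defect U h' = defect U h" unfolding h'_def by (rule defect_proj[OF U])
  then have "Y h' = Y h" using Q_op_defect[of h] Q_op_defect[of h'] by simp
  then have "p = (defect U h', Y h')" using p d by simp
  moreover have "h' \<in> defect_space U" unfolding h'_def by (rule proj_in[OF S])
  ultimately show "p \<in> Q0_graph V U"
    unfolding Q0_graph_def using Y_space[of h'] defect_Y[of h'] by fastforce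
qed

text \<open>A bounded operator has a closed graph over the closed space
  \<open>defect_space U\<close>, and \<open>Q0_graph\<close> is the part of it over the dense range
  of \<open>D_U\<close>.\<close>

lemma Q_graph_closure: "{(x, Q_op V U x) | x. x \<in> defect_space U} = closure (Q0_graph V U)"
proof -
  note S = csubspace_defect_space[OF U] closed_defect_space[of U]
  define W where "W x = Q_op V U (proj (defect_space U) x)" for x
  have W_ops: "W \<in> ops" unfolding W_def[abs_def] by (rule bounded_ops_proj[OF S Q_op_bounded])
  have W: "Q_op V U x = W x" if "x \<in> defect_space U" for x by (simp add: W_def proj_same[OF S that])
  let ?f = "\<lambda>x. (x, W x)"
  have cont: "continuous_on A ?f" for A
    by (intro continuous_intros op_continuous_on[OF W_ops])
  have "Q0_graph V U = ?f ` range (defect U)"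
    unfolding Q0_graph_eq using W[OF defect_in_space] Q_op_defect by (auto simp: image_image)
  moreover have "closure (?f ` range (defect U)) = ?f ` defect_space U"
  proof
    have "?f ` defect_space U = {p. fst p \<in> defect_space U \<and> snd p = W (fst p)}" by force
    moreover have "closed {p. fst p \<in> defect_space U \<and> snd p = W (fst p)}"
    proof (rule closed_Collect_conj)
      show "closed {p::'b \<times> 'b. fst p \<in> defect_space U}"
        using closed_vimage[OF S(2), of fst] by (simp add: vimage_def continuous_on_fst continuous_on_id)
      show "closed {p. snd p = W (fst p)}"
        by (intro closed_Collect_eq continuous_intros op_continuous_on[OF W_ops])
    qed
    ultimately have "closed (?f ` defect_space U)" by simp
    then show "closure (?f ` range (defect U)) \<subseteq> ?f ` defect_space U"
      by (rule closure_minimal[rotated]) (use defect_in_space in blast)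
    show "?f ` defect_space U \<subseteq> closure (?f ` range (defect U))"
      unfolding defect_space_def by (rule image_closure_subset[OF cont closed_closure closure_subset])
  qed
  moreover have "{(x, Q_op V U x) | x. x \<in> defect_space U} = ?f ` defect_space U"
    using W by auto
  ultimately show ?thesis by simp
qed

end

section \<open>Norm conditions rewritten as inequalities between quadratic forms\<close>

lemma norm_rotated_pair:
  fixes k q :: "'a::complex_hilbert"
  assumes "0 \<le> n" "0 \<le> s" "0 \<le> c"
  shows "norm (s *\<^sub>R k + (\<i> * complex_of_real c) *\<^sub>C q) \<le> n \<and> norm (s *\<^sub>R k - (\<i> * complex_of_real c) *\<^sub>C q) \<le> n
    \<longleftrightarrow> s\<^sup>2 * (norm k)\<^sup>2 + c\<^sup>2 * (norm q)\<^sup>2 + 2 * (s * c) * \<bar>Im (cinner k q)\<bar> \<le> n\<^sup>2"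
proof -
  have sq: "norm w \<le> n \<longleftrightarrow> (norm w)\<^sup>2 \<le> n\<^sup>2" for w :: 'a
    using assms by (simp add: power2_le_iff_abs_le)
  \<comment> \<open>The two norms differ only in the sign of this cross term, so together the
    conditions amount to one inequality with an absolute value.\<close>
  have re: "Re (cinner (s *\<^sub>R k) ((\<i> * complex_of_real c) *\<^sub>C q)) = (s * c) * Im (cinner k q)"
    by (simp add: cinner_simps)
  have n1: "(norm (s *\<^sub>R k))\<^sup>2 = s\<^sup>2 * (norm k)\<^sup>2" by (simp add: power_mult_distrib)
  have n2: "(norm ((\<i> * complex_of_real c) *\<^sub>C q))\<^sup>2 = c\<^sup>2 * (norm q)\<^sup>2"
    by (simp add: norm_scaleC norm_mult power_mult_distrib)
  have "\<bar>(s * c) * Im (cinner k q)\<bar> = (s * c) * \<bar>Im (cinner k q)\<bar>"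
    using assms by (simp add: abs_mult)
  then show ?thesis unfolding sq norm_add_sq norm_diff_sq re n1 n2 by linarith
qed

lemma op_norm_rotated_pair:
  assumes K: "K \<in> bounded_ops S S'" "Q \<in> bounded_ops S S'" and S: "csubspace S" "closed S"
    and "0 \<le> s" "0 \<le> c"
  shows "op_norm S (\<lambda>x. s *\<^sub>R K x + (\<i> * complex_of_real c) *\<^sub>C Q x) \<le> 1 \<and>
      op_norm S (\<lambda>x. s *\<^sub>R K x - (\<i> * complex_of_real c) *\<^sub>C Q x) \<le> 1
    \<longleftrightarrow> (\<forall>x\<in>S. s\<^sup>2 * (norm (K x))\<^sup>2 + c\<^sup>2 * (norm (Q x))\<^sup>2 + 2 * (s * c) * \<bar>Im (cinner (K x) (Q x))\<bar> \<le> (norm x)\<^sup>2)"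
proof -
  have ne: "S \<noteq> {}" using csubspace_0[OF S(1)] by auto
  note KP = bounded_ops_proj[OF S K(1)] and QP = bounded_ops_proj[OF S K(2)]
  obtain B where B: "norm (s *\<^sub>R K (proj S x) + (\<i> * complex_of_real c) *\<^sub>C Q (proj S x)) \<le> B * norm x" for x
    by (rule op_bound[OF ops_add[OF ops_scaleR[OF KP] ops_scaleC[OF QP]]]) blast
  obtain B' where B': "norm (s *\<^sub>R K (proj S x) - (\<i> * complex_of_real c) *\<^sub>C Q (proj S x)) \<le> B' * norm x" for x
    by (rule op_bound[OF ops_diff[OF ops_scaleR[OF KP] ops_scaleC[OF QP]]]) blast
  have "op_norm S (\<lambda>x. s *\<^sub>R K x + (\<i> * complex_of_real c) *\<^sub>C Q x) \<le> 1
      \<longleftrightarrow> (\<forall>x\<in>S. norm (s *\<^sub>R K x + (\<i> * complex_of_real c) *\<^sub>C Q x) \<le> norm x)"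
    by (rule op_norm_le_1_iff[OF ne, of _ B]) (use B proj_same[OF S] in metis)
  moreover have "op_norm S (\<lambda>x. s *\<^sub>R K x - (\<i> * complex_of_real c) *\<^sub>C Q x) \<le> 1
      \<longleftrightarrow> (\<forall>x\<in>S. norm (s *\<^sub>R K x - (\<i> * complex_of_real c) *\<^sub>C Q x) \<le> norm x)"
    by (rule op_norm_le_1_iff[OF ne, of _ B']) (use B' proj_same[OF S] in metis)
  ultimately show ?thesis
    unfolding norm_rotated_pair[OF norm_ge_zero assms(5,6), symmetric] by blast
qed

text \<open>For \<open>\<phi> > 0\<close>, cancelling \<open>sin \<phi>\<close> turns the norm
  conditions into the second inequality, which implies contractivity. At \<open>\<phi> = 0\<close>
  that inequality says \<open>Im (cinner (T x) x) = 0\<close>, that is, selfadjointness; one formula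
  thus covers all angles.\<close>

lemma C_class_iff:
  fixes T :: "'h::complex_hilbert \<Rightarrow> 'h"
  assumes T: "T \<in> ops" and "0 \<le> \<phi>" "\<phi> \<le> pi / 2"
  shows "T \<in> C_class \<phi> \<longleftrightarrow> (\<forall>x. norm (T x) \<le> norm x) \<and>
    (\<forall>x. 2 * cos \<phi> * \<bar>Im (cinner (T x) x)\<bar> \<le> sin \<phi> * ((norm x)\<^sup>2 - (norm (T x))\<^sup>2))"
proof (cases "\<phi> = 0")
  case True
  then show ?thesis
    using selfadj_iff_Im[OF T] selfadj_iff_adj[OF T] T by (auto simp: C_class_def contrs_iff)
next
  case False
  have s: "0 < sin \<phi>" using False assms by (intro sin_gt_zero) auto
  have c: "0 \<le> cos \<phi>" using assms by (intro cos_ge_zero) auto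
  have "T \<in> C_class \<phi> \<longleftrightarrow> (\<forall>x. (sin \<phi>)\<^sup>2 * (norm (T x))\<^sup>2 + (cos \<phi>)\<^sup>2 * (norm x)\<^sup>2
      + 2 * (sin \<phi> * cos \<phi>) * \<bar>Im (cinner (T x) x)\<bar> \<le> (norm x)\<^sup>2)"
    using op_norm_rotated_pair[OF T ops_id, of "sin \<phi>" "cos \<phi>"] False s c T
    by (simp add: C_class_def)
  also have "\<dots> \<longleftrightarrow> (\<forall>x. 2 * cos \<phi> * \<bar>Im (cinner (T x) x)\<bar> \<le> sin \<phi> * ((norm x)\<^sup>2 - (norm (T x))\<^sup>2))"
  proof (rule iff_allI)
    fix x :: 'h
    have "(cos \<phi>)\<^sup>2 * (norm x)\<^sup>2 = (norm x)\<^sup>2 - (sin \<phi>)\<^sup>2 * (norm x)\<^sup>2"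
      by (simp add: cos_squared_eq left_diff_distrib)
    moreover have "sin \<phi> * (2 * cos \<phi> * \<bar>Im (cinner (T x) x)\<bar>)
        = 2 * (sin \<phi> * cos \<phi>) * \<bar>Im (cinner (T x) x)\<bar>"
      by simp
    moreover have "sin \<phi> * (sin \<phi> * ((norm x)\<^sup>2 - (norm (T x))\<^sup>2))
        = (sin \<phi>)\<^sup>2 * (norm x)\<^sup>2 - (sin \<phi>)\<^sup>2 * (norm (T x))\<^sup>2"
      by (simp add: power2_eq_square right_diff_distrib mult.assoc)
    ultimately have "(sin \<phi>)\<^sup>2 * (norm (T x))\<^sup>2 + (cos \<phi>)\<^sup>2 * (norm x)\<^sup>2
          + 2 * (sin \<phi> * cos \<phi>) * \<bar>Im (cinner (T x) x)\<bar> \<le> (norm x)\<^sup>2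
        \<longleftrightarrow> sin \<phi> * (2 * cos \<phi> * \<bar>Im (cinner (T x) x)\<bar>) \<le> sin \<phi> * (sin \<phi> * ((norm x)\<^sup>2 - (norm (T x))\<^sup>2))"
      by linarith
    also have "\<dots> \<longleftrightarrow> 2 * cos \<phi> * \<bar>Im (cinner (T x) x)\<bar> \<le> sin \<phi> * ((norm x)\<^sup>2 - (norm (T x))\<^sup>2)"
      using s by (rule mult_le_cancel_left_pos)
    finally show "(sin \<phi>)\<^sup>2 * (norm (T x))\<^sup>2 + (cos \<phi>)\<^sup>2 * (norm x)\<^sup>2
          + 2 * (sin \<phi> * cos \<phi>) * \<bar>Im (cinner (T x) x)\<bar> \<le> (norm x)\<^sup>2
        \<longleftrightarrow> 2 * cos \<phi> * \<bar>Im (cinner (T x) x)\<bar> \<le> sin \<phi> * ((norm x)\<^sup>2 - (norm (T x))\<^sup>2)" .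
  qed
  also have "\<dots> \<longleftrightarrow> (\<forall>x. norm (T x) \<le> norm x) \<and>
    (\<forall>x. 2 * cos \<phi> * \<bar>Im (cinner (T x) x)\<bar> \<le> sin \<phi> * ((norm x)\<^sup>2 - (norm (T x))\<^sup>2))"
  proof -
    have "norm (T x) \<le> norm x"
      if "2 * cos \<phi> * \<bar>Im (cinner (T x) x)\<bar> \<le> sin \<phi> * ((norm x)\<^sup>2 - (norm (T x))\<^sup>2)" for x
    proof -
      have "0 \<le> sin \<phi> * ((norm x)\<^sup>2 - (norm (T x))\<^sup>2)"
        by (rule order_trans[OF _ that]) (use c in simp)
      then have "(norm (T x))\<^sup>2 \<le> (norm x)\<^sup>2" using s by (simp add: zero_le_mult_iff)
      then show ?thesis by (rule power2_le_imp_le) simp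
    qed
    then show ?thesis by blast
  qed
  finally show ?thesis .
qed

text \<open>\<open>adj_on\<close> is a definite description, so \<open>adj_on S S K = K\<close> is
  informative only once an adjoint has been exhibited. It is the compression to \<open>S\<close> of
  the adjoint of \<open>W\<close>, the extension of \<open>K\<close> by the projection.\<close>

lemma symmetric_iff_adj_on:
  assumes K: "K \<in> bounded_ops S S" and S: "csubspace S" "closed S"
  shows "adj_on S S K = K \<longleftrightarrow> (\<forall>x\<in>S. Im (cinner (K x) x) = 0)"
proof -
  define W where "W x = K (proj S x)" for x
  have W_ops: "W \<in> ops" unfolding W_def[abs_def] by (rule bounded_ops_proj[OF S K])
  have WK: "W x = K x" if "x \<in> S" for x by (simp add: W_def proj_same[OF S that])
  have W_in: "W x \<in> S" for x using K proj_in[OF S] by (simp add: W_def bounded_ops_def)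
  have projr: "cinner x (proj S y) = cinner x y" if "x \<in> S" for x y
    using proj_orth[OF S that, of y] by (simp add: cinner_eq_zero_iff_commute[of _ x] cinner_diff_right)
  show ?thesis
  proof
    assume eq: "adj_on S S K = K"
    let ?B = "\<lambda>y. if y \<in> S then proj S (adj W y) else 0"
    have "?B \<in> bounded_ops S S"
      using ops_restrict[OF S(1) ops_comp[OF ops_proj[OF S] ops_adj[OF W_ops]], of S] proj_in[OF S] by simp
    then have "adj_on S S K = ?B"
      by (rule adj_on_eqI) (use S in \<open>auto simp: projr cinner_adj_right[OF W_ops] WK\<close>)
    then have KB: "K y = proj S (adj W y)" if "y \<in> S" for y using eq that by (metis (full_types))
    have "cinner (K x) x = cnj (cinner (K x) x)" if "x \<in> S" for x
      using projr[OF that, of "adj W x"] cinner_commute[of x "K x"]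
      by (simp add: KB[OF that, symmetric] cinner_adj_right[OF W_ops] WK[OF that])
    then show "\<forall>x\<in>S. Im (cinner (K x) x) = 0" by (auto simp: complex_eq_iff)
  next
    assume im: "\<forall>x\<in>S. Im (cinner (K x) x) = 0"
    have "Im (cinner (W x) x) = 0" for x
    proof -
      have "cinner (W x) x = cinner (K (proj S x)) (proj S x)"
        using projr[OF W_in] by (simp add: W_def)
      then show ?thesis using im proj_in[OF S] by simp
    qed
    then have "selfadj W" by (simp add: selfadj_iff_Im[OF W_ops])
    then have "cinner (K x) y = cinner x (K y)" if "x \<in> S" "y \<in> S" for x y
      using selfadj_cinner[of W x y] WK that by simp
    then show "adj_on S S K = K" by (rule adj_on_eqI[OF K _ S(1)])
  qed
qed

context ball_element
begin

text \<open>At \<open>x = D_U h\<close>, \<open>norm_Y\<close> splits the term with \<open>Q\<close>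
  into \<open>c^2 * (norm (X h))^2\<close> and \<open>(1 - s^2) * (norm (D_U h))^2\<close>; moving
  the latter across leaves the factor \<open>s^2\<close> on the right. By continuity such
  \<open>x\<close> suffice.\<close>

lemma hole_pointwise:
  assumes K: "K \<in> bounded_ops (defect_space U) (defect_space (adj V))" and "0 \<le> s"
  shows "(\<forall>x\<in>defect_space U. s\<^sup>2 * (norm (K x))\<^sup>2 + c\<^sup>2 * (norm (Q_op V U x))\<^sup>2
      + 2 * (s * c) * \<bar>Im (cinner (K x) (Q_op V U x))\<bar> \<le> (norm x)\<^sup>2)
    \<longleftrightarrow> (\<forall>h. s\<^sup>2 * (norm (K (defect U h)))\<^sup>2 + c\<^sup>2 * (norm (X h))\<^sup>2
      + 2 * (s * c) * \<bar>Im (cinner (K (defect U h)) (Y h))\<bar> \<le> s\<^sup>2 * (norm (defect U h))\<^sup>2)"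
    (is "?L \<longleftrightarrow> ?R")
proof -
  note S = csubspace_defect_space[OF U] closed_defect_space[of U]
  define f where "f x = s\<^sup>2 * (norm (K (proj (defect_space U) x)))\<^sup>2
      + c\<^sup>2 * (norm (Q_op V U (proj (defect_space U) x)))\<^sup>2
      + 2 * (s * c) * \<bar>Im (cinner (K (proj (defect_space U) x)) (Q_op V U (proj (defect_space U) x)))\<bar>" for x
  have cont: "continuous_on UNIV f"
    unfolding f_def
    by (intro continuous_intros op_continuous[OF bounded_ops_proj[OF S K]]
        op_continuous[OF bounded_ops_proj[OF S Q_op_bounded]])
  have "?L \<longleftrightarrow> (\<forall>x\<in>defect_space U. f x \<le> (norm x)\<^sup>2)"
    by (simp add: f_def proj_same[OF S])
  also have "\<dots> \<longleftrightarrow> (\<forall>h. f (defect U h) \<le> (norm (defect U h))\<^sup>2)"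
    using closed_le_defect_space[OF cont, of "\<lambda>x. (norm x)\<^sup>2" U] defect_in_space
    by (auto intro: continuous_intros)
  also have "\<dots> \<longleftrightarrow> ?R"
  proof (rule iff_allI)
    fix h
    have "c\<^sup>2 * (norm (Y h))\<^sup>2 = c\<^sup>2 * (norm (X h))\<^sup>2 + (norm (defect U h))\<^sup>2 - s\<^sup>2 * (norm (defect U h))\<^sup>2"
      using arg_cong[OF sc, of "\<lambda>t. t * (norm (defect U h))\<^sup>2"]
      by (simp add: norm_Y norm_defect[OF U] algebra_simps)
    then show "f (defect U h) \<le> (norm (defect U h))\<^sup>2 \<longleftrightarrow>
      s\<^sup>2 * (norm (K (defect U h)))\<^sup>2 + c\<^sup>2 * (norm (X h))\<^sup>2
        + 2 * (s * c) * \<bar>Im (cinner (K (defect U h)) (Y h))\<bar> \<le> s\<^sup>2 * (norm (defect U h))\<^sup>2"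
      unfolding f_def proj_same[OF S defect_in_space] Q_op_defect by linarith
  qed
  finally show ?thesis .
qed

lemma operator_hole_iff:
  assumes "0 < \<phi>" "\<phi> < pi / 2" "s = sin \<phi>" "c = cos \<phi>"
  shows "K \<in> operator_hole \<phi> V U \<longleftrightarrow> K \<in> bounded_ops (defect_space U) (defect_space (adj V)) \<and>
    (\<forall>h. s\<^sup>2 * (norm (K (defect U h)))\<^sup>2 + c\<^sup>2 * (norm (X h))\<^sup>2
      + 2 * (s * c) * \<bar>Im (cinner (K (defect U h)) (Y h))\<bar> \<le> s\<^sup>2 * (norm (defect U h))\<^sup>2)"
proof (cases "K \<in> bounded_ops (defect_space U) (defect_space (adj V))")
  case True
  have s: "0 \<le> s" using assms by (simp add: sin_ge_zero)
  show ?thesis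
    using op_norm_rotated_pair[OF True Q_op_bounded csubspace_defect_space[OF U] closed_defect_space s less_imp_le[OF c]]
      hole_pointwise[OF True s] True assms
    by (simp add: operator_hole_def)
qed (simp add: operator_hole_def)

text \<open>For \<open>s = 0\<close> the factor \<open>X\<close> vanishes, so \<open>U = V*\<close>
  and \<open>Y = D_U\<close>: \<open>Q\<close> acts as the identity, and the condition on the
  imaginary part is symmetry of \<open>K\<close>.\<close>

lemma operator_hole_0_iff:
  assumes "s = 0"
  shows "K \<in> operator_hole 0 V U \<longleftrightarrow> K \<in> contractions (defect_space U) (defect_space (adj V)) \<and>
    (\<forall>h. Im (cinner (K (defect U h)) (Y h)) = 0)"
proof -
  have X0: "X h = 0" for h using X_le[of h] assms c by (simp add: mult_le_0_iff)
  have UV: "U = adj V" using U_eq by (auto simp: X0 op_zero[OF defect_ops[OF V]])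
  have Y: "Y h = defect U h" for h by (simp add: Y_def X0 UV op_zero[OF contrs_ops[OF V]])
  note S = csubspace_defect_space[OF U] closed_defect_space[of U]
  show ?thesis
  proof (cases "K \<in> bounded_ops (defect_space U) (defect_space (adj V))")
    case True
    then have K: "K \<in> bounded_ops (defect_space U) (defect_space U)" by (simp add: UV)
    have cont: "continuous_on UNIV (\<lambda>x. \<bar>Im (cinner (K (proj (defect_space U) x)) x)\<bar>)"
      by (intro continuous_intros op_continuous[OF bounded_ops_proj[OF S K]])
    have "(\<forall>x\<in>defect_space U. Im (cinner (K x) x) = 0)
      \<longleftrightarrow> (\<forall>x\<in>defect_space U. \<bar>Im (cinner (K (proj (defect_space U) x)) x)\<bar> \<le> 0)"
      by (simp add: proj_same[OF S])
    also have "\<dots> \<longleftrightarrow> (\<forall>h. \<bar>Im (cinner (K (proj (defect_space U) (defect U h))) (defect U h))\<bar> \<le> 0)"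
      using closed_le_defect_space[OF cont, of "\<lambda>x. 0" U] defect_in_space
      by (auto intro: continuous_intros)
    also have "\<dots> \<longleftrightarrow> (\<forall>h. Im (cinner (K (defect U h)) (Y h)) = 0)"
      by (simp add: proj_same[OF S defect_in_space] Y)
    finally show ?thesis
      using symmetric_iff_adj_on[OF K S] True
      by (auto simp: operator_hole_def contractions_def UV)
  qed (simp add: operator_hole_def contractions_def)
qed

end

section \<open>Extensions of a symmetric contraction\<close>

locale extension =
  fixes A :: "'a::complex_hilbert \<Rightarrow> 'a" and V :: "'a \<Rightarrow> 'b::complex_hilbert"
  assumes A: "A \<in> contrs" and A_sa: "selfadj A" and V: "V \<in> contrs"
    and ker: "\<And>f. defect A f = 0 \<Longrightarrow> V f = 0"
begin

lemmas V' = contrs_adj[OF V]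
lemmas Aop = contrs_ops[OF A] and Vop = contrs_ops[OF V]
lemmas adjA = selfadj_adj[OF A_sa]

text \<open>\<open>(f, u) \<mapsto> (A f + D\<^sub>A u, D\<^sub>A f - A u)\<close> is unitary; the second component is the variable
  \<open>y\<close> in which all quadratic forms below become independent of \<open>A\<close>.\<close>

lemma norm_unitary: "(norm (A f + defect A u))\<^sup>2 + (norm (defect A f - A u))\<^sup>2 = (norm f)\<^sup>2 + (norm u)\<^sup>2"
  using norm_row_defect[OF A, of f u] by (simp add: adjA)

text \<open>The first identity applies two isometries in turn, that of \<open>A\<close> at
  \<open>(f, U h)\<close> and that of \<open>V\<close> at \<open>(y, k)\<close>. In the second,
  selfadjointness makes the diagonal values of \<open>A\<close> at \<open>f\<close> and
  \<open>U h\<close> real, so \<open>A\<close> remains only inside \<open>y\<close>.\<close>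

lemma form_identities:
  fixes U f h k
  defines "y \<equiv> defect A f - A (U h)"
  defines "t1 \<equiv> A f + defect A (U h)" and "t2 \<equiv> V (defect A f) + (- V (A (U h)) + defect (adj V) k)"
  shows "(norm f)\<^sup>2 + (norm h)\<^sup>2 - ((norm t1)\<^sup>2 + (norm t2)\<^sup>2)
      = (norm h)\<^sup>2 - (norm (U h))\<^sup>2 - (norm k)\<^sup>2 + (norm (defect V y - adj V k))\<^sup>2"
    and "Im (cinner t1 f + cinner t2 h) = Im (cinner y (adj V h - U h) + cinner (defect (adj V) k) h)"
proof -
  have t2: "t2 = V y + defect (adj V) k"
    by (simp add: t2_def y_def op_diff[OF Vop])
  show "(norm f)\<^sup>2 + (norm h)\<^sup>2 - ((norm t1)\<^sup>2 + (norm t2)\<^sup>2)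
      = (norm h)\<^sup>2 - (norm (U h))\<^sup>2 - (norm k)\<^sup>2 + (norm (defect V y - adj V k))\<^sup>2"
    using norm_unitary[of f "U h"] norm_row_defect[OF V, of y k]
    by (simp add: t2 t1_def y_def)
  have im: "Im (cinner (A x) x) = 0" for x using A_sa selfadj_iff_Im[OF Aop] by blast
  have "cinner t1 f = cinner (A f) f + cinner (U h) (y + A (U h))"
    by (simp add: t1_def cinner_add_left defect_cinner[OF A] y_def)
  moreover have "Im (cinner (U h) (A (U h))) = 0"
    using im[of "U h"] cinner_commute[of "U h" "A (U h)"] by simp
  moreover have "Im (cinner (U h) y) = - Im (cinner y (U h))"
    using cinner_commute[of "U h" y] by simp
  ultimately show "Im (cinner t1 f + cinner t2 h) = Im (cinner y (adj V h - U h) + cinner (defect (adj V) k) h)"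
    by (simp add: t2 cinner_simps im cinner_adj_right[OF Vop])
qed

text \<open>\<open>A u\<close> lies in \<open>defect_space A\<close>, so the shifted range is dense
  there; \<open>stable\<close> takes care of the remaining component of \<open>y\<close>, which is
  in the kernel of \<open>defect A\<close>.\<close>

lemma extend_to_all:
  fixes F G :: "'a \<Rightarrow> real"
  assumes u: "u \<in> defect_space A" and cont: "continuous_on UNIV F" "continuous_on UNIV G"
    and le: "\<And>f. F (defect A f - A u) \<le> G (defect A f - A u)"
    and stable: "\<And>y z. y \<in> defect_space A \<Longrightarrow> defect A z = 0 \<Longrightarrow> F y \<le> G y \<Longrightarrow> F (y + z) \<le> G (y + z)"
  shows "F y \<le> G y"
proof -
  note S = csubspace_defect_space[OF A] closed_defect_space[of A]
  let ?p = "proj (defect_space A) y"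
  have Au: "A u \<in> defect_space A" using contrs_defect_space[OF A u] by (simp add: adjA)
  have c: "continuous_on UNIV (\<lambda>x. H (x - A u))" if "continuous_on UNIV H" for H :: "'a \<Rightarrow> real"
    by (rule continuous_on_compose2[OF that]) (auto intro!: continuous_intros)
  have "F (?p + A u - A u) \<le> G (?p + A u - A u)"
    by (rule closed_le_defect_space[OF c[OF cont(1)] c[OF cont(2)] le])
       (intro csubspace_add[OF S(1)] Au proj_in[OF S])
  then have "F ?p \<le> G ?p" by simp
  moreover have "defect A (y - ?p) = 0" by (simp add: op_diff[OF defect_ops[OF A]] defect_proj[OF A])
  ultimately have "F (?p + (y - ?p)) \<le> G (?p + (y - ?p))" by (intro stable proj_in[OF S])
  then show ?thesis by simp
qed

text \<open>The upper row \<open>(A, T12)\<close> yields \<open>U\<close>. In the variable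
  \<open>y\<close> the lower row becomes a contractive row \<open>(V, W)\<close> with
  \<open>W D_U = T22 + V A U\<close>, and its factorization through \<open>D_{V*}\<close> yields
  \<open>K\<close>.\<close>

lemma contractive_parameters:
  fixes T12 :: "'c::complex_hilbert \<Rightarrow> 'a" and T22 :: "'c \<Rightarrow> 'b"
  assumes T12: "T12 \<in> ops" and T22: "T22 \<in> ops"
    and le: "\<And>f h. (norm (A f + T12 h))\<^sup>2 + (norm (V (defect A f) + T22 h))\<^sup>2 \<le> (norm f)\<^sup>2 + (norm h)\<^sup>2"
  obtains U K where "U \<in> contrs" "\<And>h. U h \<in> defect_space A"
    "K \<in> contractions (defect_space U) (defect_space (adj V))"
    "\<And>h. T12 h = defect A (U h)" "\<And>h. T22 h = - V (A (U h)) + defect (adj V) (K (defect U h))"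
proof -
  have "(norm (A f + T12 h))\<^sup>2 \<le> (norm f)\<^sup>2 + (norm h)\<^sup>2" for f h
    using le[of f h] zero_le_power2[of "norm (V (defect A f) + T22 h)"] by linarith
  then obtain U where U: "U \<in> contrs" "\<And>h. T12 h = defect (adj A) (U h)" "\<And>h. U h \<in> defect_space (adj A)"
    by (rule row_contraction[OF A T12]) blast
  have US: "U h \<in> defect_space A" and TU: "T12 h = defect A (U h)" for h using U by (simp_all add: adjA)
  note SU = csubspace_defect_space[OF U(1)] closed_defect_space[of U]
  define Z where "Z h = T22 h + V (A (U h))" for h
  have Z_ops: "Z \<in> ops"
    unfolding Z_def[abs_def] by (intro ops_add T22 ops_comp[OF Vop ops_comp[OF Aop contrs_ops[OF U(1)]]])
  have row: "(norm (V y + Z h))\<^sup>2 \<le> (norm y)\<^sup>2 + (norm (defect U h))\<^sup>2" for y h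
  proof (rule extend_to_all[OF US[of h], of "\<lambda>y. (norm (V y + Z h))\<^sup>2" "\<lambda>y. (norm y)\<^sup>2 + (norm (defect U h))\<^sup>2"])
    show "continuous_on UNIV (\<lambda>y. (norm (V y + Z h))\<^sup>2)"
      by (intro continuous_intros op_continuous[OF Vop])
    show "continuous_on UNIV (\<lambda>y::'a. (norm y)\<^sup>2 + (norm (defect U h))\<^sup>2)"
      by (intro continuous_intros)
    fix f
    have "V (defect A f - A (U h)) + Z h = V (defect A f) + T22 h"
      by (simp add: Z_def op_diff[OF Vop])
    then show "(norm (V (defect A f - A (U h)) + Z h))\<^sup>2 \<le> (norm (defect A f - A (U h)))\<^sup>2 + (norm (defect U h))\<^sup>2"
      using le[of f h] norm_unitary[of f "U h"] by (simp add: TU norm_defect[OF U(1)])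
  next
    \<comment> \<open>Along the kernel the left side is constant, because \<open>V z = 0\<close>,
      while the right side grows by Pythagoras.\<close>
    fix y z assume y: "y \<in> defect_space A" and z: "defect A z = 0"
      and IH: "(norm (V y + Z h))\<^sup>2 \<le> (norm y)\<^sup>2 + (norm (defect U h))\<^sup>2"
    have "(norm (y + z))\<^sup>2 = (norm y)\<^sup>2 + (norm z)\<^sup>2"
      by (simp add: norm_add_sq defect_kernel_orthogonal[OF A y z])
    then show "(norm (V (y + z) + Z h))\<^sup>2 \<le> (norm (y + z))\<^sup>2 + (norm (defect U h))\<^sup>2"
      using IH zero_le_power2[of "norm z"] unfolding op_add[OF Vop] ker[OF z] add_0_right by linarith
  qed
  \<comment> \<open>Taking \<open>y = 0\<close> isolates \<open>Z\<close> and lets it factor through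
    \<open>D_U\<close>.\<close>
  have "norm (Z h) \<le> 1 * norm (defect U h)" for h
  proof -
    have "(norm (Z h))\<^sup>2 \<le> (norm (defect U h))\<^sup>2" using row[of 0 h] by (simp add: op_zero[OF Vop])
    then show ?thesis using power2_le_imp_le[of "norm (Z h)" "norm (defect U h)"] by simp
  qed
  then obtain W where W: "W \<in> ops" "\<And>h. W (defect U h) = Z h" "\<And>x. (\<And>h. cinner x (defect U h) = 0) \<Longrightarrow> W x = 0"
    by (rule douglas[OF Z_ops defect_ops[OF U(1)] zero_le_one]) blast
  have "(norm (V y + W g))\<^sup>2 \<le> (norm y)\<^sup>2 + (norm g)\<^sup>2" for y g
  proof -
    let ?p = "proj (defect_space U) g"
    \<comment> \<open>\<open>W\<close> was chosen to vanish on the orthogonal complement of the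
      range of \<open>D_U\<close>, which reduces arbitrary \<open>g\<close> to the closure of that
      range.\<close>
    have "W (g - ?p) = 0" by (intro W(3) proj_orth[OF SU] defect_in_space)
    then have Wp: "W g = W ?p" by (simp add: op_diff[OF W(1)])
    have "(norm (V y + W ?p))\<^sup>2 \<le> (norm y)\<^sup>2 + (norm ?p)\<^sup>2"
    proof -
      have "continuous_on UNIV (\<lambda>g. (norm (V y + W g))\<^sup>2)"
        by (intro continuous_intros op_continuous[OF W(1)])
      moreover have "continuous_on UNIV (\<lambda>g::'c. (norm y)\<^sup>2 + (norm g)\<^sup>2)"
        by (intro continuous_intros)
      moreover have "(norm (V y + W (defect U h)))\<^sup>2 \<le> (norm y)\<^sup>2 + (norm (defect U h))\<^sup>2" for h
        by (simp add: W(2) row)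
      ultimately show ?thesis using proj_in[OF SU] by (rule closed_le_defect_space)
    qed
    also have "\<dots> \<le> (norm y)\<^sup>2 + (norm g)\<^sup>2"
      using norm_proj_le[OF SU, of g] by (simp add: power_mono)
    finally show ?thesis unfolding Wp .
  qed
  then obtain C where C: "C \<in> contrs" "\<And>g. W g = defect (adj V) (C g)" "\<And>g. C g \<in> defect_space (adj V)"
    by (rule row_contraction[OF V W(1)]) blast
  define K where "K g = (if g \<in> defect_space U then C g else 0)" for g
  have K: "K \<in> contractions (defect_space U) (defect_space (adj V))"
    unfolding contractions_iff[OF defect_space_nonempty] K_def[abs_def]
    using ops_restrict[OF SU(1) contrs_ops[OF C(1)], of "defect_space (adj V)"] C(3) contrs_le[OF C(1)] by simp
  have "T22 h = - V (A (U h)) + defect (adj V) (K (defect U h))" for h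
    using C(2)[of "defect U h"] by (simp add: K_def defect_in_space W(2) Z_def eq_diff_eq)
  then show thesis using that[OF U(1) US K TU] by blast
qed

text \<open>The estimate on \<open>\<langle>y, W h\<rangle>\<close> with \<open>W = V* - U\<close> yields the factorization \<open>W = D\<^sub>V X\<close>.\<close>

lemma dissipative_parameters:
  assumes U: "U \<in> contrs" and US: "\<And>h. U h \<in> defect_space A"
    and K: "K \<in> contractions (defect_space U) (defect_space (adj V))"
    and c: "0 < c" and s: "0 \<le> s" and sc: "s\<^sup>2 + c\<^sup>2 = 1"
    and est: "\<And>f h. 2 * c * \<bar>Im (cinner (defect A f - A (U h)) (adj V h - U h)
        + cinner (defect (adj V) (K (defect U h))) h)\<bar>
      \<le> s * ((norm (defect U h))\<^sup>2 - (norm (K (defect U h)))\<^sup>2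
        + (norm (defect V (defect A f - A (U h)) - adj V (K (defect U h))))\<^sup>2)"
  obtains X where "ball_factor s c V U X"
    "\<And>h. s\<^sup>2 * (norm (K (defect U h)))\<^sup>2 + c\<^sup>2 * (norm (X h))\<^sup>2
      + 2 * (s * c) * \<bar>Im (cinner (K (defect U h)) (V (X h) + defect (adj V) h))\<bar> \<le> s\<^sup>2 * (norm (defect U h))\<^sup>2"
    "\<And>h. s = 0 \<Longrightarrow> Im (cinner (K (defect U h)) (V (X h) + defect (adj V) h)) = 0"
proof -
  define k where "k h = K (defect U h)" for h
  define W where "W h = adj V h - U h" for h
  define G where "G h = (norm (defect U h))\<^sup>2 - (norm (k h))\<^sup>2" for h
  define \<beta> where "\<beta> h = cinner (defect (adj V) (k h)) h" for h
  have kS: "k h \<in> defect_space (adj V)" and k_le: "norm (k h) \<le> norm (defect U h)" for h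
    using K defect_in_space[of U h] unfolding k_def contractions_iff[OF defect_space_nonempty]
    by (auto simp: bounded_ops_def)
  have W_ops: "W \<in> ops" unfolding W_def[abs_def] by (intro ops_diff contrs_ops[OF V'] contrs_ops[OF U])
  have all: "2 * c * \<bar>Im (cinner y (W h) + \<beta> h)\<bar> \<le> s * (G h + (norm (defect V y - adj V (k h)))\<^sup>2)" for y h
  proof (rule extend_to_all[OF US[of h], of "\<lambda>y. 2 * c * \<bar>Im (cinner y (W h) + \<beta> h)\<bar>"
        "\<lambda>y. s * (G h + (norm (defect V y - adj V (k h)))\<^sup>2)"])
    show "continuous_on UNIV (\<lambda>y. 2 * c * \<bar>Im (cinner y (W h) + \<beta> h)\<bar>)"
      by (intro continuous_intros)
    show "continuous_on UNIV (\<lambda>y. s * (G h + (norm (defect V y - adj V (k h)))\<^sup>2))"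
      by (intro continuous_intros op_continuous[OF defect_ops[OF V]])
    show "2 * c * \<bar>Im (cinner (defect A f - A (U h)) (W h) + \<beta> h)\<bar>
        \<le> s * (G h + (norm (defect V (defect A f - A (U h)) - adj V (k h)))\<^sup>2)" for f
      using est[of f h] by (simp add: W_def G_def \<beta>_def k_def)
  next
    \<comment> \<open>A kernel vector \<open>z\<close> is orthogonal to \<open>W h\<close>, since
      \<open>V z = 0\<close> and \<open>U h\<close> lies in \<open>defect_space A\<close>. Hence the
      left side does not change and the right side can only grow.\<close>
    fix y z assume y: "y \<in> defect_space A" and z: "defect A z = 0"
      and IH: "2 * c * \<bar>Im (cinner y (W h) + \<beta> h)\<bar> \<le> s * (G h + (norm (defect V y - adj V (k h)))\<^sup>2)"
    have yz: "cinner y z = 0" by (rule defect_kernel_orthogonal[OF A y z])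
    have Vz: "V z = 0" by (rule ker[OF z])
    have "cinner z (U h) = 0"
      using defect_kernel_orthogonal[OF A US z] by (simp add: cinner_eq_zero_iff_commute)
    then have zW: "cinner z (W h) = 0" by (simp add: W_def cinner_simps cinner_adj_right[OF Vop] Vz)
    have "cinner (defect V y) (defect V z) = 0"
      by (simp add: defect_cinner[OF V] defect_defect[OF V] Vz op_zero[OF contrs_ops[OF V']] yz)
    moreover have "cinner (adj V (k h)) (defect V z) = 0"
      by (simp add: cinner_adj_left[OF Vop] defect_intertwine[OF V] Vz op_zero[OF defect_ops[OF V']])
    ultimately have "cinner (defect V y - adj V (k h)) (defect V z) = 0" by (simp add: cinner_diff_left)
    moreover have "defect V (y + z) - adj V (k h) = (defect V y - adj V (k h)) + defect V z"
      by (simp add: op_add[OF defect_ops[OF V]])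
    ultimately have "(norm (defect V y - adj V (k h)))\<^sup>2 \<le> (norm (defect V (y + z) - adj V (k h)))\<^sup>2"
      by (simp only: norm_add_sq) simp
    then have "s * (G h + (norm (defect V y - adj V (k h)))\<^sup>2) \<le> s * (G h + (norm (defect V (y + z) - adj V (k h)))\<^sup>2)"
      using s by (intro mult_left_mono) auto
    then show "2 * c * \<bar>Im (cinner (y + z) (W h) + \<beta> h)\<bar> \<le> s * (G h + (norm (defect V (y + z) - adj V (k h)))\<^sup>2)"
      using IH by (simp only: cinner_add_left zW add_0_right)
  qed
  \<comment> \<open>Crude bounds for unit vectors: \<open>G h\<close> plus the square is at most
    \<open>1 + 4\<close>, giving \<open>5 * s\<close>; splitting off \<open>\<beta> h\<close>, whose
    modulus is at most 1, costs \<open>2 * c\<close>.\<close>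
  define C where "C = (5 * s + 2 * c) / (2 * c)"
  have C: "0 < C" using s c by (simp add: C_def)
  have unit: "norm (adj W y) \<le> C" if y: "norm (defect V y) \<le> 1" for y
  proof (cases "adj W y = 0")
    case False
    define w where "w = adj W y"
    \<comment> \<open>The unit vector along \<open>w\<close>, rotated so that
      \<open>cinner y (W h)\<close> is purely imaginary with modulus \<open>norm w\<close>.\<close>
    define h where "h = (\<i> * complex_of_real (1 / norm w)) *\<^sub>C w"
    have w0: "norm w \<noteq> 0" using False by (simp add: w_def)
    have h1: "norm h = 1" using w0 by (simp add: h_def norm_scaleC norm_mult norm_divide)
    have "cinner y (W h) = cinner w h" by (simp add: w_def cinner_adj_left[OF W_ops])
    also have "\<dots> = - \<i> * norm w"
      using w0 by (simp add: h_def cinner_scaleC_right cinner_self power2_eq_square)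
    finally have "\<bar>Im (cinner y (W h))\<bar> = norm w" by simp
    moreover have "\<bar>Im (\<beta> h)\<bar> \<le> 1"
    proof -
      have kh: "norm (k h) \<le> 1" using k_le[of h] norm_defect_le[OF U, of h] h1 by linarith
      have "cmod (\<beta> h) \<le> norm (defect (adj V) (k h)) * norm h" unfolding \<beta>_def by (rule cmod_cinner_le)
      then show ?thesis using norm_defect_le[OF V', of "k h"] kh h1 abs_Im_le_cmod[of "\<beta> h"] by simp
    qed
    ultimately have "norm w \<le> \<bar>Im (cinner y (W h) + \<beta> h)\<bar> + 1" by simp
    then have "2 * c * norm w \<le> 2 * c * (\<bar>Im (cinner y (W h) + \<beta> h)\<bar> + 1)" using c by (intro mult_left_mono) auto
    also have "\<dots> \<le> s * (G h + (norm (defect V y - adj V (k h)))\<^sup>2) + 2 * c"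
      using all[of y h] by (simp add: distrib_left)
    also have "\<dots> \<le> s * 5 + 2 * c"
    proof -
      have "norm (defect U h) \<le> 1" using norm_defect_le[OF U, of h] h1 by simp
      then have d: "(norm (defect U h))\<^sup>2 \<le> 1" by (simp add: power_le_one)
      have "norm (defect V y - adj V (k h)) \<le> norm (defect V y) + norm (adj V (k h))" by (rule norm_triangle_ineq4)
      then have "norm (defect V y - adj V (k h)) \<le> 2"
        using y contrs_le[OF V', of "k h"] k_le[of h] \<open>norm (defect U h) \<le> 1\<close> by linarith
      then have "(norm (defect V y - adj V (k h)))\<^sup>2 \<le> 2\<^sup>2" by (rule power_mono) simp
      moreover have "(2::real)\<^sup>2 = 4" by simp
      ultimately have "G h + (norm (defect V y - adj V (k h)))\<^sup>2 \<le> 5"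
        using d zero_le_power2[of "norm (k h)"] unfolding G_def by linarith
      then show ?thesis using s by (simp add: mult_left_mono)
    qed
    finally show ?thesis using c by (simp add: C_def w_def field_simps)
  qed (use C in simp)
  have le: "norm (adj W y) \<le> C * norm (adj (defect V) y)" for y
  proof (rule field_le_epsilon)
    fix e :: real assume e: "0 < e"
    \<comment> \<open>Homogeneity reduces to \<open>unit\<close>, but \<open>D_V y\<close> may
      vanish; \<open>e / C\<close> keeps the normalizing factor positive.\<close>
    define d where "d = norm (defect V y) + e / C"
    have d: "0 < d" "norm (defect V y) \<le> d" using e C by (simp_all add: d_def add_nonneg_pos)
    have "norm (adj W ((1 / d) *\<^sub>R y)) \<le> C"
      using d by (intro unit) (simp add: op_scaleR[OF defect_ops[OF V]] divide_le_eq)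
    then have "norm (adj W y) \<le> C * d"
      using d by (simp add: op_scaleR[OF ops_adj[OF W_ops]] divide_le_eq)
    then show "norm (adj W y) \<le> C * norm (adj (defect V) y) + e"
      using C by (simp add: d_def distrib_left selfadj_adj[OF defect_selfadj[OF V]])
  qed
  obtain X where X: "X \<in> ops" "\<And>h. defect V (X h) = W h" "\<And>h. X h \<in> closure (range (adj (defect V)))"
    by (rule douglas_range[OF W_ops defect_ops[OF V] less_imp_le[OF C] le]) blast
  have XS: "X h \<in> defect_space V" for h
    using X(3)[of h] by (simp add: selfadj_adj[OF defect_selfadj[OF V]] defect_space_def)
  have UX: "U h = adj V h - defect V (X h)" for h by (simp add: X(2) W_def)
  define Y where "Y h = V (X h) + defect (adj V) h" for h
  \<comment> \<open>With \<open>v = D_V y\<close> the estimate extends to all \<open>v\<close> in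
    \<open>defect_space V\<close>. This space contains \<open>V* k\<close>, so the shifted variable
    \<open>z = v - V* k\<close> is arbitrary in it.\<close>
  have zest: "2 * c * \<bar>Im (cinner z (X h) + cinner (k h) (Y h))\<bar> \<le> s * (G h + (norm z)\<^sup>2)"
    if z: "z \<in> defect_space V" for z h
  proof -
    have "2 * c * \<bar>Im (cinner (v - adj V (k h)) (X h) + cinner (k h) (Y h))\<bar> \<le> s * (G h + (norm (v - adj V (k h)))\<^sup>2)"
      if v: "v \<in> defect_space V" for v
    proof (rule closed_le_defect_space[OF _ _ _ v,
          of "\<lambda>v. 2 * c * \<bar>Im (cinner (v - adj V (k h)) (X h) + cinner (k h) (Y h))\<bar>"
            "\<lambda>v. s * (G h + (norm (v - adj V (k h)))\<^sup>2)"])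
      fix y
      have "cinner (defect V y - adj V (k h)) (X h) + cinner (k h) (Y h) = cinner y (W h) + \<beta> h"
        by (simp add: Y_def \<beta>_def cinner_simps cinner_adj_left[OF Vop] defect_cinner[OF V] defect_cinner[OF V'] X(2))
      then show "2 * c * \<bar>Im (cinner (defect V y - adj V (k h)) (X h) + cinner (k h) (Y h))\<bar>
          \<le> s * (G h + (norm (defect V y - adj V (k h)))\<^sup>2)"
        using all[of y h] by simp
    qed (intro continuous_intros)+
    from this[of "z + adj V (k h)"] show ?thesis
      using csubspace_add[OF csubspace_defect_space[OF V] z contrs_adj_defect_space[OF V kS]] by simp
  qed
  have X0: "X h = 0" and Y0: "Im (cinner (k h) (Y h)) = 0" if "s = 0" for h
  proof -
    show i: "Im (cinner (k h) (Y h)) = 0"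
      using zest[OF csubspace_0[OF csubspace_defect_space[OF V]], of h] c that
      by (simp add: mult_le_0_iff)
    \<comment> \<open>For \<open>s = 0\<close> the right side of \<open>zest\<close> is zero, and at
      this \<open>z\<close> the imaginary part is \<open>(norm (X h))^2\<close>.\<close>
    have "Im (cinner (\<i> *\<^sub>C X h) (X h)) = 0"
      using zest[OF csubspace_scaleC[OF csubspace_defect_space[OF V] XS], of \<i> h h] c that i
      by (simp add: mult_le_0_iff)
    then show "X h = 0" by (simp add: cinner_scaleC_left cinner_self)
  qed
  have key: "s\<^sup>2 * (norm (k h))\<^sup>2 + c\<^sup>2 * (norm (X h))\<^sup>2 + 2 * (s * c) * \<bar>Im (cinner (k h) (Y h))\<bar>
      \<le> s\<^sup>2 * (norm (defect U h))\<^sup>2" for h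
  proof (cases "s = 0")
    case False
    then have s0: "0 < s" using s by simp
    define I where "I = Im (cinner (k h) (Y h))"
    \<comment> \<open>The sign aligns the two imaginary parts so that their moduli add;
      \<open>c / s\<close> is the length factor minimizing
      \<open>s * (norm z)^2 - 2 * c * norm z * norm (X h)\<close>.\<close>
    define \<epsilon> :: real where "\<epsilon> = (if 0 \<le> I then 1 else -1)"
    define z where "z = (\<i> * complex_of_real (\<epsilon> * (c / s))) *\<^sub>C X h"
    have "z \<in> defect_space V" unfolding z_def by (rule csubspace_scaleC[OF csubspace_defect_space[OF V] XS])
    then have est: "2 * c * \<bar>Im (cinner z (X h)) + I\<bar> \<le> s * (G h + (norm z)\<^sup>2)"
      using zest[of z h] by (simp add: I_def)
    have "Im (cinner z (X h)) = \<epsilon> * (c / s * (norm (X h))\<^sup>2)"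
      by (simp add: z_def cinner_scaleC_left cinner_self)
    moreover have "0 \<le> c / s * (norm (X h))\<^sup>2" using s0 c by simp
    ultimately have im: "\<bar>Im (cinner z (X h)) + I\<bar> = c / s * (norm (X h))\<^sup>2 + \<bar>I\<bar>"
      by (auto simp: \<epsilon>_def)
    have nz: "(norm z)\<^sup>2 = c\<^sup>2 / s\<^sup>2 * (norm (X h))\<^sup>2"
      by (simp add: z_def norm_scaleC norm_mult power_mult_distrib power_divide \<epsilon>_def norm_divide)
    have "s * (2 * c * (c / s * (norm (X h))\<^sup>2 + \<bar>I\<bar>)) \<le> s * (s * (G h + c\<^sup>2 / s\<^sup>2 * (norm (X h))\<^sup>2))"
      by (rule mult_left_mono[OF est[unfolded im nz] s])
    moreover have "s * (2 * c * (c / s * (norm (X h))\<^sup>2 + \<bar>I\<bar>)) = 2 * (c\<^sup>2 * (norm (X h))\<^sup>2) + 2 * (s * c) * \<bar>I\<bar>"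
      using s0 by (simp add: field_simps power2_eq_square)
    moreover have "s * (s * (G h + c\<^sup>2 / s\<^sup>2 * (norm (X h))\<^sup>2)) = s\<^sup>2 * (norm (defect U h))\<^sup>2 - s\<^sup>2 * (norm (k h))\<^sup>2 + c\<^sup>2 * (norm (X h))\<^sup>2"
      using s0 by (simp add: G_def field_simps power2_eq_square)
    ultimately have "2 * (c\<^sup>2 * (norm (X h))\<^sup>2) + 2 * (s * c) * \<bar>I\<bar>
        \<le> s\<^sup>2 * (norm (defect U h))\<^sup>2 - s\<^sup>2 * (norm (k h))\<^sup>2 + c\<^sup>2 * (norm (X h))\<^sup>2"
      by (simp only:)
    then show ?thesis unfolding I_def[symmetric] by simp
  qed (simp add: X0)
  have "c\<^sup>2 * (norm (X h))\<^sup>2 \<le> s\<^sup>2 * ((norm h)\<^sup>2 - (norm (U h))\<^sup>2)" for h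
  proof -
    have "0 \<le> s\<^sup>2 * (norm (k h))\<^sup>2" "0 \<le> 2 * (s * c) * \<bar>Im (cinner (k h) (Y h))\<bar>"
      using s c by simp_all
    then show ?thesis using key[of h] unfolding norm_defect[OF U] by linarith
  qed
  then have "ball_factor s c V U X"
    unfolding ball_factor_def using X(1) XS UX U by blast
  then show thesis
    by (rule that) (use key Y0 in \<open>simp_all add: k_def Y_def\<close>)
qed

text \<open>The converse of the optimization: \<open>2 a b \<le> a^2 + b^2\<close> with
  \<open>a = s * norm z\<close> and \<open>b = c * norm (X h)\<close> recovers the estimate for
  every \<open>z\<close>. For \<open>s = 0\<close> the vector \<open>X h\<close> vanishes and
  \<open>key0\<close> supplies what the factor \<open>s\<close> erases from
  \<open>key\<close>.\<close>

lemma dissipative_estimate: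
  assumes X: "ball_factor s c V U X" and c: "0 < c" and s: "0 \<le> s"
    and key: "s\<^sup>2 * (norm k)\<^sup>2 + c\<^sup>2 * (norm (X h))\<^sup>2
      + 2 * (s * c) * \<bar>Im (cinner k (V (X h) + defect (adj V) h))\<bar> \<le> s\<^sup>2 * (norm (defect U h))\<^sup>2"
    and key0: "s = 0 \<Longrightarrow> Im (cinner k (V (X h) + defect (adj V) h)) = 0"
  shows "2 * c * \<bar>Im (cinner y (adj V h - U h) + cinner (defect (adj V) k) h)\<bar>
      \<le> s * ((norm (defect U h))\<^sup>2 - (norm k)\<^sup>2 + (norm (defect V y - adj V k))\<^sup>2)"
proof -
  define z where "z = defect V y - adj V k"
  define I where "I = Im (cinner k (V (X h) + defect (adj V) h))"
  have UX: "U h = adj V h - defect V (X h)" using X by (auto simp: ball_factor_def)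
  have "cinner y (adj V h - U h) + cinner (defect (adj V) k) h = cinner z (X h) + cinner k (V (X h) + defect (adj V) h)"
    by (simp add: UX z_def cinner_simps cinner_adj_left[OF Vop] defect_cinner[OF V] defect_cinner[OF V'])
  then have im: "Im (cinner y (adj V h - U h) + cinner (defect (adj V) k) h) = Im (cinner z (X h)) + I"
    by (simp add: I_def)
  show ?thesis
  proof (cases "s = 0")
    case True
    have "c\<^sup>2 * (norm (X h))\<^sup>2 \<le> 0" using X True by (auto simp: ball_factor_def)
    then have "X h = 0" using c by (simp add: mult_le_0_iff)
    then show ?thesis using key0 True unfolding im by (simp add: I_def)
  next
    case False
    then have s0: "0 < s" using s by simp
    have "\<bar>Im (cinner z (X h)) + I\<bar> \<le> norm z * norm (X h) + \<bar>I\<bar>"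
      using abs_Im_le_cmod[of "cinner z (X h)"] cmod_cinner_le[of z "X h"] by linarith
    then have "s * (2 * c * \<bar>Im (cinner z (X h)) + I\<bar>) \<le> s * (2 * c * (norm z * norm (X h) + \<bar>I\<bar>))"
      using s c by (intro mult_left_mono) auto
    also have "\<dots> = 2 * (s * norm z) * (c * norm (X h)) + 2 * (s * c) * \<bar>I\<bar>"
      by (simp add: algebra_simps)
    also have "\<dots> \<le> (s * norm z)\<^sup>2 + (c * norm (X h))\<^sup>2 + 2 * (s * c) * \<bar>I\<bar>"
      using sum_squares_bound[of "s * norm z" "c * norm (X h)"] by simp
    also have "\<dots> \<le> s\<^sup>2 * (norm (defect U h))\<^sup>2 - s\<^sup>2 * (norm k)\<^sup>2 + s\<^sup>2 * (norm z)\<^sup>2"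
      using key by (simp add: I_def power_mult_distrib)
    also have "\<dots> = s * (s * ((norm (defect U h))\<^sup>2 - (norm k)\<^sup>2 + (norm z)\<^sup>2))"
      by (simp add: algebra_simps power2_eq_square)
    finally show ?thesis unfolding im z_def[symmetric] using s0 by (simp only: mult_le_cancel_left_pos)
  qed
qed

end

theorem theorem3p14:
  fixes T\<^sub>1 :: "'a::complex_hilbert \<Rightarrow> 'a \<times> 'b::complex_hilbert"
    and T\<^sub>1\<^sub>1 :: "'a \<Rightarrow> 'a"
    and V :: "'a \<Rightarrow> 'b"
    and T :: "'a \<times> 'b \<Rightarrow> 'a \<times> 'b"
    and \<phi> :: real
  assumes "symmetric_contraction T\<^sub>1"
    and "T\<^sub>1 = (\<lambda>f. (T\<^sub>1\<^sub>1 f, V (defect T\<^sub>1\<^sub>1 f)))"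
    and "V \<in> contractions UNIV UNIV"
    and "{f. defect T\<^sub>1\<^sub>1 f = 0} \<subseteq> {f. V f = 0}"
    and "T \<in> bounded_ops UNIV UNIV"
    and "extends T T\<^sub>1"
    and "0 \<le> \<phi>" and "\<phi> \<le> pi / 2"
  shows
    "(T \<in> Ext T\<^sub>1 (pi / 2) \<longleftrightarrow>
       (\<exists>U \<in> contractions UNIV UNIV.
        \<exists>K \<in> contractions (defect_space U) (defect_space (adj V)).
          block12 T = (\<lambda>h. defect T\<^sub>1\<^sub>1 (U h)) \<and>
          block22 T = (\<lambda>h. - V (adj T\<^sub>1\<^sub>1 (U h)) + defect (adj V) (K (defect U h)))))
     \<and> (\<forall>U \<in> operator_ball \<phi> V. U \<in> contractions UNIV UNIV \<and>
         (\<phi> < pi / 2 \<longrightarrow>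
           (\<exists>!Q. is_Q V U Q) \<and>
           {(x, Q_op V U x) | x. x \<in> defect_space U} = closure (Q0_graph V U)))
     \<and> (T \<in> Ext T\<^sub>1 \<phi> \<longleftrightarrow>
         (\<exists>U \<in> operator_ball \<phi> V.
            block12 T = (\<lambda>h. defect T\<^sub>1\<^sub>1 (U h)) \<and>
            (\<exists>K \<in> operator_hole \<phi> V U.
               block22 T = (\<lambda>h. - V (adj T\<^sub>1\<^sub>1 (U h)) + defect (adj V) (K (defect U h))))))"
proof -
  note V = assms(3) and T = assms(5)
  have T1: "T\<^sub>1 \<in> contrs" and sym: "cinner (T\<^sub>1 f) (g, 0) = cinner (f, 0) (T\<^sub>1 g)" for f g
    using assms(1) by (auto simp: symmetric_contraction_def)
  have T1f: "T\<^sub>1 f = (T\<^sub>1\<^sub>1 f, V (defect T\<^sub>1\<^sub>1 f))" for f using assms(2) by simp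
  have A_le: "norm (T\<^sub>1\<^sub>1 f) \<le> norm f" for f
  proof -
    have "norm (T\<^sub>1\<^sub>1 f) \<le> norm (T\<^sub>1 f)" using norm_fst_le[of "T\<^sub>1\<^sub>1 f" "V (defect T\<^sub>1\<^sub>1 f)"] by (simp add: T1f)
    then show ?thesis using contrs_le[OF T1, of f] by linarith
  qed
  have fst_T1: "T\<^sub>1\<^sub>1 f = fst (T\<^sub>1 f)" for f by (simp add: T1f)
  have A: "T\<^sub>1\<^sub>1 \<in> contrs"
  proof (rule contrsI[OF opsI[of _ 1] A_le])
    note op1 = contrs_ops[OF T1]
    show "T\<^sub>1\<^sub>1 (x + y) = T\<^sub>1\<^sub>1 x + T\<^sub>1\<^sub>1 y" for x y by (simp only: fst_T1 op_add[OF op1] fst_add)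
    show "T\<^sub>1\<^sub>1 (c *\<^sub>C x) = c *\<^sub>C T\<^sub>1\<^sub>1 x" for c x
      by (simp only: fst_T1 op_scaleC[OF op1] scaleC_prod_def fst_conv)
  qed (simp add: A_le)
  have A_sa: "selfadj T\<^sub>1\<^sub>1"
    unfolding selfadj_def using contrs_ops[OF A] sym by (simp add: T1f cinner_prod_def)
  interpret extension T\<^sub>1\<^sub>1 V
    by unfold_locales (use A A_sa V assms(4) in auto)
  let ?P = "\<lambda>U K. block12 T = (\<lambda>h. defect T\<^sub>1\<^sub>1 (U h)) \<and>
    block22 T = (\<lambda>h. - V (adj T\<^sub>1\<^sub>1 (U h)) + defect (adj V) (K (defect U h)))"
  have T_block: "T (f, h) = (T\<^sub>1\<^sub>1 f + block12 T h, V (defect T\<^sub>1\<^sub>1 f) + block22 T h)" for f h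
  proof -
    have "T (f, h) = T (f, 0) + T (0, h)" by (simp add: op_add[OF T, symmetric])
    also have "T (f, 0) = T\<^sub>1 f" using assms(6) by (simp add: extends_def)
    finally show ?thesis by (simp add: T1f block12_def block22_def prod_eq_iff)
  qed
  have T_le: "norm (T (0, h)) \<le> B * norm h" if "\<And>x. norm (T x) \<le> B * norm x" for B h
    using that[of "(0, h)"] by (simp add: norm_Pair)
  obtain B where B: "\<And>x. norm (T x) \<le> B * norm x" using op_bound[OF T] by blast
  have T0: "T (0, x + y) = T (0, x) + T (0, y)" "T (0, a *\<^sub>C x) = a *\<^sub>C T (0, x)" for x y a
    using op_add[OF T, of "(0, x)" "(0, y)"] op_scaleC[OF T, of a "(0, x)"]
    by (simp_all add: scaleC_prod_def)
  have T12: "block12 T \<in> ops"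
  proof (rule opsI[of _ B])
    show "norm (block12 T h) \<le> B * norm h" for h
      using T_le[OF B, of h] norm_fst_le[of "fst (T (0, h))" "snd (T (0, h))"] by (simp add: block12_def)
  qed (simp_all add: block12_def T0 scaleC_prod_def)
  have T22: "block22 T \<in> ops"
  proof (rule opsI[of _ B])
    show "norm (block22 T h) \<le> B * norm h" for h
      using T_le[OF B, of h] norm_snd_le[of "snd (T (0, h))" "fst (T (0, h))"] by (simp add: block22_def)
  qed (simp_all add: block22_def T0 scaleC_prod_def)
  have norm_pair: "(norm (a, b))\<^sup>2 = (norm a)\<^sup>2 + (norm b)\<^sup>2" for a :: 'a and b :: 'b
    by (simp add: norm_Pair)
  \<comment> \<open>Both sides of the criterion \<open>C_class_iff\<close> in terms of the
    parameters; this serves both directions.\<close>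
  have forms: "(norm (f, h))\<^sup>2 - (norm (T (f, h)))\<^sup>2 = (norm (defect U h))\<^sup>2 - (norm (K (defect U h)))\<^sup>2
        + (norm (defect V (defect T\<^sub>1\<^sub>1 f - T\<^sub>1\<^sub>1 (U h)) - adj V (K (defect U h))))\<^sup>2"
      "Im (cinner (T (f, h)) (f, h)) = Im (cinner (defect T\<^sub>1\<^sub>1 f - T\<^sub>1\<^sub>1 (U h)) (adj V h - U h)
        + cinner (defect (adj V) (K (defect U h))) h)"
    if "U \<in> contrs" "?P U K" for U K f h
    using form_identities[where f = f and U = U and h = h and k = "K (defect U h)"] that(2)
    by (simp_all add: T_block norm_pair cinner_prod_def norm_defect[OF that(1)] adjA)
  have Ext_iff: "T \<in> Ext T\<^sub>1 \<psi> \<longleftrightarrow> T \<in> C_class \<psi>" for \<psi>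
    using assms(6) by (simp add: Ext_def)
  have params: "\<exists>U\<in>contrs. (\<forall>h. U h \<in> defect_space T\<^sub>1\<^sub>1) \<and>
      (\<exists>K\<in>contractions (defect_space U) (defect_space (adj V)). ?P U K)"
    if le: "\<forall>x. norm (T x) \<le> norm x"
  proof -
    have "(norm (T\<^sub>1\<^sub>1 f + block12 T h))\<^sup>2 + (norm (V (defect T\<^sub>1\<^sub>1 f) + block22 T h))\<^sup>2 \<le> (norm f)\<^sup>2 + (norm h)\<^sup>2" for f h
      using power_mono[OF le[rule_format, of "(f, h)"], of 2] by (simp add: T_block norm_pair)
    then obtain U K where UK: "U \<in> contrs" "\<And>h. U h \<in> defect_space T\<^sub>1\<^sub>1"
      "K \<in> contractions (defect_space U) (defect_space (adj V))"
      and P: "\<And>h. block12 T h = defect T\<^sub>1\<^sub>1 (U h)"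
      "\<And>h. block22 T h = - V (T\<^sub>1\<^sub>1 (U h)) + defect (adj V) (K (defect U h))"
      by (rule contractive_parameters[OF T12 T22]) blast
    have "?P U K" by (simp add: fun_eq_iff P adjA)
    then show ?thesis using UK by blast
  qed
  have contractive: "\<forall>x. norm (T x) \<le> norm x"
    if "U \<in> contrs" "\<And>h. norm (K (defect U h)) \<le> norm (defect U h)" "?P U K" for U K
  proof clarify
    fix f h
    have "(norm (K (defect U h)))\<^sup>2 \<le> (norm (defect U h))\<^sup>2" by (intro power_mono that norm_ge_zero)
    then have "0 \<le> (norm (f, h))\<^sup>2 - (norm (T (f, h)))\<^sup>2"
      unfolding forms(1)[OF that(1,3)] by simp
    then have "(norm (T (f, h)))\<^sup>2 \<le> (norm (f, h))\<^sup>2" by linarith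
    then show "norm (T (f, h)) \<le> norm (f, h)" by (rule power2_le_imp_le) simp
  qed
  have half_pi: "T \<in> Ext T\<^sub>1 (pi / 2) \<longleftrightarrow> (\<forall>x. norm (T x) \<le> norm x)"
    unfolding Ext_iff using C_class_iff[OF T, of "pi / 2"] by (auto simp: power_mono)
  have i: "T \<in> Ext T\<^sub>1 (pi / 2) \<longleftrightarrow> (\<exists>U\<in>contrs. \<exists>K\<in>contractions (defect_space U) (defect_space (adj V)). ?P U K)"
    unfolding half_pi
  proof
    assume "\<forall>x. norm (T x) \<le> norm x"
    from params[OF this] show "\<exists>U\<in>contrs. \<exists>K\<in>contractions (defect_space U) (defect_space (adj V)). ?P U K"
      by blast
  next
    assume "\<exists>U\<in>contrs. \<exists>K\<in>contractions (defect_space U) (defect_space (adj V)). ?P U K"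
    then obtain U K where UK: "U \<in> contrs" "K \<in> contractions (defect_space U) (defect_space (adj V))" "?P U K"
      by blast
    show "\<forall>x. norm (T x) \<le> norm x"
      by (rule contractive[OF UK(1) _ UK(3)])
         (use UK(2) in \<open>simp add: contractions_iff[OF defect_space_nonempty] defect_in_space\<close>)
  qed
  show ?thesis
  \<comment> \<open>At \<open>\<pi>/2\<close> the ball and the hole consist of contractions by
    definition, so (ii) reduces to (i).\<close>
  proof (cases "\<phi> = pi / 2")
    case True
    have "operator_hole \<phi> V U = contractions (defect_space U) (defect_space (adj V))" for U
      by (simp add: True operator_hole_def contractions_def)
    then show ?thesis using i by (auto simp: True operator_ball_def)
  next
    case False
    define s c where "s = sin \<phi>" and "c = cos \<phi>"
    have \<phi>: "\<phi> < pi / 2" using False assms(8) by simp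
    have c: "0 < c" unfolding c_def using \<phi> assms(7) by (intro cos_gt_zero_pi) auto
    have s: "0 \<le> s" unfolding s_def using \<phi> assms(7) by (intro sin_ge_zero) auto
    have sc: "s\<^sup>2 + c\<^sup>2 = 1" by (simp add: s_def c_def)
    have s_pos: "0 < s" if "\<phi> \<noteq> 0" unfolding s_def using \<phi> assms(7) that by (intro sin_gt_zero) auto
    note ball = operator_ball_factor[OF V assms(7) \<phi>, folded s_def c_def]
    have element: "ball_element V U X s c" if "ball_factor s c V U X" for U X
      by unfold_locales (use that V c sc in auto)
    \<comment> \<open>One description for all angles below \<open>\<pi>/2\<close>. The clause for
      \<open>s = 0\<close> restores the condition that the factor \<open>s\<close> erases from the
      inequality, and contractivity of \<open>K\<close> is what the contractivity of
      \<open>T\<close> will be deduced from.\<close>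
    have hole: "K \<in> operator_hole \<phi> V U \<longleftrightarrow> K \<in> contractions (defect_space U) (defect_space (adj V)) \<and>
        (\<forall>h. s\<^sup>2 * (norm (K (defect U h)))\<^sup>2 + c\<^sup>2 * (norm (X h))\<^sup>2
          + 2 * (s * c) * \<bar>Im (cinner (K (defect U h)) (V (X h) + defect (adj V) h))\<bar> \<le> s\<^sup>2 * (norm (defect U h))\<^sup>2) \<and>
        (s = 0 \<longrightarrow> (\<forall>h. Im (cinner (K (defect U h)) (V (X h) + defect (adj V) h)) = 0))"
      if X: "ball_factor s c V U X" for U X K
    proof -
      interpret E: ball_element V U X s c by (rule element[OF X])
      show ?thesis
      proof (cases "\<phi> = 0")
        case True
        then have s0: "s = 0" by (simp add: s_def)
        have "X h = 0" for h using E.X_le[of h] c s0 by (simp add: mult_le_0_iff)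
        then show ?thesis using E.operator_hole_0_iff[OF s0, of K] by (simp add: True s0 E.Y_def)
      next
        case False
        note s0 = s_pos[OF False]
        have "K \<in> contractions (defect_space U) (defect_space (adj V))"
          if K: "K \<in> operator_hole \<phi> V U"
        proof -
          have Kb: "K \<in> bounded_ops (defect_space U) (defect_space (adj V))"
            using K by (simp add: operator_hole_def)
          note SU = csubspace_defect_space[OF E.U] closed_defect_space[of U]
          have le: "norm (K (proj (defect_space U) (defect U h))) \<le> norm (defect U h)" for h
          proof -
            have "s\<^sup>2 * (norm (K (defect U h)))\<^sup>2 + c\<^sup>2 * (norm (X h))\<^sup>2
              + 2 * (s * c) * \<bar>Im (cinner (K (defect U h)) (E.Y h))\<bar> \<le> s\<^sup>2 * (norm (defect U h))\<^sup>2"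
              using E.operator_hole_iff[of \<phi> K] K False assms(7) \<phi> by (simp add: s_def c_def)
            moreover have "0 \<le> c\<^sup>2 * (norm (X h))\<^sup>2" "0 \<le> 2 * (s * c) * \<bar>Im (cinner (K (defect U h)) (E.Y h))\<bar>"
              using s c by simp_all
            ultimately have "s\<^sup>2 * (norm (K (defect U h)))\<^sup>2 \<le> s\<^sup>2 * (norm (defect U h))\<^sup>2" by linarith
            then have "(norm (K (defect U h)))\<^sup>2 \<le> (norm (defect U h))\<^sup>2" using s0 by simp
            then show ?thesis
              unfolding proj_same[OF SU defect_in_space] by (rule power2_le_imp_le) simp
          qed
          have "norm (K x) \<le> norm x" if x: "x \<in> defect_space U" for x
            using closed_le_defect_space[OF continuous_on_norm[OF op_continuous[OF bounded_ops_proj[OF SU Kb]]]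
                continuous_on_norm[OF continuous_on_id] le x]
            by (simp add: proj_same[OF SU x])
          then show ?thesis using Kb by (simp add: contractions_iff[OF defect_space_nonempty])
        qed
        moreover have "K \<in> operator_hole \<phi> V U" if "K \<in> contractions (defect_space U) (defect_space (adj V))"
            "\<forall>h. s\<^sup>2 * (norm (K (defect U h)))\<^sup>2 + c\<^sup>2 * (norm (X h))\<^sup>2
              + 2 * (s * c) * \<bar>Im (cinner (K (defect U h)) (E.Y h))\<bar> \<le> s\<^sup>2 * (norm (defect U h))\<^sup>2"
          using E.operator_hole_iff[of \<phi> K] that False assms(7) \<phi>
          by (simp add: s_def c_def contractions_def)
        ultimately show ?thesis
          using E.operator_hole_iff[of \<phi> K] s0 False assms(7) \<phi>
          unfolding E.Y_def[symmetric] by (auto simp: s_def c_def)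
      qed
    qed
    have ii: "U \<in> contrs \<and> (\<exists>!Q. is_Q V U Q) \<and> {(x, Q_op V U x) | x. x \<in> defect_space U} = closure (Q0_graph V U)"
      if UB: "U \<in> operator_ball \<phi> V" for U
    proof -
      obtain X where "ball_factor s c V U X" using iffD1[OF ball UB] by blast
      then interpret ball_element V U X s c by (rule element)
      show ?thesis by (intro conjI U ex1_Q Q_graph_closure)
    qed
    have "T \<in> Ext T\<^sub>1 \<phi> \<longleftrightarrow> (\<exists>U\<in>operator_ball \<phi> V. \<exists>K\<in>operator_hole \<phi> V U. ?P U K)"
    proof
      assume "T \<in> Ext T\<^sub>1 \<phi>"
      then have le: "\<forall>x. norm (T x) \<le> norm x"
        and dis: "\<And>x. 2 * c * \<bar>Im (cinner (T x) x)\<bar> \<le> s * ((norm x)\<^sup>2 - (norm (T x))\<^sup>2)"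
        unfolding Ext_iff C_class_iff[OF T assms(7,8)] s_def c_def by blast+
      obtain U K where U: "U \<in> contrs" "\<And>h. U h \<in> defect_space T\<^sub>1\<^sub>1"
        and K: "K \<in> contractions (defect_space U) (defect_space (adj V))" and P: "?P U K"
        using params[OF le] by blast
      obtain X where X: "ball_factor s c V U X"
        "\<And>h. s\<^sup>2 * (norm (K (defect U h)))\<^sup>2 + c\<^sup>2 * (norm (X h))\<^sup>2
          + 2 * (s * c) * \<bar>Im (cinner (K (defect U h)) (V (X h) + defect (adj V) h))\<bar> \<le> s\<^sup>2 * (norm (defect U h))\<^sup>2"
        "\<And>h. s = 0 \<Longrightarrow> Im (cinner (K (defect U h)) (V (X h) + defect (adj V) h)) = 0"
        \<comment> \<open>The criterion at \<open>x = (f, h)\<close>, rewritten by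
          \<open>forms\<close>, is exactly the required estimate.\<close>
        by (rule dissipative_parameters[OF U K c s sc dis[of "(_, _)", unfolded forms[OF U(1) P]]]) blast
      have "U \<in> operator_ball \<phi> V" using X(1) by (intro iffD2[OF ball] exI)
      moreover have "K \<in> operator_hole \<phi> V U" using K X(2,3) by (intro iffD2[OF hole[OF X(1)]] conjI allI impI)
      ultimately show "\<exists>U\<in>operator_ball \<phi> V. \<exists>K\<in>operator_hole \<phi> V U. ?P U K" using P by blast
    next
      assume "\<exists>U\<in>operator_ball \<phi> V. \<exists>K\<in>operator_hole \<phi> V U. ?P U K"
      then obtain U K where UB: "U \<in> operator_ball \<phi> V" and KH: "K \<in> operator_hole \<phi> V U" and P: "?P U K"
        by blast
      obtain X where X: "ball_factor s c V U X" using iffD1[OF ball UB] by blast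
      have K: "K \<in> contractions (defect_space U) (defect_space (adj V))"
        and key: "\<And>h. s\<^sup>2 * (norm (K (defect U h)))\<^sup>2 + c\<^sup>2 * (norm (X h))\<^sup>2
          + 2 * (s * c) * \<bar>Im (cinner (K (defect U h)) (V (X h) + defect (adj V) h))\<bar> \<le> s\<^sup>2 * (norm (defect U h))\<^sup>2"
        and key0: "\<And>h. s = 0 \<Longrightarrow> Im (cinner (K (defect U h)) (V (X h) + defect (adj V) h)) = 0"
        using iffD1[OF hole[OF X] KH] by blast+
      have U: "U \<in> contrs" using X by (simp add: ball_factor_def)
      have "\<forall>x. norm (T x) \<le> norm x"
        by (rule contractive[OF U _ P])
           (use K in \<open>simp add: contractions_iff[OF defect_space_nonempty] defect_in_space\<close>)
      moreover have "2 * c * \<bar>Im (cinner (T x) x)\<bar> \<le> s * ((norm x)\<^sup>2 - (norm (T x))\<^sup>2)" for x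
      proof (cases x)
        case (Pair f h)
        show ?thesis unfolding Pair forms[OF U P]
          by (rule dissipative_estimate[OF X c s key key0])
      qed
      ultimately show "T \<in> Ext T\<^sub>1 \<phi>"
        unfolding Ext_iff C_class_iff[OF T assms(7,8)] s_def c_def by blast
    qed
    then have iii: "T \<in> Ext T\<^sub>1 \<phi> \<longleftrightarrow> (\<exists>U\<in>operator_ball \<phi> V. block12 T = (\<lambda>h. defect T\<^sub>1\<^sub>1 (U h)) \<and>
        (\<exists>K\<in>operator_hole \<phi> V U. block22 T = (\<lambda>h. - V (adj T\<^sub>1\<^sub>1 (U h)) + defect (adj V) (K (defect U h)))))"
      by (simp only: bex_simps)
    show ?thesis
      by (intro conjI ballI impI i iii) (rule ii[THEN conjunct1] ii[THEN conjunct2, THEN conjunct1]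
          ii[THEN conjunct2, THEN conjunct2]; assumption)+
  qed
qed

end
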